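(* There exist smooth scattering data $(u^\mu_\infty)$, $\mu\in\{0,1,2,3\}$, of arbitrary finite $\dot H^1$ norm, for which $\Box\phi=-\phi^5$ has a solution scattering to these data and a soliton. That is: for every $A\in(0,\infty)$ there exist a smooth finite-energy solution $u_\infty$ of the free wave equation $\Box u_\infty=0$ on $\mathbb R^{1+3}$, with $u^\mu_\infty:=\partial_\mu u_\infty$ satisfying $\sum_{\mu=0}^3\|u^\mu_\infty\|_{L^2(\{t=c\})}^2=A^2$ for all $c$, a time $T=T(u^\mu_\infty)$, and a solution $\phi$ of $\Box\phi=-\phi^5$ on $\{t>T\}\times\mathbb R^3$ such that for each $\mu\in\{0,1,2,3\}$ $$\big\|\partial_\mu(\phi-W)-u^\mu_\infty\big\|_{L^2(\{t=c\})}\to0\qquad\text{as }c\to\infty .$$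
   Context: $(t,x)\in\mathbb R^{1+3}$, $\partial_0=\partial_t$, $\partial_i=\partial_{x_i}$, $\Box=-\partial_t^2+\Delta$. $W(x)=(1+|x|^2/3)^{-1/2}$ is the ground state soliton, a stationary solution of $\Box\phi=-\phi^5$. *)

theory Defs
  imports "HOL-Analysis.Analysis"
begin

type_synonym spacetime = "real \<times> (real^3)"

text \<open>In the index type \<open>3\<close> of \<open>real^3\<close> the numeral \<open>3\<close> is the residue \<open>0\<close>, so \<open>of_nat\<close> maps
  the indices 1, 2, 3 bijectively onto the three coordinates.\<close>

definition coord_dir :: "nat \<Rightarrow> spacetime" where
  "coord_dir \<mu> = (if \<mu> = 0 then (1, 0) else (0, axis (of_nat \<mu>) 1))"

text \<open>Meaningful for \<open>\<mu> \<in> {0,1,2,3}\<close>.\<close>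

definition partial :: "nat \<Rightarrow> (spacetime \<Rightarrow> real) \<Rightarrow> spacetime \<Rightarrow> real" where
  "partial \<mu> f p = deriv (\<lambda>h. f (p + h *\<^sub>R coord_dir \<mu>)) 0"

text \<open>Only used for open \<open>S\<close>.\<close>

primrec Ck_on :: "nat \<Rightarrow> spacetime set \<Rightarrow> (spacetime \<Rightarrow> real) \<Rightarrow> bool" where
  "Ck_on 0 S f \<longleftrightarrow> continuous_on S f"
| "Ck_on (Suc k) S f \<longleftrightarrow>
     (\<forall>p\<in>S. f differentiable (at p)) \<and> (\<forall>\<mu>\<in>{0..3}. Ck_on k S (partial \<mu> f))"

definition smooth_on :: "spacetime set \<Rightarrow> (spacetime \<Rightarrow> real) \<Rightarrow> bool" where
  "smooth_on S f \<longleftrightarrow> (\<forall>k. Ck_on k S f)"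

definition wave_op :: "(spacetime \<Rightarrow> real) \<Rightarrow> spacetime \<Rightarrow> real" where
  "wave_op f p = - partial 0 (partial 0 f) p + (\<Sum>i=1..3. partial i (partial i f) p)"

definition soliton :: "real^3 \<Rightarrow> real" where
  "soliton x = (1 + (norm x)\<^sup>2 / 3) powr (-1/2)"

text \<open>\<open>slice_norm\<close> is junk (zero) when the square is not integrable, so it has to be
  accompanied by \<open>slice_L2\<close>.\<close>

definition slice_L2 :: "real \<Rightarrow> (spacetime \<Rightarrow> real) \<Rightarrow> bool" where
  "slice_L2 c f \<longleftrightarrow> (\<lambda>x. f (c, x)) \<in> borel_measurable lborel
     \<and> integrable lborel (\<lambda>x. (f (c, x))\<^sup>2)"

definition slice_norm :: "real \<Rightarrow> (spacetime \<Rightarrow> real) \<Rightarrow> real" where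
  "slice_norm c f = sqrt (LINT x|lborel. (f (c, x))\<^sup>2)"

definition free_wave :: "(spacetime \<Rightarrow> real) \<Rightarrow> bool" where
  "free_wave u \<longleftrightarrow> (\<forall>p. wave_op u p = 0)"

definition quintic_solution_after :: "real \<Rightarrow> (spacetime \<Rightarrow> real) \<Rightarrow> bool" where
  "quintic_solution_after T \<phi> \<longleftrightarrow> Ck_on 2 {p. T < fst p} \<phi>
     \<and> (\<forall>p. T < fst p \<longrightarrow> wave_op \<phi> p = - (\<phi> p ^ 5))"

end

theory Submission
  imports Defs "HOL-Computational_Algebra.Polynomial"
begin

text \<open>
  Take a radial free wave whose radiation profile \<open>F\<close> vanishes on \<open>[0, \<infinity>)\<close>, for instance
  \<open>u = (F (t + r) - F (t - r)) / r\<close> with \<open>F s = \<kappa> exp (1 / s)\<close> for \<open>s < 0\<close>. For \<open>t > 0\<close> it lives outside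
  the cone \<open>r = t\<close>, and we look for \<open>\<phi>\<close> that equals the soliton \<open>W\<close> inside that cone. Outside, put
  \<open>\<phi> = W + u + d / r\<close>. The equation for \<open>d\<close> is a characteristic problem with zero data on the cone
  \<open>r = t\<close> and at null infinity. In the coordinates \<open>a = r - t\<close>, \<open>z = 1 / (t + r)\<close> it becomes
  \<open>d\<^sub>a\<^sub>z = k (a, z, d)\<close> with \<open>k\<close> regular up to \<open>z = 0\<close> and \<open>|k| \<le> B / (L + a)\<^sup>2\<close>, where \<open>L\<close> grows as
  the strip \<open>0 \<le> z \<le> z\<^sub>0\<close> (late times) is made thinner. So it is solved by a contraction for
  data of any size, and no spectral information on the linearisation at \<open>W\<close> enters. The solution
  satisfies \<open>|\<partial> (d / r)| \<le> C / r\<^sup>2\<close> on \<open>r \<ge> t\<close>, which tends to zero in \<open>L\<^sup>2\<close>. The energy of \<open>u\<close> is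
  proportional to \<open>\<kappa>\<^sup>2\<close>.
\<close>

section \<open>Calculus of the coordinate derivatives\<close>

text \<open>The linearisation at \<open>W\<close> has an unstable mode, which a solution built
  forward in time would have to avoid. Posing the problem only on r > t removes it: there r
  \<open>W\<close> is at most sqrt 3, so \<open>W\<close> acts like any bounded radiation field and
  enters only through a Lipschitz constant. For v = r w the radial wave operator is (v_rr - v_tt) /
  r, and v_rr - v_tt = - 4 z^2 v_az. Solving for d_az leaves the factor 1 / (4 z^2 r^4) = 4 z^2 / (1
  + a z)^4 in front of the difference of quintics; this is where the regularity at z = 0 and the
  decay in a come from. Integrating from z = 0 gives the correction no radiation of its own, so the
  scattering data remain exactly those of u. Flatness of F at 0 makes the source vanish on the whole
  side a \<le> 0 of the cone and stay C^1 across it, so the two pieces of \<phi> match to second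
  order. F itself may tend to a nonzero constant at minus infinity: only F' has to be square
  integrable. The choice exp (1 / s) makes all derivatives, and the primitive of F'^2,
  explicit.\<close>

lemma partial_eq:
  assumes "(f has_derivative f') (at p)"
  shows "partial \<mu> f p = f' (coord_dir \<mu>)"
proof -
  let ?v = "coord_dir \<mu>"
  have lin: "bounded_linear f'" using assms has_derivative_bounded_linear by blast
  have "((\<lambda>h::real. p + h *\<^sub>R ?v) has_derivative (\<lambda>h. h *\<^sub>R ?v)) (at 0)"
    by (auto intro!: derivative_eq_intros)
  moreover have "(f has_derivative f') (at (p + (0::real) *\<^sub>R ?v))" using assms by simp
  ultimately have "((\<lambda>h::real. f (p + h *\<^sub>R ?v)) has_derivative (\<lambda>h. f' (h *\<^sub>R ?v))) (at 0)"
    by (rule has_derivative_compose)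
  moreover have "(\<lambda>h. f' (h *\<^sub>R ?v)) = (\<lambda>h. h * f' ?v)"
    by (simp add: linear_cmul bounded_linear.linear[OF lin])
  ultimately have "((\<lambda>h::real. f (p + h *\<^sub>R ?v)) has_field_derivative f' ?v) (at 0)"
    by (simp add: has_field_derivative_def mult.commute[of _ "f' ?v"])
  then show ?thesis unfolding partial_def by (rule DERIV_imp_deriv)
qed

lemma partial_cong:
  assumes "open S" "p \<in> S" "\<And>q. q \<in> S \<Longrightarrow> f q = g q"
  shows "partial \<mu> f p = partial \<mu> g p"
proof -
  have "((\<lambda>h::real. p + h *\<^sub>R coord_dir \<mu>) \<longlongrightarrow> p + 0 *\<^sub>R coord_dir \<mu>) (nhds 0)"
    by (intro tendsto_intros filterlim_ident)
  then have "((\<lambda>h::real. p + h *\<^sub>R coord_dir \<mu>) \<longlongrightarrow> p) (nhds 0)" by simp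
  then have "\<forall>\<^sub>F h in nhds 0. p + h *\<^sub>R coord_dir \<mu> \<in> S"
    using assms(1,2) by (rule topological_tendstoD)
  then have "\<forall>\<^sub>F h in nhds 0. f (p + h *\<^sub>R coord_dir \<mu>) = g (p + h *\<^sub>R coord_dir \<mu>)"
    by eventually_elim (use assms(3) in auto)
  then show ?thesis unfolding partial_def by (intro deriv_cong_ev) auto
qed

lemma Ck_on_cong:
  assumes "open S" "\<And>q. q \<in> S \<Longrightarrow> f q = g q" "Ck_on k S f"
  shows "Ck_on k S g"
  using assms(2,3)
proof (induction k arbitrary: f g)
  case 0
  then show ?case using continuous_on_cong[of S S f g] by auto
next
  case (Suc k)
  show ?case unfolding Ck_on.simps
  proof (intro conjI ballI)
    fix p assume "p \<in> S"
    with Suc.prems have "f differentiable (at p)" by simp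
    then show "g differentiable (at p)"
      using \<open>p \<in> S\<close> assms(1) Suc.prems(1) unfolding differentiable_def
      by (metis has_derivative_transform_within_open)
  next
    fix \<mu> :: nat assume "\<mu> \<in> {0..3}"
    then have "Ck_on k S (partial \<mu> f)" using Suc.prems by simp
    then show "Ck_on k S (partial \<mu> g)"
      by (rule Suc.IH[rotated]) (use Suc.prems(1) assms(1) in \<open>auto intro: partial_cong\<close>)
  qed
qed

lemma Ck_on_SucI:
  assumes "open S" "\<And>p. p \<in> S \<Longrightarrow> (f has_derivative f' p) (at p)"
    "\<And>\<mu>. \<mu> \<in> {0..3} \<Longrightarrow> Ck_on k S (\<lambda>p. f' p (coord_dir \<mu>))"
  shows "Ck_on (Suc k) S f"
  unfolding Ck_on.simps
proof (intro conjI ballI)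
  show "f differentiable (at p)" if "p \<in> S" for p
    using assms(2)[OF that] differentiable_def by blast
  show "Ck_on k S (partial \<mu> f)" if "\<mu> \<in> {0..3}" for \<mu>
    by (rule Ck_on_cong[OF assms(1) _ assms(3)[OF that]]) (use partial_eq assms(2) in metis)
qed

lemma Ck_on_mono: "Ck_on k S f \<Longrightarrow> S' \<subseteq> S \<Longrightarrow> Ck_on k S' f"
  by (induction k arbitrary: f) (auto intro: continuous_on_subset)

lemma Ck_on_Suc_imp: "Ck_on (Suc k) S f \<Longrightarrow> Ck_on k S f"
proof (induction k arbitrary: f)
  case 0
  then show ?case
    by (metis Ck_on.simps differentiable_imp_continuous_within continuous_at_imp_continuous_on)
next
  case (Suc k)
  then show ?case by (metis Ck_on.simps(2))
qed

lemma Ck_on_imp_continuous_on: "Ck_on k S f \<Longrightarrow> continuous_on S f"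
  by (induction k) (auto dest: Ck_on_Suc_imp simp del: Ck_on.simps(2))

text \<open>Every clause of \<open>Ck_on\<close> is local on open sets. This glues the inside of the
  light cone to a neighbourhood of its outside.\<close>

lemma Ck_on_Un:
  assumes "open S" "open S'" "Ck_on k S f" "Ck_on k S' f"
  shows "Ck_on k (S \<union> S') f"
  using assms(3,4)
  by (induction k arbitrary: f) (auto intro: continuous_on_open_Un assms(1,2))

lemma Ck_on_const: "open S \<Longrightarrow> Ck_on k S (\<lambda>_. c)"
proof (induction k arbitrary: c)
  case (Suc k)
  show ?case by (rule Ck_on_SucI[where f'="\<lambda>_ _. 0"]) (use Suc in auto)
qed simp

lemma Ck_on_linear:
  assumes "open S" "bounded_linear f"
  shows "Ck_on k S f"
proof (cases k)
  case 0
  then show ?thesis using assms by (simp add: linear_continuous_on)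
next
  case (Suc j)
  show ?thesis unfolding Suc
    by (rule Ck_on_SucI[where f'="\<lambda>_. f"])
       (use assms in \<open>auto intro!: Ck_on_const bounded_linear_imp_has_derivative\<close>)
qed

lemma partial_add:
  assumes "f differentiable (at p)" "g differentiable (at p)"
  shows "partial \<mu> (\<lambda>p. f p + g p) p = partial \<mu> f p + partial \<mu> g p"
proof -
  obtain f' g' where d: "(f has_derivative f') (at p)" "(g has_derivative g') (at p)"
    using assms by (auto simp: differentiable_def)
  show ?thesis using partial_eq[OF has_derivative_add[OF d]] partial_eq[OF d(1)] partial_eq[OF d(2)]
    by simp
qed

lemma partial_mult:
  assumes "f differentiable (at p)" "g differentiable (at p)"
  shows "partial \<mu> (\<lambda>p. f p * g p) p = f p * partial \<mu> g p + partial \<mu> f p * g p"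
proof -
  obtain f' g' where d: "(f has_derivative f') (at p)" "(g has_derivative g') (at p)"
    using assms by (auto simp: differentiable_def)
  show ?thesis using partial_eq[OF has_derivative_mult[OF d]] partial_eq[OF d(1)] partial_eq[OF d(2)]
    by simp
qed

lemma Ck_on_add:
  assumes "open S" "Ck_on k S f" "Ck_on k S g"
  shows "Ck_on k S (\<lambda>p. f p + g p)"
  using assms(2,3)
proof (induction k arbitrary: f g)
  case 0
  then show ?case by (auto intro: continuous_intros)
next
  case (Suc k)
  have "Ck_on k S (partial \<mu> (\<lambda>p. f p + g p))" if "\<mu> \<in> {0..3}" for \<mu>
    by (rule Ck_on_cong[OF assms(1) _ Suc.IH[of "partial \<mu> f" "partial \<mu> g"]])
       (use Suc.prems that in \<open>auto simp: partial_add\<close>)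
  then show ?case using Suc.prems by auto
qed

lemma Ck_on_mult:
  assumes "open S" "Ck_on k S f" "Ck_on k S g"
  shows "Ck_on k S (\<lambda>p. f p * g p)"
  using assms(2,3)
proof (induction k arbitrary: f g)
  case 0
  then show ?case by (auto intro: continuous_intros)
next
  case (Suc k)
  have "Ck_on k S (partial \<mu> (\<lambda>p. f p * g p))" if "\<mu> \<in> {0..3}" for \<mu>
  proof (rule Ck_on_cong[OF assms(1)])
    show "Ck_on k S (\<lambda>p. f p * partial \<mu> g p + partial \<mu> f p * g p)"
      using Suc.prems that
      by (intro Ck_on_add[OF assms(1)] Suc.IH) (auto dest: Ck_on_Suc_imp simp del: Ck_on.simps, auto)
    show "f q * partial \<mu> g q + partial \<mu> f q * g q = partial \<mu> (\<lambda>p. f p * g p) q" if "q \<in> S" for q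
      using Suc.prems that by (simp add: partial_mult)
  qed
  then show ?case using Suc.prems by auto
qed

lemma wave_op_add:
  assumes "open S" "p \<in> S" "Ck_on 2 S f" "Ck_on 2 S g"
  shows "wave_op (\<lambda>q. f q + g q) p = wave_op f p + wave_op g p"
proof -
  have "partial \<mu> (partial \<mu> (\<lambda>q. f q + g q)) p = partial \<mu> (partial \<mu> f) p + partial \<mu> (partial \<mu> g) p"
    if "\<mu> \<in> {0..3}" for \<mu>
  proof -
    have "partial \<mu> (partial \<mu> (\<lambda>q. f q + g q)) p = partial \<mu> (\<lambda>q. partial \<mu> f q + partial \<mu> g q) p"
      using assms by (intro partial_cong[OF assms(1,2)] partial_add) (auto simp: numeral_2_eq_2)
    also have "\<dots> = partial \<mu> (partial \<mu> f) p + partial \<mu> (partial \<mu> g) p"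
      using assms that by (intro partial_add) (auto simp: numeral_2_eq_2)
    finally show ?thesis .
  qed
  then show ?thesis by (simp add: wave_op_def sum.distrib)
qed

lemma coord_dir_inner: "\<mu> \<in> {1..3} \<Longrightarrow> x \<bullet> snd (coord_dir \<mu>) = x $ of_nat \<mu>"
  by (auto simp: coord_dir_def inner_axis)

lemma fst_coord_dir: "fst (coord_dir \<mu>) = (if \<mu> = 0 then 1 else 0)"
  by (simp add: coord_dir_def)

lemma snd_coord_dir_0: "snd (coord_dir 0) = 0"
  by (simp add: coord_dir_def)

lemma sum_coord_squares: "(\<Sum>i=1..3. (x $ of_nat i)\<^sup>2) = (norm (x::real^3))\<^sup>2"
proof -
  have "{1..3::nat} = {1,2,3}" by auto
  then show ?thesis
    by (simp add: norm_eq_sqrt_inner inner_vec_def sum_3 power2_eq_square)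
qed

lemma bounded_linear_coord: "bounded_linear (\<lambda>p::spacetime. snd p $ i)"
  using bounded_linear_compose[OF bounded_linear_vec_nth bounded_linear_snd] .

section \<open>Radial functions on spacetime\<close>

lemma has_derivative_norm_snd:
  fixes p :: spacetime
  assumes "snd p \<noteq> 0"
  shows "((\<lambda>p::spacetime. norm (snd p)) has_derivative (\<lambda>h. (snd p \<bullet> snd h) / norm (snd p))) (at p)"
proof -
  have "((\<lambda>p::spacetime. snd p) has_derivative snd) (at p)"
    by (auto intro!: derivative_eq_intros)
  from has_derivative_compose[OF this has_derivative_norm[OF assms]]
  show ?thesis by (simp add: sgn_div_norm divide_inverse inner_commute mult.commute)
qed

text \<open>Writing the radial derivative as \<open>b * norm x\<close> cancels the division by the
  radius in the gradient, so that one formula covers the axis x = 0 as well. This is what makes the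
  spherical waves below smooth there.\<close>

lemma has_derivative_norm_lift:
  fixes g :: "real \<times> real \<Rightarrow> real"
  assumes "(g has_derivative (\<lambda>h. a * fst h + b * norm x * snd h)) (at (t, norm x))"
  shows "((\<lambda>p::spacetime. g (fst p, norm (snd p))) has_derivative
           (\<lambda>h. a * fst h + b * (x \<bullet> snd h))) (at (t, x))"
proof (cases "x = 0")
  case False
  have n: "((\<lambda>p::spacetime. norm (snd p)) has_derivative (\<lambda>h. (x \<bullet> snd h) / norm x)) (at (t, x))"
    using has_derivative_norm_snd[of "(t, x)"] False by simp
  have "((\<lambda>p::spacetime. (fst p, norm (snd p))) has_derivative (\<lambda>h. (fst h, (x \<bullet> snd h) / norm x))) (at (t, x))"
    by (intro has_derivative_Pair n) (auto intro!: derivative_eq_intros)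
  from has_derivative_compose[OF this, of g "\<lambda>h. a * fst h + b * norm x * snd h"] assms False
  show ?thesis by (simp add: mult.assoc)
next
  case True
  have "((\<lambda>h. norm (g ((t,0) + h) - g (t,0) - a * fst h) / norm h) \<longlongrightarrow> 0) (at 0)"
    using assms True by (simp add: has_derivative_at)
  \<comment> \<open>On the axis the radial derivative is zero, and the increment of the lifted
    function at h is that of \<open>g\<close> at (fst h, |snd h|), a vector of the same norm as h.
    The limit therefore transfers by substitution.\<close>
  moreover have "filterlim (\<lambda>h::spacetime. (fst h, norm (snd h))) (at 0) (at 0)"
    unfolding filterlim_at
  proof
    show "\<forall>\<^sub>F h::spacetime in at 0. (fst h, norm (snd h)) \<in> UNIV \<and> (fst h, norm (snd h)) \<noteq> 0"
      by (auto simp: eventually_at zero_prod_def prod_eq_iff intro!: exI[of _ 1])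
    have "isCont (\<lambda>h::spacetime. (fst h, norm (snd h))) 0" by (intro continuous_intros)
    then show "((\<lambda>h::spacetime. (fst h, norm (snd h))) \<longlongrightarrow> 0) (at 0)"
      by (simp add: isCont_def zero_prod_def)
  qed
  from filterlim_compose[OF calculation this]
  have "((\<lambda>h::spacetime. norm (g ((t,0) + (fst h, norm (snd h))) - g (t,0) - a * fst h)
      / norm (fst h, norm (snd h))) \<longlongrightarrow> 0) (at 0)"
    by simp
  moreover have "bounded_linear (\<lambda>h::spacetime. a * fst h)"
    by (intro bounded_linear_intros)
  ultimately show ?thesis using True
    by (simp add: has_derivative_at norm_prod_def)
qed

text \<open>Chain rule off the axis. The partials are supplied as explicit functions, so
  second-order regularity reduces to continuity of the four second ones. In the Laplacian, summing
  1/r - x_i^2/r^3 over the coordinates yields the first-order term 2/r.\<close>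

lemma radial_C2:
  fixes g gt gr gtt gtr grt grr :: "real \<times> real \<Rightarrow> real"
  defines "R \<equiv> (\<lambda>p::spacetime. (fst p, norm (snd p)))"
  assumes "open S" and nz: "\<And>p. p \<in> S \<Longrightarrow> snd p \<noteq> 0"
    and g: "\<And>p. p \<in> S \<Longrightarrow> (g has_derivative (\<lambda>h. gt (R p) * fst h + gr (R p) * snd h)) (at (R p))"
    and gt: "\<And>p. p \<in> S \<Longrightarrow> (gt has_derivative (\<lambda>h. gtt (R p) * fst h + gtr (R p) * snd h)) (at (R p))"
    and gr: "\<And>p. p \<in> S \<Longrightarrow> (gr has_derivative (\<lambda>h. grt (R p) * fst h + grr (R p) * snd h)) (at (R p))"
    and cont: "continuous_on S (\<lambda>p. gtt (R p))" "continuous_on S (\<lambda>p. gtr (R p))"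
      "continuous_on S (\<lambda>p. grt (R p))" "continuous_on S (\<lambda>p. grr (R p))"
  shows "Ck_on 2 S (\<lambda>p. g (R p))"
    and "\<And>p. p \<in> S \<Longrightarrow> partial 0 (\<lambda>p. g (R p)) p = gt (R p)"
    and "\<And>p i. p \<in> S \<Longrightarrow> i \<in> {1..3} \<Longrightarrow>
      partial i (\<lambda>p. g (R p)) p = gr (R p) * (snd p $ of_nat i / norm (snd p))"
    and "\<And>p. p \<in> S \<Longrightarrow> wave_op (\<lambda>p. g (R p)) p = - gtt (R p) + grr (R p) + 2 * gr (R p) / norm (snd p)"
proof -
  have lift: "((\<lambda>p. G (R p)) has_derivative (\<lambda>h. a * fst h + b / norm (snd p) * (snd p \<bullet> snd h))) (at p)"
    if "(G has_derivative (\<lambda>h. a * fst h + b * snd h)) (at (R p))" "p \<in> S" for G a b p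
    using has_derivative_norm_lift[of G a "b / norm (snd p)" "snd p" "fst p"] that nz[OF that(2)]
    by (simp add: R_def)
  note lg = lift[OF g] and lgt = lift[OF gt] and lgr = lift[OF gr]
  show p0: "partial 0 (\<lambda>p. g (R p)) p = gt (R p)" if "p \<in> S" for p
    using partial_eq[OF lg[OF that that]] by (simp add: fst_coord_dir snd_coord_dir_0)
  show pi: "partial i (\<lambda>p. g (R p)) p = gr (R p) * (snd p $ of_nat i / norm (snd p))"
    if "p \<in> S" "i \<in> {1..3}" for p i
    using partial_eq[OF lg[OF that(1) that(1)], of i] that(2) by (simp add: fst_coord_dir coord_dir_inner)
  have inv: "((\<lambda>p::spacetime. snd p $ of_nat i / norm (snd p)) has_derivative
     (\<lambda>h. snd h $ of_nat i / norm (snd p) - snd p $ of_nat i * (snd p \<bullet> snd h) / norm (snd p) ^ 3)) (at p)"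
    if "p \<in> S" for p i
    using nz[OF that]
    by (auto intro!: derivative_eq_intros has_derivative_norm_snd
        bounded_linear_imp_has_derivative[OF bounded_linear_coord]
        simp: field_simps power3_eq_cube)
  have Rc: "continuous_on S (\<lambda>p. G (R p))"
    if "\<And>p. p \<in> S \<Longrightarrow> (G has_derivative (\<lambda>h. a p * fst h + b p * snd h)) (at (R p))" for G a b
    using lift[OF that] has_derivative_continuous continuous_at_imp_continuous_on by blast
  have C0: "Ck_on 0 S (\<lambda>p. snd p $ of_nat i / norm (snd p))" for i
    using nz by (auto intro!: continuous_intros)
  have C1: "Ck_on (Suc 0) S (\<lambda>p. snd p $ of_nat i / norm (snd p))" for i
    by (rule Ck_on_SucI[OF \<open>open S\<close> inv]) (use nz in \<open>auto intro!: continuous_intros\<close>)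
  have Cgt: "Ck_on (Suc 0) S (\<lambda>p. gt (R p))"
    by (rule Ck_on_SucI[OF \<open>open S\<close> lgt]) (use nz cont in \<open>auto intro!: continuous_intros\<close>)
  have Cgr: "Ck_on (Suc 0) S (\<lambda>p. gr (R p))"
    by (rule Ck_on_SucI[OF \<open>open S\<close> lgr]) (use nz cont in \<open>auto intro!: continuous_intros\<close>)
  have diff: "(\<lambda>p. g (R p)) differentiable (at p)" if "p \<in> S" for p
    using lg[OF that that] differentiable_def by blast
  have "Ck_on (Suc 0) S (partial \<mu> (\<lambda>p. g (R p)))" if "\<mu> \<in> {0..3}" for \<mu>
  proof (cases "\<mu> = 0")
    case True
    show ?thesis unfolding True by (rule Ck_on_cong[OF \<open>open S\<close> _ Cgt]) (simp add: p0)
  next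
    case False
    then have "\<mu> \<in> {1..3}" using that by auto
    show ?thesis by (rule Ck_on_cong[OF \<open>open S\<close> _ Ck_on_mult[OF \<open>open S\<close> Cgr C1[of \<mu>]]])
        (use pi[OF _ \<open>\<mu> \<in> {1..3}\<close>] in simp)
  qed
  then show "Ck_on 2 S (\<lambda>p. g (R p))"
    using diff by (simp add: numeral_2_eq_2 del: One_nat_def)
  show "wave_op (\<lambda>p. g (R p)) p = - gtt (R p) + grr (R p) + 2 * gr (R p) / norm (snd p)"
    if "p \<in> S" for p
  proof -
    let ?r = "norm (snd p)"
    have r: "?r \<noteq> 0" using nz[OF that] by simp
    have "partial 0 (partial 0 (\<lambda>p. g (R p))) p = partial 0 (\<lambda>p. gt (R p)) p"
      by (rule partial_cong[OF \<open>open S\<close> that p0])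
    also have "\<dots> = gtt (R p)"
      using partial_eq[OF lgt[OF that that]] by (simp add: fst_coord_dir snd_coord_dir_0)
    finally have 0: "partial 0 (partial 0 (\<lambda>p. g (R p))) p = gtt (R p)" .
    have "partial i (partial i (\<lambda>p. g (R p))) p =
        grr (R p) / ?r^2 * (snd p $ of_nat i)^2 + gr (R p) * (1 / ?r - (snd p $ of_nat i)^2 / ?r^3)"
      if i: "i \<in> {1..3}" for i
    proof -
      have "partial i (partial i (\<lambda>p. g (R p))) p = partial i (\<lambda>p. gr (R p) * (snd p $ of_nat i / norm (snd p))) p"
        by (rule partial_cong[OF \<open>open S\<close> \<open>p \<in> S\<close>]) (rule pi[OF _ i])
      also have "\<dots> = gr (R p) * partial i (\<lambda>p. snd p $ of_nat i / norm (snd p)) p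
           + partial i (\<lambda>p. gr (R p)) p * (snd p $ of_nat i / ?r)"
        using lgr[OF \<open>p \<in> S\<close> \<open>p \<in> S\<close>] inv[OF \<open>p \<in> S\<close>] by (intro partial_mult) (auto simp: differentiable_def)
      also have "partial i (\<lambda>p. gr (R p)) p = grr (R p) / ?r * snd p $ of_nat i"
        using partial_eq[OF lgr[OF \<open>p \<in> S\<close> \<open>p \<in> S\<close>], of i] i by (simp add: fst_coord_dir coord_dir_inner)
      also have "partial i (\<lambda>p. snd p $ of_nat i / norm (snd p)) p = 1 / ?r - (snd p $ of_nat i)^2 / ?r^3"
        using partial_eq[OF inv[OF \<open>p \<in> S\<close>], of i i] i coord_dir_inner[OF i, of "snd p"]
        by (simp add: power2_eq_square coord_dir_def)
      finally show ?thesis using r by (simp add: power2_eq_square algebra_simps)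
    qed
    then have "(\<Sum>i=1..3. partial i (partial i (\<lambda>p. g (R p))) p)
       = (\<Sum>i=1..3. grr (R p) / ?r^2 * (snd p $ of_nat i)^2 + gr (R p) * (1 / ?r - (snd p $ of_nat i)^2 / ?r^3))"
      by (intro sum.cong) auto
    also have "\<dots> = grr (R p) / ?r^2 * (\<Sum>i=1..3. (snd p $ of_nat i)^2)
       + gr (R p) * (3 / ?r - (\<Sum>i=1..3. (snd p $ of_nat i)^2) / ?r^3)"
      by (simp add: sum.distrib sum_distrib_left sum_subtractf sum_divide_distrib right_diff_distrib)
    also have "\<dots> = grr (R p) + 2 * gr (R p) / ?r"
      unfolding sum_coord_squares using r by (simp add: field_simps power2_eq_square power3_eq_cube)
    finally show ?thesis by (simp add: wave_op_def 0)
  qed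
qed

section \<open>Integration of radial functions\<close>

text \<open>Both measures give the half-line up to a the volume K a^3 of a ball, and half-lines
  generate the Borel sets and are stable under intersection. This takes the place of polar
  coordinates with a surface measure.\<close>

lemma distr_norm_lborel:
  fixes K :: real
  defines "K \<equiv> unit_ball_vol 3"
  shows "distr lborel borel (norm :: real^3 \<Rightarrow> real)
    = density lborel (\<lambda>r. ennreal (3 * K * r\<^sup>2) * indicator {0..} r)"
proof (rule measure_eqI_generator_eq[where E="range atMost" and \<Omega>=UNIV and A="\<lambda>i. {..real i}"])
  have K: "K \<ge> 0" by (simp add: K_def)
  show "Int_stable (range (atMost :: real \<Rightarrow> _))"
    by (auto simp: Int_stable_def)
  show "sets (distr lborel borel (norm :: real^3 \<Rightarrow> real)) = sigma_sets UNIV (range atMost)"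
    by (simp add: borel_eq_atMost)
  show "sets (density lborel (\<lambda>r. ennreal (3 * K * r\<^sup>2) * indicator {0..} r)) = sigma_sets UNIV (range atMost)"
    by (simp add: borel_eq_atMost)
  show "(\<Union>i. {..real i}) = UNIV"
    using real_arch_simple by auto
  have d: "emeasure (distr lborel borel (norm :: real^3 \<Rightarrow> real)) {..a} = (if a \<ge> 0 then ennreal (K * a ^ 3) else 0)"
    for a
  proof -
    have "(norm :: real^3 \<Rightarrow> real) -` {..a} = cball 0 a" by auto
    then show ?thesis by (simp add: emeasure_distr emeasure_cball K_def)
  qed
  then show "emeasure (distr lborel borel (norm :: real^3 \<Rightarrow> real)) {..real i} \<noteq> \<infinity>" for i
    by simp
  fix X assume "X \<in> range (atMost :: real \<Rightarrow> _)"
  then obtain a where X: "X = {..a}" by auto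
  have "emeasure (density lborel (\<lambda>r. ennreal (3 * K * r\<^sup>2) * indicator {0..} r)) {..a}
     = (\<integral>\<^sup>+r. ennreal (3 * K * r\<^sup>2) * indicator {0..a} r \<partial>lborel)"
    by (subst emeasure_density) (auto intro!: nn_integral_cong simp: indicator_def)
  also have "\<dots> = (if a \<ge> 0 then ennreal (K * a ^ 3) else 0)"
  proof (cases "a \<ge> 0")
    case True
    have "(\<integral>\<^sup>+r. ennreal (3 * K * r\<^sup>2) * indicator {0..a} r \<partial>lborel) = ennreal (K * a ^ 3 - K * 0 ^ 3)"
      by (rule nn_integral_FTC_Icc) (use K True in \<open>auto intro!: derivative_eq_intros\<close>)
    with True show ?thesis by simp
  qed auto
  finally show "emeasure (distr lborel borel (norm :: real^3 \<Rightarrow> real)) X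
     = emeasure (density lborel (\<lambda>r. ennreal (3 * K * r\<^sup>2) * indicator {0..} r)) X"
    unfolding X d by simp
qed auto

lemma nn_integral_radial:
  fixes f :: "real \<Rightarrow> ennreal"
  assumes [measurable]: "f \<in> borel_measurable borel"
  shows "(\<integral>\<^sup>+x. f (norm (x::real^3)) \<partial>lborel)
    = (\<integral>\<^sup>+r. ennreal (3 * unit_ball_vol 3 * r\<^sup>2) * indicator {0..} r * f r \<partial>lborel)"
proof -
  have "(\<integral>\<^sup>+x. f (norm (x::real^3)) \<partial>lborel) = (\<integral>\<^sup>+r. f r \<partial>distr lborel borel (norm :: real^3 \<Rightarrow> real))"
    by (simp add: nn_integral_distr)
  also have "\<dots> = (\<integral>\<^sup>+r. ennreal (3 * unit_ball_vol 3 * r\<^sup>2) * indicator {0..} r * f r \<partial>lborel)"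
    unfolding distr_norm_lborel by (subst nn_integral_density) auto
  finally show ?thesis .
qed

section \<open>Total derivatives and integrals with a parameter\<close>

text \<open>The criterion is asymmetric: the second partial must exist nearby and be continuous, the
  first need only exist at the point. For the primitives below, the second partial is always the one
  whose continuity is at hand.\<close>

lemma C1_has_derivative:
  fixes g gx gy :: "real \<times> real \<Rightarrow> real"
  assumes "open S" "p \<in> S"
    and gx: "((\<lambda>x. g (x, snd p)) has_real_derivative gx p) (at (fst p))"
    and gy: "\<And>q. q \<in> S \<Longrightarrow> ((\<lambda>y. g (fst q, y)) has_real_derivative gy q) (at (snd q))"
    and cont: "continuous_on S gy"
  shows "(g has_derivative (\<lambda>h. gx p * fst h + gy p * snd h)) (at p)"
proof -
  obtain x y where p: "p = (x, y)" by fastforce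
  obtain A B where AB: "open A" "open B" "(x, y) \<in> A \<times> B" "A \<times> B \<subseteq> S"
    using assms(1,2) p open_prod_elim by metis
  obtain e where e: "e > 0" "ball y e \<subseteq> B" using AB openE by blast
  \<comment> \<open>The mean value estimate in the second variable requires a convex factor, hence a
    ball inside \<open>B\<close>.\<close>
  let ?B = "ball y e"
  have sub: "A \<times> ?B \<subseteq> S" using AB e by auto
  have "((\<lambda>(x, y). g (x, y)) has_derivative (\<lambda>(tx, ty). gx p * tx + blinfun_mult_right (gy (x, y)) ty))
      (at (x, y) within A \<times> ?B)"
  proof (rule has_derivative_partialsI)
    show "((\<lambda>x. g (x, y)) has_derivative (*) (gx p)) (at x within A)"
      using gx p by (simp add: has_field_derivative_def has_derivative_at_withinI)
    show "((\<lambda>y. g (x, y)) has_derivative blinfun_apply (blinfun_mult_right (gy (x, y)))) (at y within ?B)"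
      if "x \<in> A" "y \<in> ?B" for x y
    proof -
      have "(x, y) \<in> S" using that sub by auto
      then show ?thesis using gy[of "(x, y)"]
        by (simp add: has_field_derivative_def has_derivative_at_withinI)
    qed
    have "continuous (at (x, y)) gy"
      using cont assms(1,2) p by (simp add: continuous_on_eq_continuous_at)
    then have "continuous (at (x, y)) (\<lambda>q. blinfun_mult_right (gy q))"
      by (rule bounded_linear.continuous[OF bounded_linear_blinfun_mult_right])
    then have "continuous (at (x, y) within A \<times> ball y e) (\<lambda>q. blinfun_mult_right (gy q))"
      by (rule continuous_at_imp_continuous_at_within)
    then show "continuous (at (x, y) within A \<times> ball y e) (\<lambda>(x, y). blinfun_mult_right (gy (x, y)))"
      by (simp add: case_prod_beta')
  qed (use e in auto)
  moreover have "at (x, y) within A \<times> ?B = at (x, y)"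
    by (rule at_within_open) (use AB e in \<open>auto intro: open_Times\<close>)
  ultimately show ?thesis using p by (simp add: case_prod_beta')
qed

lemma continuous_on_integral_param:
  fixes f :: "'a::topological_space \<Rightarrow> real \<Rightarrow> real"
  assumes "continuous_on (U \<times> {a..b}) (\<lambda>p. f (fst p) (snd p))"
  shows "continuous_on U (\<lambda>x. integral {a..b} (f x))"
  using integral_continuous_on_param[of U a b f] assms by (simp add: case_prod_beta')

lemma has_real_derivative_integral_param:
  fixes f fx :: "real \<Rightarrow> real \<Rightarrow> real"
  assumes "open U" "convex U" "x0 \<in> U"
    and "\<And>x s. x \<in> U \<Longrightarrow> s \<in> {a..b} \<Longrightarrow> ((\<lambda>x. f x s) has_real_derivative fx x s) (at x)"
    and "\<And>x. x \<in> U \<Longrightarrow> continuous_on {a..b} (f x)"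
    and "continuous_on (U \<times> {a..b}) (\<lambda>p. fx (fst p) (snd p))"
  shows "((\<lambda>x. integral {a..b} (f x)) has_real_derivative integral {a..b} (fx x0)) (at x0)"
proof -
  have "((\<lambda>x. integral (cbox a b) (f x)) has_field_derivative integral (cbox a b) (fx x0)) (at x0 within U)"
  proof (rule leibniz_rule_field_derivative)
    show "((\<lambda>x. f x s) has_field_derivative fx x s) (at x within U)" if "x \<in> U" "s \<in> cbox a b" for x s
      using assms(4)[of x s] that by (simp add: has_field_derivative_at_within)
    show "f x integrable_on cbox a b" if "x \<in> U" for x
      using assms(5)[OF that] by (simp add: integrable_continuous_interval)
    show "continuous_on (U \<times> cbox a b) (\<lambda>(x, t). fx x t)"
      using assms(6) by (simp add: case_prod_beta')
  qed (use assms in auto)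
  then show ?thesis using assms(1,3) by (simp only: at_within_open cbox_interval)
qed

section \<open>A flat radiation profile\<close>

text \<open>Polynomials in x = - 1 / s times exp (- x), extended by zero. The family is closed under
  differentiation, so smoothness at 0 follows from one first-order statement for all
  polynomials.\<close>

definition flat :: "real poly \<Rightarrow> real \<Rightarrow> real" where
  "flat q s = (if s < 0 then poly q (- inverse s) * exp (inverse s) else 0)"

text \<open>The free power x^n absorbs the shift from q to x q in the induction over the
  polynomial.\<close>

lemma tendsto_power_poly_exp_0:
  fixes q :: "real poly"
  shows "((\<lambda>x. x ^ n * poly q x / exp x) \<longlongrightarrow> 0) at_top"
proof (induction q arbitrary: n)
  case 0
  then show ?case by simp
next
  case (pCons a q)
  have "((\<lambda>x. a * (x ^ n / exp x) + x ^ Suc n * poly q x / exp x) \<longlongrightarrow> a * 0 + 0) at_top"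
    by (intro tendsto_intros tendsto_power_div_exp_0 pCons.IH)
  then show ?case by (simp add: algebra_simps add_divide_distrib)
qed

text \<open>With x = - 1 / s one has dx/ds = x^2, so the chain rule sends q to x^2 (q' - q). At 0
  the left difference quotient is - x q(x) / exp x with x tending to infinity.\<close>

lemma flat_has_real_derivative:
  "(flat q has_real_derivative flat ([:0, 0, 1:] * (pderiv q - q)) s) (at s)"
proof (cases s "0::real" rule: linorder_cases)
  case less
  have "((\<lambda>s. poly q (- inverse s) * exp (inverse s)) has_real_derivative
      flat ([:0, 0, 1:] * (pderiv q - q)) s) (at s)"
    using less by (auto intro!: derivative_eq_intros simp: flat_def power2_eq_square algebra_simps)
  then show ?thesis
    by (rule has_field_derivative_transform_within_open[of _ _ _ "{..<0}"]) (use less in \<open>auto simp: flat_def\<close>)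
next
  case greater
  have "((\<lambda>s. 0) has_real_derivative flat ([:0, 0, 1:] * (pderiv q - q)) s) (at s)"
    using greater by (auto simp: flat_def)
  then show ?thesis
    by (rule has_field_derivative_transform_within_open[of _ _ _ "{0<..}"]) (use greater in \<open>auto simp: flat_def\<close>)
next
  case equal
  have top: "LIM x (at_left (0::real)). - inverse x :> at_top"
    using filterlim_inverse_at_bot_neg by (simp add: filterlim_uminus_at_top)
  have "((\<lambda>h. - (((- inverse h) ^ 1 * poly q (- inverse h)) / exp (- inverse h))) \<longlongrightarrow> - 0) (at_left 0)"
    by (intro tendsto_minus filterlim_compose[OF tendsto_power_poly_exp_0 top])
  moreover have "\<forall>\<^sub>F h in at_left 0. - (((- inverse h) ^ 1 * poly q (- inverse h)) / exp (- inverse h))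
      = flat q h / h"
    unfolding eventually_at_left_field
    by (auto simp: flat_def exp_minus field_simps intro!: exI[of _ "-1"])
  ultimately have "((\<lambda>h. flat q h / h) \<longlongrightarrow> - 0) (at_left 0)"
    by (rule Lim_transform_eventually)
  then have "((\<lambda>h. flat q h / h) \<longlongrightarrow> 0) (at_left 0)"
    by simp
  moreover have "((\<lambda>h. flat q h / h) \<longlongrightarrow> 0) (at_right 0)"
    by (rule tendsto_eventually) (auto simp: eventually_at_right_field flat_def intro!: exI[of _ 1])
  ultimately have "((\<lambda>h. flat q h / h) \<longlongrightarrow> 0) (at 0)"
    by (simp add: filterlim_split_at)
  then show ?thesis by (simp add: equal DERIV_def flat_def)
qed

text \<open>The n-th derivative of F s = \<kappa> exp (1 / s), obtained by iterating the map on
  polynomials.\<close>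

definition profile :: "real \<Rightarrow> nat \<Rightarrow> real \<Rightarrow> real" where
  "profile \<kappa> n = flat (((\<lambda>q. [:0, 0, 1:] * (pderiv q - q)) ^^ n) [:\<kappa>:])"

lemma profile_has_real_derivative:
  "(profile \<kappa> n has_real_derivative profile \<kappa> (Suc n) s) (at s)"
  unfolding profile_def using flat_has_real_derivative by simp

lemma profile_eq_0: "0 \<le> s \<Longrightarrow> profile \<kappa> n s = 0"
  by (simp add: profile_def flat_def)

lemma profile_bound: "\<bar>profile \<kappa> 0 s\<bar> \<le> \<bar>\<kappa>\<bar>"
  by (simp add: profile_def flat_def abs_mult mult_left_le)

lemma flat_at_bot: "(flat q \<longlongrightarrow> poly q 0) at_bot"
proof -
  have i: "((\<lambda>s::real. inverse s) \<longlongrightarrow> 0) at_bot"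
    by (rule filterlim_compose[OF tendsto_inverse_0 filterlim_mono[OF filterlim_ident at_bot_le_at_infinity order_refl]])
  have "((\<lambda>s. poly q (- inverse s) * exp (inverse s)) \<longlongrightarrow> poly q (- 0) * exp 0) at_bot"
    by (intro tendsto_intros i)
  then have "((\<lambda>s. poly q (- inverse s) * exp (inverse s)) \<longlongrightarrow> poly q 0) at_bot" by simp
  moreover have "\<forall>\<^sub>F s in at_bot. poly q (- inverse s) * exp (inverse s) = flat q s"
    using eventually_gt_at_bot[of 0] by eventually_elim (simp add: flat_def)
  ultimately show ?thesis by (rule Lim_transform_eventually)
qed

text \<open>The primitive of F'^2 that vanishes on the right of 0. With x = - 1 / s one has F'^2 ds
  = \<kappa>^2 x^2 exp (- 2 x) dx, whose primitive is - \<kappa>^2 (x^2/2 + x/2 + 1/4) exp (- 2 x);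
  the argument \<open>s / 2\<close> turns x into 2 x and accounts for the coefficients. Its limit at
  minus infinity shows that F'^2 has total integral \<kappa>^2 / 4.\<close>

definition profile_energy :: "real \<Rightarrow> real \<Rightarrow> real" where
  "profile_energy \<kappa> s = - flat [:\<kappa>\<^sup>2 / 4, \<kappa>\<^sup>2 / 4, \<kappa>\<^sup>2 / 8:] (s / 2)"

lemma profile_energy_has_real_derivative:
  "(profile_energy \<kappa> has_real_derivative (profile \<kappa> 1 s)\<^sup>2) (at s)"
proof -
  let ?q = "[:\<kappa>\<^sup>2 / 4, \<kappa>\<^sup>2 / 4, \<kappa>\<^sup>2 / 8:]"
  have "((\<lambda>s. flat ?q (s / 2)) has_real_derivative
     flat ([:0, 0, 1:] * (pderiv ?q - ?q)) (s / 2) * (1 / 2)) (at s)"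
    by (rule DERIV_chain2[OF flat_has_real_derivative]) (auto intro!: derivative_eq_intros)
  then have "(profile_energy \<kappa> has_real_derivative
     - (flat ([:0, 0, 1:] * (pderiv ?q - ?q)) (s / 2) * (1 / 2))) (at s)"
    unfolding profile_energy_def[abs_def] by (rule DERIV_minus)
  moreover have "- (flat ([:0, 0, 1:] * (pderiv ?q - ?q)) (s / 2) * (1 / 2)) = (profile \<kappa> 1 s)\<^sup>2"
  proof (cases "s < 0")
    case True
    have "exp (2 / s) = (exp (inverse s))\<^sup>2"
      by (simp add: exp_double[symmetric] divide_inverse)
    then show ?thesis using True
      by (simp add: flat_def profile_def pderiv_pCons power2_eq_square field_simps)
  qed (simp add: flat_def profile_def)
  ultimately show ?thesis by simp
qed

lemma profile_energy_eq_0: "0 \<le> s \<Longrightarrow> profile_energy \<kappa> s = 0"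
  by (simp add: profile_energy_def flat_def)

lemma profile_energy_at_bot: "(profile_energy \<kappa> \<longlongrightarrow> - (\<kappa>\<^sup>2 / 4)) at_bot"
proof -
  have "LIM s at_bot. (s::real) / 2 :> at_bot"
    using filterlim_tendsto_pos_mult_at_bot[OF tendsto_const[of "1/2"] _ filterlim_ident] by simp
  from filterlim_compose[OF flat_at_bot this]
  have "((\<lambda>s. - flat [:\<kappa>\<^sup>2 / 4, \<kappa>\<^sup>2 / 4, \<kappa>\<^sup>2 / 8:] (s / 2)) \<longlongrightarrow> - (\<kappa>\<^sup>2 / 4)) at_bot"
    by (intro tendsto_minus) (metis poly_0_coeff_0 coeff_pCons_0)
  then show ?thesis by (simp add: profile_energy_def[abs_def])
qed

section \<open>Spherical free waves\<close>

text \<open>For k = 0 this is (F(t + r) - F(t - r)) / r, with F replaced by its derivative of order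
  n - 1, written as an average so that it is regular at r = 0. The weights (1 - s^2)^k arise from
  differentiation in r: each one raises k and splits off a factor r, which in space becomes a factor
  x.\<close>

definition kern :: "(nat \<Rightarrow> real \<Rightarrow> real) \<Rightarrow> nat \<Rightarrow> nat \<Rightarrow> real \<times> real \<Rightarrow> real" where
  "kern F k n p = integral {-1..1} (\<lambda>s. (1 - s\<^sup>2) ^ k * F n (fst p + s * snd p))"

definition radial_kern :: "(nat \<Rightarrow> real \<Rightarrow> real) \<Rightarrow> nat \<Rightarrow> nat \<Rightarrow> spacetime \<Rightarrow> real" where
  "radial_kern F k n p = kern F k n (fst p, norm (snd p))"

context
  fixes F :: "nat \<Rightarrow> real \<Rightarrow> real"
  assumes F: "\<And>n x. (F n has_real_derivative F (Suc n) x) (at x)"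
begin

lemma F_continuous: "continuous_on UNIV (F n)"
  using F DERIV_isCont continuous_at_imp_continuous_on by blast

lemma F_continuous_on:
  assumes "continuous_on A f" shows "continuous_on A (\<lambda>x. F n (f x))"
  using continuous_on_compose2[OF F_continuous assms] by simp

lemma kern_continuous: "continuous_on UNIV (kern F k n)"
  unfolding kern_def
  by (rule continuous_on_integral_param) (intro continuous_intros F_continuous_on)

lemma DERIV_F_affine: "((\<lambda>x. F n (a + x * b)) has_real_derivative b * F (Suc n) (a + x * b)) (at x)"
proof -
  have "((\<lambda>x. a + x * b) has_real_derivative b) (at x)"
    by (auto intro!: derivative_eq_intros)
  from DERIV_chain2[OF F this] show ?thesis by (simp add: mult.commute)
qed

text \<open>Up to the factor - 1 / (2 (k + 1)), the odd factor s (1 - s^2)^k is the derivative of (1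
  - s^2)^(k + 1), which vanishes at both endpoints. The factor r that comes out is the one needed
  for differentiability on the axis.\<close>

lemma kern_by_parts:
  "integral {-1..1} (\<lambda>s. s * (1 - s\<^sup>2) ^ k * F n (t + s * r))
   = r / (2 * (real k + 1)) * integral {-1..1} (\<lambda>s. (1 - s\<^sup>2) ^ Suc k * F (Suc n) (t + s * r))"
proof -
  let ?G = "\<lambda>s. - ((1 - s\<^sup>2) ^ Suc k * F n (t + s * r))"
  have "((\<lambda>s. 2 * (real k + 1) * (s * (1 - s\<^sup>2) ^ k * F n (t + s * r))
           - r * ((1 - s\<^sup>2) ^ Suc k * F (Suc n) (t + s * r))) has_integral (?G 1 - ?G (-1))) {-1..1}"
  proof (rule fundamental_theorem_of_calculus)
    fix s :: real
    have "(?G has_real_derivative (2 * (real k + 1) * (s * (1 - s\<^sup>2) ^ k * F n (t + s * r))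
           - r * ((1 - s\<^sup>2) ^ Suc k * F (Suc n) (t + s * r)))) (at s)"
    proof -
      have "((\<lambda>s. (1 - s\<^sup>2) ^ Suc k) has_real_derivative - (2 * (real k + 1) * s * (1 - s\<^sup>2) ^ k)) (at s)"
      proof -
        have "((\<lambda>s::real. 1 - s\<^sup>2) has_real_derivative - (2 * s)) (at s)"
          by (auto intro!: derivative_eq_intros)
        from DERIV_power_Suc[OF this, of k] show ?thesis
          by (rule DERIV_cong) (simp add: algebra_simps)
      qed
      from DERIV_minus[OF DERIV_mult[OF this DERIV_F_affine[of n t r s]]]
      show ?thesis by (rule DERIV_cong) (simp add: algebra_simps del: power_Suc)
    qed
    then show "(?G has_vector_derivative (2 * (real k + 1) * (s * (1 - s\<^sup>2) ^ k * F n (t + s * r))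
           - r * ((1 - s\<^sup>2) ^ Suc k * F (Suc n) (t + s * r)))) (at s within {-1..1})"
      using has_real_derivative_iff_has_vector_derivative has_vector_derivative_at_within by blast
  qed simp
  then have "integral {-1..1} (\<lambda>s. 2 * (real k + 1) * (s * (1 - s\<^sup>2) ^ k * F n (t + s * r))
           - r * ((1 - s\<^sup>2) ^ Suc k * F (Suc n) (t + s * r))) = 0"
    by (simp add: integral_unique)
  moreover have "integral {-1..1} (\<lambda>s. 2 * (real k + 1) * (s * (1 - s\<^sup>2) ^ k * F n (t + s * r))
           - r * ((1 - s\<^sup>2) ^ Suc k * F (Suc n) (t + s * r)))
     = 2 * (real k + 1) * integral {-1..1} (\<lambda>s. s * (1 - s\<^sup>2) ^ k * F n (t + s * r))
       - r * integral {-1..1} (\<lambda>s. (1 - s\<^sup>2) ^ Suc k * F (Suc n) (t + s * r))"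
    by (subst integral_diff)
       (auto intro!: integrable_continuous_interval continuous_intros F_continuous_on simp del: power_Suc)
  ultimately show ?thesis by (simp add: field_simps del: power_Suc)
qed

lemma kern_has_derivative:
  "(kern F k n has_derivative (\<lambda>h. kern F k (Suc n) p * fst h
      + snd p / (2 * (real k + 1)) * kern F (Suc k) (Suc (Suc n)) p * snd h)) (at p)"
proof (rule C1_has_derivative[OF open_UNIV UNIV_I, where gy="\<lambda>p. snd p / (2 * (real k + 1)) * kern F (Suc k) (Suc (Suc n)) p"])
  show "((\<lambda>x. kern F k n (x, snd p)) has_real_derivative kern F k (Suc n) p) (at (fst p))"
  proof -
    have "((\<lambda>x. integral {-1..1} (\<lambda>s. (1 - s\<^sup>2) ^ k * F n (x + s * snd p))) has_real_derivative
        integral {-1..1} (\<lambda>s. (1 - s\<^sup>2) ^ k * F (Suc n) (fst p + s * snd p))) (at (fst p))"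
    proof (rule has_real_derivative_integral_param[OF open_UNIV convex_UNIV UNIV_I])
      show "((\<lambda>x. (1 - s\<^sup>2) ^ k * F n (x + s * snd p)) has_real_derivative
          (1 - s\<^sup>2) ^ k * F (Suc n) (x + s * snd p)) (at x)" for x s
        using DERIV_cmult[OF DERIV_F_affine[where n=n and a="s * snd p" and b=1 and x=x], of "(1 - s\<^sup>2) ^ k"]
        by (simp add: add.commute)
    qed (intro continuous_intros F_continuous_on)+
    then show ?thesis by (simp add: kern_def)
  qed
  show "((\<lambda>y. kern F k n (fst q, y)) has_real_derivative
      snd q / (2 * (real k + 1)) * kern F (Suc k) (Suc (Suc n)) q) (at (snd q))" for q
  proof -
    have "((\<lambda>y. integral {-1..1} (\<lambda>s. (1 - s\<^sup>2) ^ k * F n (fst q + s * y))) has_real_derivative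
        integral {-1..1} (\<lambda>s. s * (1 - s\<^sup>2) ^ k * F (Suc n) (fst q + s * snd q))) (at (snd q))"
    proof (rule has_real_derivative_integral_param[OF open_UNIV convex_UNIV UNIV_I])
      show "((\<lambda>y. (1 - s\<^sup>2) ^ k * F n (fst q + s * y)) has_real_derivative
          s * (1 - s\<^sup>2) ^ k * F (Suc n) (fst q + s * y)) (at y)" for y s
        using DERIV_cmult[OF DERIV_F_affine[where n=n and a="fst q" and b=s and x=y], of "(1 - s\<^sup>2) ^ k"]
        by (simp add: mult_ac)
    qed (intro continuous_intros F_continuous_on)+
    then show ?thesis unfolding kern_by_parts by (simp add: kern_def del: power_Suc)
  qed
  show "continuous_on UNIV (\<lambda>p. snd p / (2 * (real k + 1)) * kern F (Suc k) (Suc (Suc n)) p)"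
    by (intro continuous_intros F_continuous_on kern_continuous) auto
qed

lemma radial_kern_has_derivative:
  "(radial_kern F k n has_derivative (\<lambda>h. radial_kern F k (Suc n) p * fst h
      + radial_kern F (Suc k) (Suc (Suc n)) p / (2 * (real k + 1)) * (snd p \<bullet> snd h))) (at p)"
  using has_derivative_norm_lift[of "kern F k n" "radial_kern F k (Suc n) p"
      "radial_kern F (Suc k) (Suc (Suc n)) p / (2 * (real k + 1))" "snd p" "fst p"]
    kern_has_derivative[of k n "(fst p, norm (snd p))"]
  unfolding radial_kern_def[abs_def]
  by (simp add: mult_ac)

lemma partial_radial_kern_0: "partial 0 (radial_kern F k n) p = radial_kern F k (Suc n) p"
  using partial_eq[OF radial_kern_has_derivative] by (simp add: fst_coord_dir snd_coord_dir_0)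

lemma partial_radial_kern:
  assumes "i \<in> {1..3}"
  shows "partial i (radial_kern F k n) p
    = radial_kern F (Suc k) (Suc (Suc n)) p / (2 * (real k + 1)) * snd p $ of_nat i"
  using partial_eq[OF radial_kern_has_derivative, of i] assms coord_dir_inner[OF assms]
  by (simp add: fst_coord_dir)

text \<open>Every first partial is again a kernel, up to a constant and a coordinate, so the
  induction runs over all k and n at once.\<close>

lemma Ck_on_radial_kern: "Ck_on m UNIV (radial_kern F k n)"
proof (induction m arbitrary: k n)
  case 0
  have "continuous_on UNIV (radial_kern F k n)"
    by (intro continuous_at_imp_continuous_on ballI has_derivative_continuous[OF radial_kern_has_derivative])
  then show ?case by simp
next
  case (Suc m)
  show ?case
  proof (rule Ck_on_SucI[OF open_UNIV radial_kern_has_derivative])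
    fix \<mu> :: nat assume "\<mu> \<in> {0..3}"
    then consider "\<mu> = 0" | "\<mu> \<in> {1..3}" by fastforce
    then show "Ck_on m UNIV (\<lambda>p. radial_kern F k (Suc n) p * fst (coord_dir \<mu>)
      + radial_kern F (Suc k) (Suc (Suc n)) p / (2 * (real k + 1)) * (snd p \<bullet> snd (coord_dir \<mu>)))"
    proof cases
      case 1
      then show ?thesis using Suc by (simp add: fst_coord_dir snd_coord_dir_0)
    next
      case 2
      have "Ck_on m UNIV (\<lambda>p. radial_kern F (Suc k) (Suc (Suc n)) p * (1 / (2 * (real k + 1)) * snd p $ of_nat \<mu>))"
        by (intro Ck_on_mult Suc Ck_on_const Ck_on_linear open_UNIV bounded_linear_coord)
      then show ?thesis using coord_dir_inner[OF 2] 2 by (simp add: fst_coord_dir)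
    qed
  qed
qed

text \<open>Working with the kernels instead of the quotient by r treats the axis together with all
  other points. Every kernel below is taken with the derivative order that makes it scale like the
  second time derivative.\<close>

lemma wave_op_radial_kern: "wave_op (radial_kern F 0 n) p = 0"
proof -
  define t r where "t = fst p" and "r = norm (snd p)"
  have 0: "partial 0 (partial 0 (radial_kern F 0 n)) p = radial_kern F 0 (n + 2) p"
    by (simp add: partial_radial_kern_0[abs_def] partial_radial_kern_0)
  have "partial i (partial i (radial_kern F 0 n)) p
      = 1/2 * radial_kern F 1 (n + 2) p + 1/8 * radial_kern F 2 (n + 4) p * (snd p $ of_nat i)\<^sup>2"
    if i: "i \<in> {1..3}" for i
  proof -
    have "((\<lambda>p. radial_kern F 1 (n + 2) p * (snd p $ of_nat i) / 2) has_derivative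
       (\<lambda>h. (radial_kern F 1 (n + 2) p * (snd h $ of_nat i) + (radial_kern F 1 (n + 3) p * fst h
      + radial_kern F 2 (n + 4) p / 4 * (snd p \<bullet> snd h)) * (snd p $ of_nat i)) / 2)) (at p)"
      using radial_kern_has_derivative[of 1 "n + 2" p]
      by (auto intro!: derivative_eq_intros bounded_linear_imp_has_derivative[OF bounded_linear_coord]
          simp: numeral_2_eq_2 numeral_eq_Suc)
    from partial_eq[OF this, of i]
    have "partial i (\<lambda>p. radial_kern F 1 (n + 2) p * (snd p $ of_nat i) / 2) p
       = (radial_kern F 1 (n + 2) p + radial_kern F 2 (n + 4) p / 4 * (snd p $ of_nat i) * (snd p $ of_nat i)) / 2"
      using i coord_dir_inner[OF i, of "snd p"] by (simp add: fst_coord_dir) (simp add: coord_dir_def)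
    then show ?thesis
      unfolding partial_radial_kern[OF i, abs_def] by (simp add: power2_eq_square numeral_2_eq_2)
  qed
  then have "(\<Sum>i=1..3. partial i (partial i (radial_kern F 0 n)) p)
    = (\<Sum>i=1..3. 1/2 * radial_kern F 1 (n + 2) p + 1/8 * radial_kern F 2 (n + 4) p * (snd p $ of_nat i)\<^sup>2)"
    by (intro sum.cong) auto
  also have "\<dots> = 3/2 * radial_kern F 1 (n + 2) p + 1/8 * radial_kern F 2 (n + 4) p * r\<^sup>2"
    unfolding sum.distrib sum_distrib_left[symmetric] sum_coord_squares r_def by simp
  finally have lap: "(\<Sum>i=1..3. partial i (partial i (radial_kern F 0 n)) p)
    = 3/2 * radial_kern F 1 (n + 2) p + 1/8 * radial_kern F 2 (n + 4) p * r\<^sup>2" .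
  \<comment> \<open>Two integrations by parts lower \<open>r\<^sup>2 F''''\<close> to \<open>F''\<close>.\<close>
  have "r\<^sup>2 * radial_kern F 2 (n + 4) p = r\<^sup>2 * kern F 2 (n + 4) (t, r)"
    by (simp add: radial_kern_def t_def r_def)
  also have "\<dots> = 4 * r * integral {-1..1} (\<lambda>s. s * (1 - s\<^sup>2) ^ 1 * F (n + 3) (t + s * r))"
    using kern_by_parts[of 1 "n + 3" t r] by (simp add: kern_def power2_eq_square numeral_eq_Suc)
  also have "\<dots> = integral {-1..1} (\<lambda>s. (12 * s\<^sup>2 - 4) * F (n + 2) (t + s * r))"
  proof -
    let ?G = "\<lambda>s. s * (1 - s\<^sup>2) * F (n + 2) (t + s * r)"
    have "((\<lambda>s. (1 - 3 * s\<^sup>2) * F (n + 2) (t + s * r) + r * (s * (1 - s\<^sup>2) * F (n + 3) (t + s * r)))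
        has_integral (?G 1 - ?G (-1))) {-1..1}"
    proof (rule fundamental_theorem_of_calculus)
      fix s :: real
      have "(?G has_real_derivative ((1 - 3 * s\<^sup>2) * F (n + 2) (t + s * r) + r * (s * (1 - s\<^sup>2) * F (n + 3) (t + s * r)))) (at s)"
      proof -
        have "((\<lambda>s. s * (1 - s\<^sup>2)) has_real_derivative 1 - 3 * s\<^sup>2) (at s)"
          by (auto intro!: derivative_eq_intros simp: power2_eq_square)
        from DERIV_mult[OF this DERIV_F_affine[of "n + 2" t r s]]
        show ?thesis by (rule DERIV_cong) (simp add: algebra_simps numeral_eq_Suc)
      qed
      then show "(?G has_vector_derivative ((1 - 3 * s\<^sup>2) * F (n + 2) (t + s * r) + r * (s * (1 - s\<^sup>2) * F (n + 3) (t + s * r))))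
          (at s within {-1..1})"
        using has_real_derivative_iff_has_vector_derivative has_vector_derivative_at_within by blast
    qed simp
    then have "0 = integral {-1..1} (\<lambda>s. (1 - 3 * s\<^sup>2) * F (n + 2) (t + s * r) + r * (s * (1 - s\<^sup>2) * F (n + 3) (t + s * r)))"
      by (simp add: integral_unique)
    also have "\<dots> = integral {-1..1} (\<lambda>s. (1 - 3 * s\<^sup>2) * F (n + 2) (t + s * r))
        + r * integral {-1..1} (\<lambda>s. s * (1 - s\<^sup>2) * F (n + 3) (t + s * r))"
      by (subst integral_add) (auto intro!: integrable_continuous_interval continuous_intros F_continuous_on)
    finally have "r * integral {-1..1} (\<lambda>s. s * (1 - s\<^sup>2) * F (n + 3) (t + s * r))
       = - integral {-1..1} (\<lambda>s. (1 - 3 * s\<^sup>2) * F (n + 2) (t + s * r))" by simp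
    moreover have "integral {-1..1} (\<lambda>s. (12 * s\<^sup>2 - 4) * F (n + 2) (t + s * r))
      = integral {-1..1} (\<lambda>s. (-4) * ((1 - 3 * s\<^sup>2) * F (n + 2) (t + s * r)))"
      by (intro integral_cong) (simp add: algebra_simps)
    ultimately show ?thesis by simp
  qed
  \<comment> \<open>12 s^2 - 4 = 8 - 12 (1 - s^2) returns to the weights k = 0 and k = 1. After
    division by 8 the k = 1 part cancels the 3/2 in \<open>lap\<close>, and the remaining k = 0 part
    is the second time derivative.\<close>
  also have "\<dots> = integral {-1..1} (\<lambda>s. 8 * (F (n + 2) (t + s * r)) - 12 * ((1 - s\<^sup>2) * F (n + 2) (t + s * r)))"
    by (intro integral_cong) (simp add: algebra_simps)
  also have "\<dots> = 8 * radial_kern F 0 (n + 2) p - 12 * radial_kern F 1 (n + 2) p"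
    unfolding radial_kern_def kern_def t_def[symmetric] r_def[symmetric]
    by (subst integral_diff) (auto intro!: integrable_continuous_interval continuous_intros F_continuous_on)
  finally show ?thesis
    unfolding wave_op_def 0 lap by (simp add: algebra_simps)
qed

lemma mult_kern: "r * kern F 0 (Suc n) (t, r) = F n (t + r) - F n (t - r)"
proof -
  have "((\<lambda>s. r * F (Suc n) (t + s * r)) has_integral (F n (t + 1 * r) - F n (t + (-1) * r))) {-1..1}"
  proof (rule fundamental_theorem_of_calculus)
    fix s :: real
    have "((\<lambda>s. F n (t + s * r)) has_real_derivative r * F (Suc n) (t + s * r)) (at s)"
      by (rule DERIV_F_affine)
    then show "((\<lambda>s. F n (t + s * r)) has_vector_derivative r * F (Suc n) (t + s * r)) (at s within {-1..1})"
      using has_real_derivative_iff_has_vector_derivative has_vector_derivative_at_within by blast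
  qed simp
  from integral_unique[OF this] show ?thesis by (simp add: kern_def)
qed

lemma kern_DERIV_snd:
  "((\<lambda>r. kern F k n (t, r)) has_real_derivative r / (2 * (real k + 1)) * kern F (Suc k) (Suc (Suc n)) (t, r)) (at r)"
proof -
  have "((\<lambda>r. (t, r)) has_derivative (\<lambda>h. (0, h))) (at r)"
    by (auto intro!: derivative_eq_intros)
  from has_derivative_compose[OF this kern_has_derivative[of k n]]
  show ?thesis unfolding has_field_derivative_def by (rule has_derivative_eq_rhs) (simp add: fun_eq_iff)
qed

text \<open>The product of r and the kernel is differentiated in two ways. Together with
  \<open>mult_kern\<close> this expresses r u_t and u + r u_r through F'(t + r) and F'(t - r), as
  the energy computation requires.\<close>

lemma mult_kern_deriv:
  "kern F 0 (Suc n) (t, r) + r * (r / 2 * kern F 1 (n + 3) (t, r)) = F (Suc n) (t + r) + F (Suc n) (t - r)"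
proof (rule DERIV_unique)
  show "((\<lambda>r. r * kern F 0 (Suc n) (t, r)) has_real_derivative
      kern F 0 (Suc n) (t, r) + r * (r / 2 * kern F 1 (n + 3) (t, r))) (at r)"
    using DERIV_mult[OF DERIV_ident kern_DERIV_snd[of 0 "Suc n" t r]]
    by (simp add: numeral_3_eq_3 algebra_simps)
  have "((\<lambda>r. F n (t + r * 1) - F n (t + r * (-1))) has_real_derivative
      1 * F (Suc n) (t + r * 1) - (-1) * F (Suc n) (t + r * (-1))) (at r)"
    by (intro DERIV_diff DERIV_F_affine)
  then show "((\<lambda>r. r * kern F 0 (Suc n) (t, r)) has_real_derivative F (Suc n) (t + r) + F (Suc n) (t - r)) (at r)"
    unfolding mult_kern by simp
qed

end

section \<open>Norms on time slices and the energy of the free wave\<close>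

lemma slice_L2I:
  assumes "continuous_on UNIV (\<lambda>x. f (c, x))"
    and "(\<integral>\<^sup>+x. ennreal ((f (c, x))\<^sup>2) \<partial>lborel) < \<infinity>"
  shows "slice_L2 c f"
proof -
  have [measurable]: "(\<lambda>x. f (c, x)) \<in> borel_measurable borel"
    using assms(1) by (rule borel_measurable_continuous_onI)
  show ?thesis unfolding slice_L2_def
    by (intro conjI integrableI_nonneg) (use assms(2) in auto)
qed

lemma slice_norm_eq:
  assumes "continuous_on UNIV (\<lambda>x. f (c, x))"
  shows "slice_norm c f = sqrt (enn2real (\<integral>\<^sup>+x. ennreal ((f (c, x))\<^sup>2) \<partial>lborel))"
proof -
  have [measurable]: "(\<lambda>x. f (c, x)) \<in> borel_measurable borel"
    using assms(1) by (rule borel_measurable_continuous_onI)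
  show ?thesis unfolding slice_norm_def by (subst integral_eq_nn_integral) auto
qed

text \<open>In polar form the squared field is integrated against r^2 dr, leaving C^2 / r^2 on r
  \<ge> c, with integral C^2 / c. The factor 1 / c is the rate at which the squared norm of the
  error decays.\<close>

lemma slice_decay:
  assumes "0 < c" "0 \<le> C" "continuous_on UNIV (\<lambda>x. f (c, x))"
    and "\<And>x. norm x < c \<Longrightarrow> f (c, x) = 0" "\<And>x. c \<le> norm x \<Longrightarrow> \<bar>f (c, x)\<bar> \<le> C / (norm x)\<^sup>2"
  shows "slice_L2 c f" "slice_norm c f \<le> sqrt (3 * unit_ball_vol 3 * C\<^sup>2 / c)"
proof -
  let ?K = "unit_ball_vol (3::real)"
  let ?G = "\<lambda>r. - (3 * ?K * C\<^sup>2) / r"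
  have "(\<integral>\<^sup>+x. ennreal ((f (c, x))\<^sup>2) \<partial>lborel)
      \<le> (\<integral>\<^sup>+x. ennreal (C\<^sup>2 / (norm (x::real^3)) ^ 4) * indicator {c..} (norm x) \<partial>lborel)"
  proof (rule nn_integral_mono)
    fix x :: "real^3"
    show "ennreal ((f (c, x))\<^sup>2) \<le> ennreal (C\<^sup>2 / (norm x) ^ 4) * indicator {c..} (norm x)"
    proof (cases "norm x < c")
      case False
      then have "\<bar>f (c, x)\<bar>\<^sup>2 \<le> (C / (norm x)\<^sup>2)\<^sup>2"
        using assms(5)[of x] by (intro power_mono) auto
      then show ?thesis using False
        by (simp add: power_divide power_mult[symmetric] ennreal_leI)
    qed (simp add: assms(4))
  qed
  also have "\<dots> = (\<integral>\<^sup>+r. ennreal (3 * ?K * r\<^sup>2) * indicator {0..} r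
      * (ennreal (C\<^sup>2 / r ^ 4) * indicator {c..} r) \<partial>lborel)"
    by (rule nn_integral_radial) measurable
  also have "\<dots> = (\<integral>\<^sup>+r. ennreal (3 * ?K * C\<^sup>2 / r\<^sup>2) * indicator {c..} r \<partial>lborel)"
  proof (rule nn_integral_cong)
    fix r :: real
    have "3 * ?K * r\<^sup>2 * (C\<^sup>2 / r ^ 4) = 3 * ?K * C\<^sup>2 / r\<^sup>2"
      by (simp add: field_simps power2_eq_square numeral_eq_Suc)
    then show "ennreal (3 * ?K * r\<^sup>2) * indicator {0..} r * (ennreal (C\<^sup>2 / r ^ 4) * indicator {c..} r)
        = ennreal (3 * ?K * C\<^sup>2 / r\<^sup>2) * indicator {c..} r"
      using assms(1) by (simp add: indicator_def ennreal_mult[symmetric])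
  qed
  also have "\<dots> = ennreal (0 - ?G c)"
  proof (rule nn_integral_FTC_atLeast)
    fix r :: real assume "c \<le> r"
    then show "(?G has_real_derivative 3 * ?K * C\<^sup>2 / r\<^sup>2) (at r)"
      using assms(1) by (auto intro!: derivative_eq_intros simp: power2_eq_square)
    show "0 \<le> 3 * ?K * C\<^sup>2 / r\<^sup>2" by simp
  next
    show "(?G \<longlongrightarrow> 0) at_top"
      by (rule tendsto_divide_0[OF tendsto_const]) (simp add: filterlim_at_top_imp_at_infinity filterlim_ident)
  qed measurable
  finally have le: "(\<integral>\<^sup>+x. ennreal ((f (c, x))\<^sup>2) \<partial>lborel) \<le> ennreal (3 * ?K * C\<^sup>2 / c)" by simp
  then have "(\<integral>\<^sup>+x. ennreal ((f (c, x))\<^sup>2) \<partial>lborel) < \<infinity>"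
    by (rule le_less_trans) simp
  then show "slice_L2 c f" using assms(3) by (intro slice_L2I) auto
  have "0 \<le> 3 * ?K * C\<^sup>2 / c" using assms(1) by simp
  then have "enn2real (\<integral>\<^sup>+x. ennreal ((f (c, x))\<^sup>2) \<partial>lborel) \<le> 3 * ?K * C\<^sup>2 / c"
    by (rule enn2real_leI[OF _ le])
  then show "slice_norm c f \<le> sqrt (3 * ?K * C\<^sup>2 / c)"
    unfolding slice_norm_eq[OF assms(3)] by (rule real_sqrt_le_mono)
qed

abbreviation free_profile :: "real \<Rightarrow> spacetime \<Rightarrow> real" where
  "free_profile \<kappa> \<equiv> radial_kern (profile \<kappa>) 0 1"

lemmas profile_kern_continuous = kern_continuous[where F="profile \<kappa>", OF profile_has_real_derivative] for \<kappa>
lemmas profile_kern_DERIV = kern_DERIV_snd[where F="profile \<kappa>", OF profile_has_real_derivative] for \<kappa>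
lemmas profile_mult_kern = mult_kern[where F="profile \<kappa>", OF profile_has_real_derivative] for \<kappa>
lemmas profile_mult_kern_deriv = mult_kern_deriv[where F="profile \<kappa>", OF profile_has_real_derivative] for \<kappa>
lemmas partial_free_profile = partial_radial_kern[where F="profile \<kappa>", OF profile_has_real_derivative] for \<kappa>
lemmas partial_free_profile_0 = partial_radial_kern_0[where F="profile \<kappa>", OF profile_has_real_derivative] for \<kappa>
lemmas Ck_on_free_profile = Ck_on_radial_kern[where F="profile \<kappa>", OF profile_has_real_derivative] for \<kappa>

lemma free_profile_energy_density:
  "(\<Sum>\<mu>=0..3. (partial \<mu> (free_profile \<kappa>) (c, x))\<^sup>2)
    = (kern (profile \<kappa>) 0 2 (c, norm x))\<^sup>2 + (norm x / 2 * kern (profile \<kappa>) 1 3 (c, norm x))\<^sup>2"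
proof -
  have "(\<Sum>\<mu>=0..3. (partial \<mu> (free_profile \<kappa>) (c, x))\<^sup>2)
      = (partial 0 (free_profile \<kappa>) (c, x))\<^sup>2 + (\<Sum>\<mu>=1..3. (partial \<mu> (free_profile \<kappa>) (c, x))\<^sup>2)"
    by (simp add: sum.atLeast_Suc_atMost)
  also have "(\<Sum>\<mu>=1..3. (partial \<mu> (free_profile \<kappa>) (c, x))\<^sup>2)
      = (\<Sum>\<mu>=1..3. (radial_kern (profile \<kappa>) 1 3 (c, x) / 2)\<^sup>2 * (x $ of_nat \<mu>)\<^sup>2)"
    by (intro sum.cong)
       (auto simp: partial_free_profile power_mult_distrib power_divide numeral_3_eq_3)
  also have "\<dots> = (radial_kern (profile \<kappa>) 1 3 (c, x) / 2)\<^sup>2 * (norm x)\<^sup>2"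
    by (simp only: sum_distrib_left[symmetric] sum_coord_squares)
  also have "partial 0 (free_profile \<kappa>) (c, x) = kern (profile \<kappa>) 0 2 (c, norm x)"
    unfolding partial_free_profile_0 radial_kern_def by (simp add: numeral_2_eq_2)
  also have "radial_kern (profile \<kappa>) 1 3 (c, x) = kern (profile \<kappa>) 1 3 (c, norm x)"
    unfolding radial_kern_def by simp
  finally show ?thesis by (simp only: power_mult_distrib power_divide times_divide_eq_left times_divide_eq_right mult.commute)
qed

text \<open>Put p = F'(t + r) and m = F'(t - r). Then r u_t = p - m and r u_r = p + m - u, and since
  p + m = u + r u_r, the squares add up to 2 p^2 + 2 m^2 - (r u^2)_r. This is an exact r-derivative.
  At r = 0 the boundary terms cancel; at infinity only the limit - \<kappa>^2 / 4 of the primitive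
  of F'^2 survives, so the value does not depend on t.\<close>

lemma kern_energy:
  "(\<integral>\<^sup>+r. ennreal (3 * K * r\<^sup>2 * ((kern (profile \<kappa>) 0 2 (t, r))\<^sup>2
      + (r / 2 * kern (profile \<kappa>) 1 3 (t, r))\<^sup>2)) * indicator {0..} r \<partial>lborel) = ennreal (3 / 2 * K * \<kappa>\<^sup>2)"
  if K: "0 \<le> K"
proof -
  let ?k = "\<lambda>k n r. kern (profile \<kappa>) k n (t, r)"
  let ?F = "profile \<kappa>"
  let ?Q = "profile_energy \<kappa>"
  let ?G = "\<lambda>r. 3 * K * (2 * (?Q (t + r) - ?Q (t - r)) - r * (?k 0 1 r)\<^sup>2)"
  have "(\<integral>\<^sup>+r. ennreal (3 * K * r\<^sup>2 * ((?k 0 2 r)\<^sup>2 + (r / 2 * ?k 1 3 r)\<^sup>2)) * indicator {0..} r \<partial>lborel)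
      = ennreal (3 * K * (2 * (0 - (- (\<kappa>\<^sup>2 / 4))) - 0) - ?G 0)"
  proof (rule nn_integral_FTC_atLeast)
    have kc: "continuous_on UNIV (\<lambda>r. ?k k n r)" for k n
      by (rule continuous_on_compose2[OF profile_kern_continuous]) (auto intro!: continuous_intros)
    show "(\<lambda>r. 3 * K * r\<^sup>2 * ((?k 0 2 r)\<^sup>2 + (r / 2 * ?k 1 3 r)\<^sup>2)) \<in> borel_measurable borel"
      by (intro borel_measurable_continuous_onI continuous_intros kc) auto
  next
    fix r :: real
    show "0 \<le> 3 * K * r\<^sup>2 * ((?k 0 2 r)\<^sup>2 + (r / 2 * ?k 1 3 r)\<^sup>2)" using K by simp
    define p m g g' where "p = ?F 1 (t + r)" and "m = ?F 1 (t - r)" and "g = ?k 0 1 r" and "g' = r / 2 * ?k 1 3 r"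
    have eqs: "r * ?k 0 2 r = p - m" "g + r * g' = p + m"
      using profile_mult_kern[where \<kappa>=\<kappa> and r=r and n=1 and t=t] profile_mult_kern_deriv[where \<kappa>=\<kappa> and r=r and n=0 and t=t]
      by (simp_all add: p_def m_def g_def g'_def numeral_2_eq_2)
    have dg: "((\<lambda>r. ?k 0 1 r) has_real_derivative g') (at r)"
      using profile_kern_DERIV[where \<kappa>=\<kappa> and k=0 and r=r and n=1 and t=t] by (simp add: g'_def numeral_3_eq_3)
    have dp: "((\<lambda>r. ?Q (t + r)) has_real_derivative p\<^sup>2 * 1) (at r)"
      unfolding p_def by (rule DERIV_chain2[OF profile_energy_has_real_derivative]) (auto intro!: derivative_eq_intros)
    have dm: "((\<lambda>r. ?Q (t - r)) has_real_derivative m\<^sup>2 * (-1)) (at r)"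
      unfolding m_def by (rule DERIV_chain2[OF profile_energy_has_real_derivative]) (auto intro!: derivative_eq_intros)
    have "((\<lambda>r. r * (?k 0 1 r)\<^sup>2) has_real_derivative g\<^sup>2 + r * (2 * g * g')) (at r)"
      using dg by (auto intro!: derivative_eq_intros simp: g_def)
    then have "(?G has_real_derivative 3 * K * (2 * (p\<^sup>2 * 1 - m\<^sup>2 * (-1)) - (g\<^sup>2 + r * (2 * g * g')))) (at r)"
      by (intro DERIV_cmult DERIV_diff dp dm)
    moreover have "2 * (p\<^sup>2 * 1 - m\<^sup>2 * (-1)) - (g\<^sup>2 + r * (2 * g * g')) = r\<^sup>2 * ((?k 0 2 r)\<^sup>2 + g'\<^sup>2)"
    proof -
      have "r\<^sup>2 * ((?k 0 2 r)\<^sup>2 + g'\<^sup>2) = (r * ?k 0 2 r)\<^sup>2 + (r * g')\<^sup>2"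
        by (simp add: power_mult_distrib algebra_simps)
      also have "\<dots> = (p - m)\<^sup>2 + (p + m - g)\<^sup>2"
      proof -
        have "r * g' = p + m - g" using eqs(2) by linarith
        then show ?thesis using eqs(1) by simp
      qed
      also have "\<dots> = 2 * (p\<^sup>2 + m\<^sup>2) - 2 * g * (p + m) + g\<^sup>2" by (simp add: algebra_simps power2_eq_square)
      also have "\<dots> = 2 * (p\<^sup>2 + m\<^sup>2) - 2 * g * (g + r * g') + g\<^sup>2" using eqs by simp
      finally show ?thesis by (simp add: algebra_simps power2_eq_square)
    qed
    ultimately show "(?G has_real_derivative 3 * K * r\<^sup>2 * ((?k 0 2 r)\<^sup>2 + (r / 2 * ?k 1 3 r)\<^sup>2)) (at r)"
      by (simp add: g'_def mult.assoc)
  next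
    have "((\<lambda>r. ?Q (t + r)) \<longlongrightarrow> 0) at_top"
    proof (rule tendsto_eventually)
      show "\<forall>\<^sub>F r in at_top. ?Q (t + r) = 0"
        using eventually_ge_at_top[of "- t"] by eventually_elim (simp add: profile_energy_eq_0)
    qed
    moreover have "LIM r at_top. t - r :> at_bot"
      unfolding filterlim_at_bot
    proof
      show "\<forall>\<^sub>F r in at_top. t - r \<le> Z" for Z
        using eventually_ge_at_top[of "t - Z"] by eventually_elim simp
    qed
    from filterlim_compose[OF profile_energy_at_bot this]
    have "((\<lambda>r. ?Q (t - r)) \<longlongrightarrow> - (\<kappa>\<^sup>2 / 4)) at_top" .
    \<comment> \<open>F does not vanish at minus infinity, but it is bounded by |\<kappa>|. Hence r
      u is bounded and r u^2 = (r u)^2 / r tends to 0.\<close>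
    moreover have "((\<lambda>r. r * (?k 0 1 r)\<^sup>2) \<longlongrightarrow> 0) at_top"
    proof (rule Lim_null_comparison)
      show "\<forall>\<^sub>F r in at_top. norm (r * (?k 0 1 r)\<^sup>2) \<le> (2 * \<bar>\<kappa>\<bar>)\<^sup>2 / r"
        using eventually_gt_at_top[of 0]
      proof eventually_elim
        case (elim r)
        have "\<bar>?F 0 (t + r) - ?F 0 (t - r)\<bar> \<le> 2 * \<bar>\<kappa>\<bar>"
          using profile_bound[of \<kappa> "t + r"] profile_bound[of \<kappa> "t - r"] by linarith
        then have "\<bar>r * ?k 0 1 r\<bar>\<^sup>2 \<le> (2 * \<bar>\<kappa>\<bar>)\<^sup>2"
          using profile_mult_kern[where \<kappa>=\<kappa> and r=r and n=0 and t=t] by (intro power_mono) auto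
        then have "(r * (?k 0 1 r)\<^sup>2) * r \<le> (2 * \<bar>\<kappa>\<bar>)\<^sup>2"
          by (simp add: power_mult_distrib power2_eq_square mult_ac)
        then show ?case using elim by (simp add: pos_le_divide_eq)
      qed
      show "((\<lambda>r. (2 * \<bar>\<kappa>\<bar>)\<^sup>2 / r) \<longlongrightarrow> 0) at_top"
        by (rule tendsto_divide_0[OF tendsto_const]) (simp add: filterlim_at_top_imp_at_infinity filterlim_ident)
    qed
    ultimately show "(?G \<longlongrightarrow> 3 * K * (2 * (0 - (- (\<kappa>\<^sup>2 / 4))) - 0)) at_top"
      by (intro tendsto_intros)
  qed
  then show ?thesis by simp
qed

lemma free_profile_energy:
  "(\<integral>\<^sup>+x. ennreal (\<Sum>\<mu>=0..3. (partial \<mu> (free_profile \<kappa>) (c, x))\<^sup>2) \<partial>lborel)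
    = ennreal (3 / 2 * unit_ball_vol 3 * \<kappa>\<^sup>2)"
proof -
  let ?e = "\<lambda>r. (kern (profile \<kappa>) 0 2 (c, r))\<^sup>2 + (r / 2 * kern (profile \<kappa>) 1 3 (c, r))\<^sup>2"
  have kc: "continuous_on UNIV (\<lambda>r. kern (profile \<kappa>) k n (c, r))" for k n
    by (rule continuous_on_compose2[OF profile_kern_continuous]) (auto intro!: continuous_intros)
  have [measurable]: "(\<lambda>r. kern (profile \<kappa>) k n (c, r)) \<in> borel_measurable borel" for k n
    by (rule borel_measurable_continuous_onI[OF kc])
  have "(\<integral>\<^sup>+x. ennreal (?e (norm (x::real^3))) \<partial>lborel)
      = (\<integral>\<^sup>+r. ennreal (3 * unit_ball_vol 3 * r\<^sup>2) * indicator {0..} r * ennreal (?e r) \<partial>lborel)"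
    by (intro nn_integral_radial) measurable
  also have "\<dots> = (\<integral>\<^sup>+r. ennreal (3 * unit_ball_vol 3 * r\<^sup>2 * ?e r) * indicator {0..} r \<partial>lborel)"
    by (intro nn_integral_cong) (simp add: indicator_def ennreal_mult[symmetric] del: ennreal_plus)
  also have "\<dots> = ennreal (3 / 2 * unit_ball_vol 3 * \<kappa>\<^sup>2)"
    by (rule kern_energy) simp
  finally show ?thesis unfolding free_profile_energy_density .
qed

lemma free_profile_slices:
  shows "\<And>\<mu>. \<mu> \<in> {0..3} \<Longrightarrow> slice_L2 c (partial \<mu> (free_profile \<kappa>))"
    and "(\<Sum>\<mu>=0..3. (slice_norm c (partial \<mu> (free_profile \<kappa>)))\<^sup>2) = 3 / 2 * unit_ball_vol 3 * \<kappa>\<^sup>2"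
proof -
  let ?u = "free_profile \<kappa>"
  have cont: "continuous_on UNIV (\<lambda>x. partial \<mu> ?u (c, x))" if "\<mu> \<in> {0..3}" for \<mu>
  proof -
    have "Ck_on (Suc 0) UNIV ?u" by (rule Ck_on_free_profile)
    then have "continuous_on UNIV (partial \<mu> ?u)" using that by simp
    then show ?thesis by (rule continuous_on_compose2) (auto intro!: continuous_intros)
  qed
  show L2: "slice_L2 c (partial \<mu> ?u)" if \<mu>: "\<mu> \<in> {0..3}" for \<mu>
  proof (rule slice_L2I[OF cont[OF \<mu>]])
    have "(\<integral>\<^sup>+x. ennreal ((partial \<mu> ?u (c, x))\<^sup>2) \<partial>lborel)
        \<le> (\<integral>\<^sup>+x. ennreal (\<Sum>\<mu>=0..3. (partial \<mu> ?u (c, x))\<^sup>2) \<partial>lborel)"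
      by (intro nn_integral_mono ennreal_leI member_le_sum[OF \<mu>]) auto
    then show "(\<integral>\<^sup>+x. ennreal ((partial \<mu> ?u (c, x))\<^sup>2) \<partial>lborel) < \<infinity>"
      unfolding free_profile_energy by (rule le_less_trans) simp
  qed
  have "(\<Sum>\<mu>=0..3. (slice_norm c (partial \<mu> ?u))\<^sup>2) = (\<Sum>\<mu>=0..3. (LINT x|lborel. (partial \<mu> ?u (c, x))\<^sup>2))"
    by (intro sum.cong) (auto simp: slice_norm_def)
  also have "\<dots> = (LINT x|lborel. (\<Sum>\<mu>=0..3. (partial \<mu> ?u (c, x))\<^sup>2))"
    by (rule Bochner_Integration.integral_sum[symmetric]) (use L2 in \<open>auto simp: slice_L2_def\<close>)
  also have "\<dots> = enn2real (\<integral>\<^sup>+x. ennreal (\<Sum>\<mu>=0..3. (partial \<mu> ?u (c, x))\<^sup>2) \<partial>lborel)"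
  proof (rule integral_eq_nn_integral)
    have "continuous_on UNIV (\<lambda>x. \<Sum>\<mu>=0..3. (partial \<mu> ?u (c, x))\<^sup>2)"
      by (intro continuous_intros cont)
    then have "(\<lambda>x. \<Sum>\<mu>=0..3. (partial \<mu> ?u (c, x))\<^sup>2) \<in> borel_measurable borel"
      by (rule borel_measurable_continuous_onI)
    then show "(\<lambda>x. \<Sum>\<mu>=0..3. (partial \<mu> ?u (c, x))\<^sup>2) \<in> borel_measurable lborel" by simp
  qed (intro AE_I2 sum_nonneg zero_le_power2)
  finally show "(\<Sum>\<mu>=0..3. (slice_norm c (partial \<mu> ?u))\<^sup>2) = 3 / 2 * unit_ball_vol 3 * \<kappa>\<^sup>2"
    unfolding free_profile_energy by simp
qed

section \<open>The characteristic problem at null infinity\<close>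

text \<open>The primitive in z that starts at z = 0, rescaled to the fixed interval [0, 1];
  \<open>prim1\<close> is its counterpart in a. The rescaled form makes sense for either sign of the
  variable and lets theorems on integrals with a parameter apply directly.\<close>

definition prim2 :: "(real \<times> real \<Rightarrow> real) \<Rightarrow> real \<times> real \<Rightarrow> real" where
  "prim2 k p = snd p * integral {0..1} (\<lambda>s. k (fst p, s * snd p))"

definition prim1 :: "(real \<times> real \<Rightarrow> real) \<Rightarrow> real \<times> real \<Rightarrow> real" where
  "prim1 k p = fst p * integral {0..1} (\<lambda>s. k (s * fst p, snd p))"

text \<open>Undoing the rescaling gives G x - G 0 for an ordinary primitive G based at a point - c
  to the left of both, which treats positive and negative x alike.\<close>

lemma DERIV_scaled_integral:
  fixes g :: "real \<Rightarrow> real"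
  assumes g: "continuous_on UNIV g"
  shows "((\<lambda>x. x * integral {0..1} (\<lambda>s. g (s * x))) has_real_derivative g x) (at x)"
proof -
  define c where "c = \<bar>x\<bar> + 1"
  define G where "G y = integral {-c..y} g" for y
  have G: "(G has_real_derivative g y) (at y)" if "y \<in> {-c<..<c}" for y
  proof -
    have "(G has_real_derivative g y) (at y within {-c..c})"
      unfolding G_def using that continuous_on_subset[OF g]
      by (intro integral_has_real_derivative) auto
    then show ?thesis using that by (simp add: at_within_Icc_at)
  qed
  have eq: "y * integral {0..1} (\<lambda>s. g (s * y)) = G y - G 0" if y: "y \<in> {-c<..<c}" for y
  proof -
    have "((\<lambda>s. y * g (s * y)) has_integral (G (1 * y) - G (0 * y))) {0..1}"
    proof (rule fundamental_theorem_of_calculus)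
      fix s :: real assume s: "s \<in> {0..1}"
      have "\<bar>s * y\<bar> \<le> \<bar>y\<bar>" using s by (simp add: abs_mult mult_left_le_one_le)
      then have "s * y \<in> {-c<..<c}" using y by auto
      moreover have "((\<lambda>s. s * y) has_real_derivative y) (at s)" by (auto intro!: derivative_eq_intros)
      ultimately have "((\<lambda>s. G (s * y)) has_real_derivative g (s * y) * y) (at s)"
        by (intro DERIV_chain2[OF G])
      then show "((\<lambda>s. G (s * y)) has_vector_derivative y * g (s * y)) (at s within {0..1})"
        by (simp add: has_real_derivative_iff_has_vector_derivative has_vector_derivative_at_within mult.commute)
    qed simp
    from integral_unique[OF this] show ?thesis by simp
  qed
  have x: "x \<in> {-c<..<c}" by (auto simp: c_def)
  have "((\<lambda>y. G y - G 0) has_real_derivative g x) (at x)"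
    using DERIV_diff[OF G[OF x] DERIV_const] by simp
  then show ?thesis
    by (rule has_field_derivative_transform_within_open[of _ _ _ "{-c<..<c}"]) (use x eq in auto)
qed

lemma prim2_DERIV:
  assumes "continuous_on UNIV k"
  shows "((\<lambda>z. prim2 k (a, z)) has_real_derivative k (a, z)) (at z)"
proof -
  have "continuous_on UNIV (\<lambda>z. k (a, z))"
    by (rule continuous_on_compose2[OF assms]) (auto intro!: continuous_intros)
  from DERIV_scaled_integral[OF this] show ?thesis by (simp add: prim2_def)
qed

lemma prim1_DERIV:
  assumes "continuous_on UNIV k"
  shows "((\<lambda>a. prim1 k (a, z)) has_real_derivative k (a, z)) (at a)"
proof -
  have "continuous_on UNIV (\<lambda>a. k (a, z))"
    by (rule continuous_on_compose2[OF assms]) (auto intro!: continuous_intros)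
  from DERIV_scaled_integral[OF this] show ?thesis by (simp add: prim1_def)
qed

lemma prim2_continuous_on:
  assumes "continuous_on T k" "\<And>a z s. (a, z) \<in> S \<Longrightarrow> s \<in> {0..1} \<Longrightarrow> (a, s * z) \<in> T"
  shows "continuous_on S (prim2 k)"
  unfolding prim2_def
  by (intro continuous_intros continuous_on_integral_param continuous_on_compose2[OF assms(1)])
     (use assms(2) in auto)

lemma prim1_continuous_on:
  assumes "continuous_on T k" "\<And>a z s. (a, z) \<in> S \<Longrightarrow> s \<in> {0..1} \<Longrightarrow> (s * a, z) \<in> T"
  shows "continuous_on S (prim1 k)"
  unfolding prim1_def
  by (intro continuous_intros continuous_on_integral_param continuous_on_compose2[OF assms(1)])
     (use assms(2) in auto)

lemma prim2_bound:
  assumes "\<And>s. s \<in> {0..1} \<Longrightarrow> \<bar>k (a, s * z)\<bar> \<le> B" "continuous_on UNIV k" "0 \<le> z"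
  shows "\<bar>prim2 k (a, z)\<bar> \<le> z * B"
proof -
  have "norm (integral {0..1} (\<lambda>s. k (a, s * z))) \<le> integral {0..1} (\<lambda>s::real. B)"
    by (rule integral_norm_bound_integral)
       (use assms in \<open>auto intro!: integrable_continuous_interval continuous_on_compose2[OF assms(2)] continuous_intros\<close>)
  then show ?thesis using assms(3) by (simp add: prim2_def abs_mult mult_left_mono)
qed

text \<open>The integral of B / (L + a)^2 over the whole half-line is B / L. The bound is thus
  uniform in a and contributes the factor 1 / L to the contraction constant.\<close>

lemma prim1_bound:
  assumes "\<And>s. s \<in> {0..1} \<Longrightarrow> \<bar>k (s * a, z)\<bar> \<le> B / (L + s * a)\<^sup>2" "continuous_on UNIV k"
    "0 \<le> a" "0 < L" "0 \<le> B"
  shows "\<bar>prim1 k (a, z)\<bar> \<le> B / L"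
proof -
  have "((\<lambda>s. a * (B / (L + s * a)\<^sup>2)) has_integral (- B / (L + 1 * a) - (- B / (L + 0 * a)))) {0..1}"
  proof (rule fundamental_theorem_of_calculus)
    fix s :: real assume "s \<in> {0..1}"
    then have "L + s * a > 0" using assms by (intro add_pos_nonneg) auto
    then have "((\<lambda>s. - B / (L + s * a)) has_real_derivative a * (B / (L + s * a)\<^sup>2)) (at s)"
      by (auto intro!: derivative_eq_intros simp: power2_eq_square)
    then show "((\<lambda>s. - B / (L + s * a)) has_vector_derivative a * (B / (L + s * a)\<^sup>2)) (at s within {0..1})"
      by (simp add: has_real_derivative_iff_has_vector_derivative has_vector_derivative_at_within)
  qed simp
  then have hi: "((\<lambda>s. a * (B / (L + s * a)\<^sup>2)) has_integral (B / L - B / (L + a))) {0..1}" by simp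
  have "norm (integral {0..1} (\<lambda>s. a * k (s * a, z))) \<le> integral {0..1} (\<lambda>s. a * (B / (L + s * a)\<^sup>2))"
  proof (rule integral_norm_bound_integral)
    show "norm (a * k (s * a, z)) \<le> a * (B / (L + s * a)\<^sup>2)" if "s \<in> {0..1}" for s
      using mult_left_mono[OF assms(1)[OF that] assms(3)] assms(3) by (simp add: abs_mult)
    show "(\<lambda>s. a * k (s * a, z)) integrable_on {0..1}"
      by (intro integrable_continuous_interval continuous_on_compose2[OF assms(2)] continuous_intros) auto
    show "(\<lambda>s. a * (B / (L + s * a)\<^sup>2)) integrable_on {0..1}" using hi by blast
  qed
  also have "\<dots> \<le> B / L" using integral_unique[OF hi] assms by simp
  finally show ?thesis by (simp add: prim1_def)
qed

lemma prim_diff: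
  assumes "continuous_on UNIV k" "continuous_on UNIV k'"
  shows "prim1 (prim2 k) p - prim1 (prim2 k') p = prim1 (prim2 (\<lambda>p. k p - k' p)) p"
proof -
  have c: "continuous_on UNIV (prim2 k)" "continuous_on UNIV (prim2 k')"
    using assms by (auto intro: prim2_continuous_on)
  have "prim2 k q - prim2 k' q = prim2 (\<lambda>p. k p - k' p) q" for q
    unfolding prim2_def right_diff_distrib[symmetric]
    by (subst integral_diff)
       (auto intro!: integrable_continuous_interval continuous_on_compose2[OF assms(1)]
         continuous_on_compose2[OF assms(2)] continuous_intros)
  moreover have "prim1 (prim2 k) p - prim1 (prim2 k') p = prim1 (\<lambda>q. prim2 k q - prim2 k' q) p"
    unfolding prim1_def right_diff_distrib[symmetric]
    by (subst integral_diff)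
       (auto intro!: integrable_continuous_interval continuous_on_compose2[OF c(1)]
         continuous_on_compose2[OF c(2)] continuous_intros)
  ultimately show ?thesis by simp
qed

lemma prim1_prim2_bound:
  assumes "\<And>a z. 0 \<le> a \<Longrightarrow> 0 \<le> z \<Longrightarrow> z \<le> z0 \<Longrightarrow> \<bar>k (a, z)\<bar> \<le> B / (L + a)\<^sup>2"
    "continuous_on UNIV k" "0 \<le> a" "0 \<le> z" "z \<le> z0" "0 < L" "0 \<le> B"
  shows "\<bar>prim1 (prim2 k) (a, z)\<bar> \<le> z0 * B / L"
proof (rule prim1_bound)
  show "\<bar>prim2 k (s * a, z)\<bar> \<le> z0 * B / (L + s * a)\<^sup>2" if s: "s \<in> {0..1}" for s
  proof -
    have "\<bar>prim2 k (s * a, z)\<bar> \<le> z * (B / (L + s * a)\<^sup>2)"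
    proof (rule prim2_bound)
      fix s' :: real assume s': "s' \<in> {0..1}"
      have "s' * z \<le> z0" using s' assms(4,5) mult_left_le_one_le[of z s'] by auto
      then show "\<bar>k (s * a, s' * z)\<bar> \<le> B / (L + s * a)\<^sup>2"
        using assms s s' by auto
    qed (use assms in auto)
    also have "\<dots> \<le> z0 * (B / (L + s * a)\<^sup>2)"
      by (rule mult_right_mono) (use assms in auto)
    finally show ?thesis by simp
  qed
  show "continuous_on UNIV (prim2 k)" using assms(2) by (auto intro: prim2_continuous_on)
qed (use assms in auto)

lemma prim2_DERIV_param:
  assumes "open U" "convex U" "a \<in> U" "continuous_on UNIV k"
    and "\<And>a s. a \<in> U \<Longrightarrow> s \<in> {0..1} \<Longrightarrow> ((\<lambda>a. k (a, s * z)) has_real_derivative k' (a, s * z)) (at a)"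
    and "continuous_on (U \<times> {0..1}) (\<lambda>p. k' (fst p, snd p * z))"
  shows "((\<lambda>a. prim2 k (a, z)) has_real_derivative prim2 k' (a, z)) (at a)"
  unfolding prim2_def fst_conv snd_conv
  by (intro DERIV_cmult has_real_derivative_integral_param[of U] assms
      continuous_on_compose2[OF assms(4)] continuous_intros) auto

lemma prim1_DERIV_param:
  assumes "open U" "convex U" "z \<in> U" "continuous_on UNIV k"
    and "\<And>z s. z \<in> U \<Longrightarrow> s \<in> {0..1} \<Longrightarrow> ((\<lambda>z. k (s * a, z)) has_real_derivative k' (s * a, z)) (at z)"
    and "continuous_on (U \<times> {0..1}) (\<lambda>p. k' (snd p * a, fst p))"
  shows "((\<lambda>z. prim1 k (a, z)) has_real_derivative prim1 k' (a, z)) (at z)"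
  unfolding prim1_def fst_conv snd_conv
  by (intro DERIV_cmult has_real_derivative_integral_param[of U] assms
      continuous_on_compose2[OF assms(4)] continuous_intros) auto

text \<open>The clamps make the fixed-point equation total, so that it can be posed in the complete space
  of bounded continuous functions on the whole plane.\<close>

lemma goursat_fixpoint:
  fixes H :: "real \<times> real \<Rightarrow> real \<Rightarrow> real" and z0 B L :: real
  assumes cont: "continuous_on UNIV (\<lambda>q. H (fst q) (snd q))"
    and bound: "\<And>a z e. 0 \<le> a \<Longrightarrow> 0 \<le> z \<Longrightarrow> z \<le> z0 \<Longrightarrow> \<bar>e\<bar> \<le> 1 \<Longrightarrow> \<bar>H (a, z) e\<bar> \<le> B / (L + a)\<^sup>2"
    and lip: "\<And>a z e e'. 0 \<le> a \<Longrightarrow> 0 \<le> z \<Longrightarrow> z \<le> z0 \<Longrightarrow> \<bar>e\<bar> \<le> 1 \<Longrightarrow> \<bar>e'\<bar> \<le> 1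
        \<Longrightarrow> \<bar>H (a, z) e - H (a, z) e'\<bar> \<le> B * \<bar>e - e'\<bar> / (L + a)\<^sup>2"
    and pos: "0 < z0" "0 < L" "0 \<le> B" and small: "z0 * B / L \<le> 1 / 2"
  obtains d where "continuous_on UNIV d" "\<And>p. \<bar>d p\<bar> \<le> 1"
    "\<And>a z. d (a, z) = prim1 (prim2 (\<lambda>p. H p (d p))) (max a 0, max 0 (min z0 z))"
proof -
  define cl where "cl p = (max (fst p) (0::real), max 0 (min z0 (snd p)))" for p
  have cl: "continuous_on UNIV cl" unfolding cl_def by (intro continuous_intros)
  define R where "R d = (\<lambda>p. prim1 (prim2 (\<lambda>p. H p (d p))) (cl p))" for d
  \<comment> \<open>On a ball of fixed radius the quintic nonlinearity has a fixed Lipschitz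
    constant.\<close>
  define S where "S = cball (0 :: (real \<times> real) \<Rightarrow>\<^sub>C real) 1"
  have S: "\<bar>apply_bcontfun d p\<bar> \<le> 1" if "d \<in> S" for d p
    using that norm_bounded[of d p] by (simp add: S_def)
  have k: "continuous_on UNIV (\<lambda>p. H p (apply_bcontfun d p))" for d
  proof -
    have "continuous_on UNIV (\<lambda>p. (p, apply_bcontfun d p))"
      by (intro continuous_on_Pair continuous_on_id continuous_on_apply_bcontfun)
    from continuous_on_compose2[OF cont this] show ?thesis by simp
  qed
  have Rc: "continuous_on UNIV (R (apply_bcontfun d))" for d
  proof -
    have "continuous_on UNIV (prim2 (\<lambda>p. H p (apply_bcontfun d p)))"
      by (rule prim2_continuous_on[OF k]) auto
    then have "continuous_on UNIV (prim1 (prim2 (\<lambda>p. H p (apply_bcontfun d p))))"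
      by (rule prim1_continuous_on) auto
    from continuous_on_compose2[OF this cl] show ?thesis by (simp add: R_def)
  qed
  have Rb: "\<bar>R (apply_bcontfun d) p\<bar> \<le> 1" if "d \<in> S" for d p
  proof -
    have "\<bar>R (apply_bcontfun d) p\<bar> \<le> z0 * B / L"
      unfolding R_def cl_def
      by (rule prim1_prim2_bound[OF _ k]) (use bound S[OF that] pos in auto)
    then show ?thesis using small by linarith
  qed
  \<comment> \<open>\<open>Bcontfun\<close> is meaningful only for bounded continuous functions,
    which is why the next fact assumes that \<open>d\<close> lies in \<open>S\<close>.\<close>
  define T where "T d = Bcontfun (R (apply_bcontfun d))" for d
  have T: "apply_bcontfun (T d) = R (apply_bcontfun d)" if "d \<in> S" for d
    unfolding T_def
    by (rule Bcontfun_inverse) (rule bcontfun_normI[OF Rc], use Rb[OF that] in auto)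
  have "\<exists>!d\<in>S. T d = d"
  proof (rule Banach_fix[where c="1/2"])
    show "complete S" unfolding S_def by (simp add: complete_eq_closed)
    show "S \<noteq> {}" by (simp add: S_def)
    show "T ` S \<subseteq> S"
    proof
      fix y assume "y \<in> T ` S"
      then obtain d where d: "d \<in> S" "y = T d" by auto
      have "norm (T d) \<le> 1"
        by (rule norm_bound) (use T[OF d(1)] Rb[OF d(1)] in auto)
      then show "y \<in> S" using d by (simp add: S_def)
    qed
    fix d d' assume d: "d \<in> S" "d' \<in> S"
    show "dist (T d) (T d') \<le> 1 / 2 * dist d d'"
    proof (rule dist_bound)
      fix p
      have "\<bar>R (apply_bcontfun d) p - R (apply_bcontfun d') p\<bar> \<le> z0 * (B * dist d d') / L"
        unfolding R_def prim_diff[OF k k] cl_def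
      proof (rule prim1_prim2_bound)
        fix a z :: real assume az: "0 \<le> a" "0 \<le> z" "z \<le> z0"
        have "\<bar>H (a, z) (apply_bcontfun d (a, z)) - H (a, z) (apply_bcontfun d' (a, z))\<bar>
            \<le> B * \<bar>apply_bcontfun d (a, z) - apply_bcontfun d' (a, z)\<bar> / (L + a)\<^sup>2"
          by (rule lip[OF az S[OF d(1)] S[OF d(2)]])
        also have "\<dots> \<le> B * dist d d' / (L + a)\<^sup>2"
          using dist_bounded[of d "(a, z)" d'] pos(3)
          by (intro divide_right_mono mult_left_mono) (auto simp: dist_real_def)
        finally show "\<bar>H (a, z) (apply_bcontfun d (a, z)) - H (a, z) (apply_bcontfun d' (a, z))\<bar>
            \<le> B * dist d d' / (L + a)\<^sup>2" .
      qed (use pos k in \<open>auto intro!: continuous_intros\<close>)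
      also have "\<dots> = z0 * B / L * dist d d'" by simp
      also have "\<dots> \<le> 1 / 2 * dist d d'" by (rule mult_right_mono[OF small]) simp
      finally show "dist (apply_bcontfun (T d) p) (apply_bcontfun (T d') p) \<le> 1 / 2 * dist d d'"
        by (simp add: T d dist_real_def)
    qed
  qed auto
  then obtain d where d: "d \<in> S" "T d = d" by blast
  show ?thesis
  proof (rule that[of "apply_bcontfun d"])
    show "apply_bcontfun d (a, z) = prim1 (prim2 (\<lambda>p. H p (apply_bcontfun d p))) (max a 0, max 0 (min z0 z))" for a z
      using T[OF d(1)] d(2) by (simp add: R_def cl_def fun_eq_iff)
  qed (use S[OF d(1)] in auto)
qed

section \<open>The source term in null coordinates\<close>

lemma power5_diff_bound:
  fixes x y R :: real
  assumes "\<bar>x\<bar> \<le> R" "\<bar>y\<bar> \<le> R"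
  shows "\<bar>x ^ 5 - y ^ 5\<bar> \<le> 5 * R ^ 4 * \<bar>x - y\<bar>"
proof -
  have m: "\<bar>x ^ i * y ^ j\<bar> \<le> R ^ 4" if "i + j = 4" for i j
  proof -
    have "\<bar>x ^ i * y ^ j\<bar> \<le> R ^ i * R ^ j"
      unfolding abs_mult power_abs using assms by (intro mult_mono power_mono) auto
    then show ?thesis by (simp add: power_add[symmetric] that)
  qed
  have "x ^ 5 - y ^ 5 = (x ^ 4 * y ^ 0 + x ^ 3 * y ^ 1 + x ^ 2 * y ^ 2 + x ^ 1 * y ^ 3 + x ^ 0 * y ^ 4) * (x - y)"
    by (simp add: algebra_simps numeral_eq_Suc)
  moreover have "\<bar>x ^ 4 * y ^ 0 + x ^ 3 * y ^ 1 + x ^ 2 * y ^ 2 + x ^ 1 * y ^ 3 + x ^ 0 * y ^ 4\<bar> \<le> 5 * R ^ 4"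
    using m[of 4 0] m[of 3 1] m[of 2 2] m[of 1 3] m[of 0 4] unfolding abs_le_iff by linarith
  ultimately show ?thesis by (simp add: abs_mult mult_right_mono)
qed

text \<open>In the null coordinates \<open>a = r - t\<close> and \<open>z = 1 / (t + r)\<close> one has \<open>1 + a z = 2 r z\<close>,
  and \<open>scaled_soliton (a, z)\<close> is \<open>r W(r)\<close>.\<close>

definition scaled_soliton :: "real \<times> real \<Rightarrow> real" where
  "scaled_soliton p = sqrt 3 * (1 + fst p * snd p) / sqrt (12 * (snd p)\<^sup>2 + (1 + fst p * snd p)\<^sup>2)"

text \<open>This is 1 / (4 z^2 r^4) with r = (1 + a z) / (2 z): the power r^4 remains after the
  quintic in (r W + f + d) / r is multiplied by r, and 4 z^2 comes from the wave operator. In this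
  form it extends to z = 0.\<close>

definition null_weight :: "real \<times> real \<Rightarrow> real" where
  "null_weight p = 4 * (snd p)\<^sup>2 / (1 + fst p * snd p) ^ 4"

definition null_source :: "(real \<Rightarrow> real) \<Rightarrow> real \<times> real \<Rightarrow> real \<Rightarrow> real" where
  "null_source f p e = null_weight p *
     ((scaled_soliton p + f (fst p) + e) ^ 5 - scaled_soliton p ^ 5)"

lemma scaled_soliton_bound: "\<bar>scaled_soliton p\<bar> \<le> 2"
proof -
  let ?q = "1 + fst p * snd p" and ?X = "12 * (snd p)\<^sup>2 + (1 + fst p * snd p)\<^sup>2"
  have "\<bar>?q\<bar> \<le> sqrt ?X" by (rule real_le_rsqrt) simp
  moreover have "sqrt 3 \<le> (2::real)" by (rule real_le_lsqrt) auto
  ultimately have "sqrt 3 * \<bar>?q\<bar> \<le> 2 * sqrt ?X" by (intro mult_mono) auto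
  moreover have "\<bar>scaled_soliton p\<bar> = sqrt 3 * \<bar>?q\<bar> / sqrt ?X"
    by (simp add: scaled_soliton_def abs_divide abs_mult del: distrib_left distrib_right)
  moreover have "0 \<le> sqrt ?X" by simp
  \<comment> \<open>The denominator can vanish because \<open>p\<close> is arbitrary here; the
    quotient is then 0 by convention and the bound persists.\<close>
  then have "sqrt ?X = 0 \<or> 0 < sqrt ?X" by linarith
  ultimately show ?thesis
    by (elim disjE) (simp_all only: div_by_0 pos_divide_le_eq)
qed

text \<open>From z L \<le> 1 it follows that z (L + a) \<le> 1 + a z, so two of the four powers in
  the denominator pay for z^2 (L + a)^2. Thus L can be as large as the reciprocal of the width of
  the strip.\<close>

lemma null_weight_bound:
  assumes "0 \<le> a" "0 \<le> z" "z * L \<le> 1" "0 < L"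
  shows "\<bar>null_weight (a, z)\<bar> \<le> 4 / (L + a)\<^sup>2"
proof -
  have q: "1 \<le> 1 + a * z" using assms by simp
  have "(z * (L + a))\<^sup>2 \<le> (1 + a * z)\<^sup>2"
    using assms by (intro power_mono) (auto simp: algebra_simps)
  also have "\<dots> \<le> (1 + a * z) ^ 4" using q by (intro power_increasing) auto
  finally have "z\<^sup>2 * (L + a)\<^sup>2 \<le> (1 + a * z) ^ 4" by (simp add: power_mult_distrib)
  moreover have "0 < (L + a)\<^sup>2" using assms by simp
  moreover have "0 < (1 + a * z) ^ 4" using q by (intro zero_less_power) linarith
  ultimately have "4 * z\<^sup>2 / (1 + a * z) ^ 4 \<le> 4 / (L + a)\<^sup>2"
    by (simp add: divide_le_eq mult.commute pos_le_divide_eq)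
  then show ?thesis by (simp add: null_weight_def)
qed

lemma continuous_on_null:
  assumes "\<And>p. p \<in> S \<Longrightarrow> 0 < 1 + fst p * snd p"
  shows "continuous_on S scaled_soliton" "continuous_on S null_weight"
proof -
  have X: "0 < 12 * (snd p)\<^sup>2 + (1 + fst p * snd p)\<^sup>2" if "p \<in> S" for p
    using assms[OF that] by (intro add_nonneg_pos) auto
  show "continuous_on S scaled_soliton" unfolding scaled_soliton_def
    using X by (intro continuous_intros) (fastforce simp: less_imp_neq[symmetric])
  show "continuous_on S null_weight" unfolding null_weight_def
    using assms by (intro continuous_intros) (fastforce simp: less_imp_neq[symmetric])
qed

definition scaled_soliton_a :: "real \<times> real \<Rightarrow> real" where
  "scaled_soliton_a p = 12 * sqrt 3 * snd p ^ 3 / sqrt (12 * (snd p)\<^sup>2 + (1 + fst p * snd p)\<^sup>2) ^ 3"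

definition scaled_soliton_z :: "real \<times> real \<Rightarrow> real" where
  "scaled_soliton_z p = - 12 * sqrt 3 * snd p / sqrt (12 * (snd p)\<^sup>2 + (1 + fst p * snd p)\<^sup>2) ^ 3"

definition null_weight_a :: "real \<times> real \<Rightarrow> real" where
  "null_weight_a p = - 16 * snd p ^ 3 / (1 + fst p * snd p) ^ 5"

definition null_weight_z :: "real \<times> real \<Rightarrow> real" where
  "null_weight_z p = 8 * snd p / (1 + fst p * snd p) ^ 4 - 16 * (snd p)\<^sup>2 * fst p / (1 + fst p * snd p) ^ 5"

lemma continuous_on_null_deriv:
  assumes "\<And>p. p \<in> S \<Longrightarrow> 0 < 1 + fst p * snd p"
  shows "continuous_on S scaled_soliton_a" "continuous_on S null_weight_a"
    "continuous_on S scaled_soliton_z" "continuous_on S null_weight_z"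
proof -
  have X: "0 < 12 * (snd p)\<^sup>2 + (1 + fst p * snd p)\<^sup>2" if "p \<in> S" for p
    using assms[OF that] by (intro add_nonneg_pos) auto
  show "continuous_on S scaled_soliton_a" "continuous_on S scaled_soliton_z"
    unfolding scaled_soliton_a_def scaled_soliton_z_def
    using X by (intro continuous_intros; fastforce simp: less_imp_neq[symmetric])+
  show "continuous_on S null_weight_a" "continuous_on S null_weight_z"
    unfolding null_weight_a_def null_weight_z_def
    using assms by (intro continuous_intros; fastforce simp: less_imp_neq[symmetric])+
qed

text \<open>With q = 1 + a z and s^2 = 12 z^2 + q^2, the difference s^2 - q^2 = 12 z^2 collapses the
  numerators of both quotient rules.\<close>

lemma scaled_soliton_DERIV:
  assumes "0 < 1 + a * z"
  shows "((\<lambda>a. scaled_soliton (a, z)) has_real_derivative scaled_soliton_a (a, z)) (at a)"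
    and "((\<lambda>z. scaled_soliton (a, z)) has_real_derivative scaled_soliton_z (a, z)) (at z)"
proof -
  define X where "X = 12 * z\<^sup>2 + (1 + a * z)\<^sup>2"
  have X: "X > 0" unfolding X_def using assms by (intro add_nonneg_pos) auto
  define s where "s = sqrt X"
  have s: "s > 0" "s\<^sup>2 = X" using X by (auto simp: s_def)
  have "((\<lambda>a. 1 + a * z) has_real_derivative z) (at a)"
    by (auto intro!: derivative_eq_intros)
  moreover have "((\<lambda>a. 12 * z\<^sup>2 + (1 + a * z)\<^sup>2) has_real_derivative 2 * (1 + a * z) * z) (at a)"
    by (auto intro!: derivative_eq_intros simp: algebra_simps)
  from DERIV_chain2[OF DERIV_real_sqrt this] X
  have "((\<lambda>a. sqrt (12 * z\<^sup>2 + (1 + a * z)\<^sup>2)) has_real_derivative inverse s / 2 * (2 * (1 + a * z) * z)) (at a)"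
    by (simp add: s_def X_def)
  ultimately have "((\<lambda>a. sqrt 3 * (1 + a * z) / sqrt (12 * z\<^sup>2 + (1 + a * z)\<^sup>2)) has_real_derivative
      (sqrt 3 * z * s - sqrt 3 * (1 + a * z) * (inverse s / 2 * (2 * (1 + a * z) * z))) / (s * s)) (at a)"
    using DERIV_divide[OF DERIV_cmult] s(1) by (fastforce simp: s_def X_def)
  moreover have "(sqrt 3 * z * s - sqrt 3 * (1 + a * z) * (inverse s / 2 * (2 * (1 + a * z) * z))) / (s * s)
      = sqrt 3 * z * (s\<^sup>2 - (1 + a * z)\<^sup>2) / s ^ 3"
    using s(1) by (simp add: field_simps power2_eq_square power3_eq_cube)
  moreover have "s\<^sup>2 - (1 + a * z)\<^sup>2 = 12 * z\<^sup>2" by (simp add: s X_def)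
  ultimately show "((\<lambda>a. scaled_soliton (a, z)) has_real_derivative scaled_soliton_a (a, z)) (at a)"
    by (simp add: scaled_soliton_def scaled_soliton_a_def s_def X_def power2_eq_square power3_eq_cube mult_ac)
  have "((\<lambda>z. 1 + a * z) has_real_derivative a) (at z)"
    by (auto intro!: derivative_eq_intros)
  moreover have "((\<lambda>z. 12 * z\<^sup>2 + (1 + a * z)\<^sup>2) has_real_derivative 2 * (12 * z + (1 + a * z) * a)) (at z)"
    by (auto intro!: derivative_eq_intros simp: algebra_simps)
  from DERIV_chain2[OF DERIV_real_sqrt this] X
  have "((\<lambda>z. sqrt (12 * z\<^sup>2 + (1 + a * z)\<^sup>2)) has_real_derivative inverse s / 2 * (2 * (12 * z + (1 + a * z) * a))) (at z)"
    by (simp add: s_def X_def)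
  ultimately have "((\<lambda>z. sqrt 3 * (1 + a * z) / sqrt (12 * z\<^sup>2 + (1 + a * z)\<^sup>2)) has_real_derivative
      (sqrt 3 * a * s - sqrt 3 * (1 + a * z) * (inverse s / 2 * (2 * (12 * z + (1 + a * z) * a)))) / (s * s)) (at z)"
    using DERIV_divide[OF DERIV_cmult] s(1) by (fastforce simp: s_def X_def)
  moreover have "(sqrt 3 * a * s - sqrt 3 * (1 + a * z) * (inverse s / 2 * (2 * (12 * z + (1 + a * z) * a)))) / (s * s)
      = sqrt 3 * (a * (s\<^sup>2 - (1 + a * z)\<^sup>2) - 12 * z * (1 + a * z)) / s ^ 3"
    using s(1) by (simp add: field_simps power2_eq_square power3_eq_cube)
  moreover have "a * (s\<^sup>2 - (1 + a * z)\<^sup>2) - 12 * z * (1 + a * z) = - 12 * z"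
    unfolding s(2) X_def by (simp add: algebra_simps power2_eq_square)
  ultimately show "((\<lambda>z. scaled_soliton (a, z)) has_real_derivative scaled_soliton_z (a, z)) (at z)"
    by (simp add: scaled_soliton_def scaled_soliton_z_def s_def X_def mult_ac)
qed

lemma null_weight_DERIV:
  assumes "0 < 1 + a * z"
  shows "((\<lambda>a. null_weight (a, z)) has_real_derivative null_weight_a (a, z)) (at a)"
    and "((\<lambda>z. null_weight (a, z)) has_real_derivative null_weight_z (a, z)) (at z)"
proof -
  let ?q = "1 + a * z"
  have n: "?q \<noteq> 0" using assms by simp
  have "((\<lambda>a. 4 * z\<^sup>2 / (1 + a * z) ^ 4) has_real_derivative
      (0 - 4 * z\<^sup>2 * (4 * ?q ^ 3 * z)) / (?q ^ 4 * ?q ^ 4)) (at a)"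
    using n by (auto intro!: derivative_eq_intros)
  moreover have "(0 - 4 * z\<^sup>2 * (4 * Q ^ 3 * z)) / (Q ^ 4 * Q ^ 4) = - 16 * z ^ 3 / Q ^ 5"
    if "Q \<noteq> 0" for Q :: real
    using that by (simp add: field_simps numeral_eq_Suc)
  ultimately show "((\<lambda>a. null_weight (a, z)) has_real_derivative null_weight_a (a, z)) (at a)"
    using n by (simp add: null_weight_def null_weight_a_def)
  have "((\<lambda>z. 4 * z\<^sup>2 / (1 + a * z) ^ 4) has_real_derivative
      (8 * z * ?q ^ 4 - 4 * z\<^sup>2 * (4 * ?q ^ 3 * a)) / (?q ^ 4 * ?q ^ 4)) (at z)"
    using n by (auto intro!: derivative_eq_intros)
  moreover have "(8 * z * Q ^ 4 - 4 * z\<^sup>2 * (4 * Q ^ 3 * a)) / (Q ^ 4 * Q ^ 4) = 8 * z / Q ^ 4 - 16 * z\<^sup>2 * a / Q ^ 5"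
    if "Q \<noteq> 0" for Q :: real
    using that by (simp add: field_simps numeral_eq_Suc)
  ultimately show "((\<lambda>z. null_weight (a, z)) has_real_derivative null_weight_z (a, z)) (at z)"
    using n by (simp add: null_weight_def null_weight_z_def)
qed

lemma null_source_zero: "f (fst p) = 0 \<Longrightarrow> null_source f p 0 = 0"
  by (simp add: null_source_def)

lemma null_source_continuous:
  assumes "continuous_on UNIV f" "\<And>q. q \<in> S \<Longrightarrow> 0 < 1 + fst (P q) * snd (P q)"
    "continuous_on S P" "continuous_on S e"
  shows "continuous_on S (\<lambda>q. null_source f (P q) (e q))"
proof -
  have "continuous_on S (\<lambda>q. scaled_soliton (P q))" "continuous_on S (\<lambda>q. null_weight (P q))"
    using assms(2) by (auto intro!: continuous_on_compose2[OF continuous_on_null(1)[of "P ` S"] assms(3)]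
        continuous_on_compose2[OF continuous_on_null(2)[of "P ` S"] assms(3)])
  moreover have "continuous_on S (\<lambda>q. f (fst (P q)))"
    by (rule continuous_on_compose2[OF assms(1)]) (auto intro: continuous_intros assms(3))
  ultimately show ?thesis unfolding null_source_def by (intro continuous_intros assms(4))
qed

text \<open>The radius M + 3 adds the bounds 2 for r W, M for f and 1 for the unknown; 20 is the 4
  of the weight times the 5 of the quintic. The second estimate compares with the pure soliton term,
  from which the argument differs by at most M + 1.\<close>

lemma null_source_lipschitz:
  assumes "0 \<le> a" "0 \<le> z" "z * L \<le> 1" "0 < L" "\<And>a. \<bar>f a\<bar> \<le> M" "\<bar>e\<bar> \<le> 1" "\<bar>e'\<bar> \<le> 1"
  shows "\<bar>null_source f (a, z) e - null_source f (a, z) e'\<bar> \<le> 20 * (M + 3) ^ 4 * \<bar>e - e'\<bar> / (L + a)\<^sup>2"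
    and "\<bar>null_source f (a, z) e\<bar> \<le> 20 * (M + 3) ^ 4 * (M + 1) / (L + a)\<^sup>2"
proof -
  let ?y = "scaled_soliton (a, z)"
  have y: "\<bar>?y\<bar> \<le> 2" by (rule scaled_soliton_bound)
  have M: "\<bar>f a\<bar> \<le> M" by (rule assms(5))
  have w: "\<bar>null_weight (a, z)\<bar> \<le> 4 / (L + a)\<^sup>2" using null_weight_bound assms(1-4) by blast
  have main: "\<bar>null_weight (a, z) * (u ^ 5 - v ^ 5)\<bar> \<le> 20 * (M + 3) ^ 4 * D / (L + a)\<^sup>2"
    if "\<bar>u\<bar> \<le> M + 3" "\<bar>v\<bar> \<le> M + 3" "\<bar>u - v\<bar> \<le> D" for u v D
  proof -
    have "\<bar>u ^ 5 - v ^ 5\<bar> \<le> 5 * (M + 3) ^ 4 * \<bar>u - v\<bar>" by (rule power5_diff_bound[OF that(1,2)])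
    also have "\<dots> \<le> 5 * (M + 3) ^ 4 * D" by (rule mult_left_mono[OF that(3)]) simp
    finally have "\<bar>null_weight (a, z) * (u ^ 5 - v ^ 5)\<bar> \<le> 4 / (L + a)\<^sup>2 * (5 * (M + 3) ^ 4 * D)"
      unfolding abs_mult using w by (intro mult_mono) auto
    then show ?thesis by (simp add: mult_ac)
  qed
  show "\<bar>null_source f (a, z) e - null_source f (a, z) e'\<bar> \<le> 20 * (M + 3) ^ 4 * \<bar>e - e'\<bar> / (L + a)\<^sup>2"
    using main[of "?y + f a + e" "?y + f a + e'" "\<bar>e - e'\<bar>"] y M assms(6,7)
    by (simp add: null_source_def right_diff_distrib[symmetric])
  show "\<bar>null_source f (a, z) e\<bar> \<le> 20 * (M + 3) ^ 4 * (M + 1) / (L + a)\<^sup>2"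
    using main[of "?y + f a + e" "?y" "M + 1"] y M assms(6) by (simp add: null_source_def)
qed

text \<open>One formula for both coordinate directions: \<open>cw\<close>, \<open>cy\<close> and
  \<open>ce\<close> stand for the derivatives of the weight, of r W and of f + e in the chosen
  direction.\<close>

definition null_source_deriv ::
  "(real \<Rightarrow> real) \<Rightarrow> (real \<times> real \<Rightarrow> real) \<Rightarrow> (real \<times> real \<Rightarrow> real) \<Rightarrow> (real \<times> real \<Rightarrow> real) \<Rightarrow> (real \<times> real \<Rightarrow> real)
    \<Rightarrow> real \<times> real \<Rightarrow> real" where
  "null_source_deriv f e cw cy ce p = cw p * ((scaled_soliton p + f (fst p) + e p) ^ 5 - scaled_soliton p ^ 5)
     + null_weight p * (5 * (scaled_soliton p + f (fst p) + e p) ^ 4 * (cy p + ce p) - 5 * scaled_soliton p ^ 4 * cy p)"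

lemma null_source_deriv_continuous:
  assumes "continuous_on UNIV f" "\<And>p. p \<in> S \<Longrightarrow> 0 < 1 + fst p * snd p"
    "continuous_on S e" "continuous_on S cw" "continuous_on S cy" "continuous_on S ce"
  shows "continuous_on S (null_source_deriv f e cw cy ce)"
proof -
  have "continuous_on S (\<lambda>p. f (fst p))"
    by (rule continuous_on_compose2[OF assms(1)]) (auto intro: continuous_intros)
  then show ?thesis unfolding null_source_deriv_def
    by (intro continuous_intros continuous_on_null assms)
qed

lemma null_source_DERIV:
  fixes c y w :: "real \<Rightarrow> real"
  assumes "(c has_real_derivative c') (at x)" "(y has_real_derivative y') (at x)" "(w has_real_derivative w') (at x)"
  shows "((\<lambda>x. c x * ((y x + w x) ^ 5 - y x ^ 5)) has_real_derivative
     c' * ((y x + w x) ^ 5 - y x ^ 5) + c x * (5 * (y x + w x) ^ 4 * (y' + w') - 5 * y x ^ 4 * y')) (at x)"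
  using assms by (auto intro!: derivative_eq_intros simp: algebra_simps)

text \<open>If d is the double primitive of its source k, then d_a, d_z and d_az are
  \<open>prim2 k\<close>, \<open>prim1 k\<close> and k. The chain rule for k calls only for these
  first derivatives of d, so k is differentiable in its turn, and the pure second derivatives of d
  follow by differentiation under the integral. The domain extends to a > -1 in order to overlap the
  region where d = 0.\<close>

lemma goursat_solution:
  fixes f f' :: "real \<Rightarrow> real" and M :: real
  assumes f: "\<And>a. (f has_real_derivative f' a) (at a)" and f': "continuous_on UNIV f'"
    and M: "\<And>a. \<bar>f a\<bar> \<le> M" and f0: "\<And>a. a \<le> 0 \<Longrightarrow> f a = 0"
  obtains z0 C :: real and d da dz daa dzz :: "real \<times> real \<Rightarrow> real"
  where "0 < z0"
    "\<And>p. p \<in> {-1<..} \<times> {0<..<z0} \<Longrightarrow> (d has_derivative (\<lambda>h. da p * fst h + dz p * snd h)) (at p)"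
    "\<And>p. p \<in> {-1<..} \<times> {0<..<z0} \<Longrightarrow>
       (da has_derivative (\<lambda>h. daa p * fst h + null_source f p (d p) * snd h)) (at p)"
    "\<And>p. p \<in> {-1<..} \<times> {0<..<z0} \<Longrightarrow>
       (dz has_derivative (\<lambda>h. null_source f p (d p) * fst h + dzz p * snd h)) (at p)"
    "continuous_on ({-1<..} \<times> {0<..<z0}) (\<lambda>p. null_source f p (d p))"
    "continuous_on ({-1<..} \<times> {0<..<z0}) daa" "continuous_on ({-1<..} \<times> {0<..<z0}) dzz"
    "\<And>a z. a \<le> 0 \<Longrightarrow> d (a, z) = 0"
    "\<And>a z. 0 < z \<Longrightarrow> z < z0 \<Longrightarrow> \<bar>d (a, z)\<bar> \<le> C \<and> \<bar>da (a, z)\<bar> \<le> C * z \<and> \<bar>dz (a, z)\<bar> \<le> C"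
proof -
  have M0: "0 \<le> M" using M[of 0] by linarith
  define B where "B = 20 * (M + 3) ^ 4 * (M + 1)"
  have B: "0 \<le> B" using M0 by (simp add: B_def)
  \<comment> \<open>This gives both z0 \<le> 1/2, which keeps 1 + a z positive down to a = -1, and
    z0 B \<le> 1/2. With L = 1 / z0 the contraction constant is z0^2 B.\<close>
  define z0 where "z0 = 1 / (2 + 2 * B)"
  define L where "L = 1 / z0"
  have z0: "0 < z0" "z0 \<le> 1/2" "z0 * B \<le> 1/2" using B by (auto simp: z0_def field_simps)
  have L: "0 < L" "1 \<le> L" "z0 * L = 1" using z0 by (auto simp: L_def field_simps)
  have zL: "z * L \<le> 1" if "z \<le> z0" for z
    using mult_right_mono[OF that, of L] L by simp
  have fc: "continuous_on UNIV f" using f DERIV_isCont continuous_at_imp_continuous_on by blast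
  \<comment> \<open>This clamp, unlike the one of the fixed point, acts at a = -1: the source is
    continuous on the whole plane and still unmodified on both sides of the cone a = 0.\<close>
  define cl where "cl p = (max (-1) (fst p), max 0 (min z0 (snd p)))" for p :: "real \<times> real"
  have cl_pos: "0 < 1 + fst (cl p) * snd (cl p)" for p
  proof -
    have "- 1 * snd (cl p) \<le> fst (cl p) * snd (cl p)"
      by (intro mult_right_mono) (auto simp: cl_def)
    moreover have "snd (cl p) \<le> 1/2" using z0 by (auto simp: cl_def)
    ultimately show ?thesis by linarith
  qed
  have cl_id: "cl (a, z) = (a, z)" if "-1 \<le> a" "0 \<le> z" "z \<le> z0" for a z
    using that by (auto simp: cl_def)
  define H where "H p e = null_source f (cl p) e" for p e
  have Hc: "continuous_on UNIV (\<lambda>q. H (fst q) (snd q))"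
    unfolding H_def
    by (rule null_source_continuous[OF fc cl_pos]) (auto intro!: continuous_intros simp: cl_def)
  obtain d where dc: "continuous_on UNIV d" and d1: "\<And>p. \<bar>d p\<bar> \<le> 1"
    and d: "\<And>a z. d (a, z) = prim1 (prim2 (\<lambda>p. H p (d p))) (max a 0, max 0 (min z0 z))"
  proof (rule goursat_fixpoint[OF Hc, of z0 B L])
    fix a z e e' :: real assume az: "0 \<le> a" "0 \<le> z" "z \<le> z0" and e: "\<bar>e\<bar> \<le> 1" "\<bar>e'\<bar> \<le> 1"
    have "\<bar>H (a, z) e - H (a, z) e'\<bar> \<le> 20 * (M + 3) ^ 4 * \<bar>e - e'\<bar> / (L + a)\<^sup>2"
      unfolding H_def using az e null_source_lipschitz(1)[OF az(1,2) zL[OF az(3)] L(1) M e] by (simp add: cl_id)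
    also have "\<dots> \<le> B * \<bar>e - e'\<bar> / (L + a)\<^sup>2"
      using M0 unfolding B_def
      by (intro divide_right_mono mult_right_mono) (auto simp: mult_le_cancel_left1)
    finally show "\<bar>H (a, z) e - H (a, z) e'\<bar> \<le> B * \<bar>e - e'\<bar> / (L + a)\<^sup>2" .
  next
    fix a z e :: real assume az: "0 \<le> a" "0 \<le> z" "z \<le> z0" and e: "\<bar>e\<bar> \<le> 1"
    show "\<bar>H (a, z) e\<bar> \<le> B / (L + a)\<^sup>2"
      unfolding H_def B_def using az e null_source_lipschitz(2)[OF az(1,2) zL[OF az(3)] L(1) M e e] by (simp add: cl_id)
  next
    have "z0 * B / L \<le> z0 * B / 1" using L(2) z0 B by (intro divide_left_mono) auto
    then show "z0 * B / L \<le> 1 / 2" using z0 by linarith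
  qed (use z0 L B in auto)
  define k where "k p = H p (d p)" for p
  note d = d[folded k_def]
  have kc: "continuous_on UNIV k"
  proof -
    have "continuous_on UNIV (\<lambda>p. (p, d p))" by (intro continuous_intros dc)
    from continuous_on_compose2[OF Hc this] show ?thesis by (simp add: k_def)
  qed
  have k2c: "continuous_on UNIV (prim2 k)" and k1c: "continuous_on UNIV (prim1 k)"
    by (rule prim2_continuous_on[OF kc] prim1_continuous_on[OF kc]; simp)+
  have d0: "d (a, z) = 0" if "a \<le> 0" for a z
    using that by (simp add: d prim1_def)
  have k0: "k (a, z) = 0" if "a \<le> 0" for a z
    using that d0[OF that] f0 by (simp add: k_def H_def null_source_zero cl_def)
  have k20: "prim2 k (a, z) = 0" if "a \<le> 0" for a z
    using that k0 by (simp add: prim2_def)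
  have k10: "prim1 k (a, z) = 0" if "a \<le> 0" for a z
  proof -
    have "integral {0..1} (\<lambda>s. k (s * a, z)) = integral {0..1} (\<lambda>s::real. 0)"
      by (intro integral_cong) (use k0 that in \<open>auto simp: mult_nonneg_nonpos\<close>)
    then show ?thesis by (simp add: prim1_def)
  qed
  \<comment> \<open>The fixed point freezes a at 0, but the source vanishes for a \<le> 0, so the
    unfrozen double primitive gives the same value there. Hence d is differentiable across the
    cone.\<close>
  have deq: "d (a, z) = prim1 (prim2 k) (a, z)" if "0 \<le> z" "z \<le> z0" for a z
  proof (cases "0 \<le> a")
    case True
    then show ?thesis using that by (simp add: d max_def min_def)
  next
    case False
    have "integral {0..1} (\<lambda>s. prim2 k (s * a, z)) = integral {0..1} (\<lambda>s::real. 0)"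
      by (intro integral_cong) (use k20 False in \<open>auto simp: mult_nonneg_nonpos\<close>)
    then show ?thesis using False d0[of a] by (simp add: prim1_def)
  qed
  have d_a: "((\<lambda>a. d (a, z)) has_real_derivative prim2 k (a, z)) (at a)" if "0 \<le> z" "z \<le> z0" for a z
    unfolding deq[OF that] by (rule prim1_DERIV[OF k2c])
  have d_z: "((\<lambda>z. d (a, z)) has_real_derivative prim1 k (a, z)) (at z)" if "0 < z" "z < z0" for a z
  proof (rule has_field_derivative_transform_within_open[of _ _ _ "{0<..<z0}"])
    show "((\<lambda>z. prim1 (prim2 k) (a, z)) has_real_derivative prim1 k (a, z)) (at z)"
    proof (rule prim1_DERIV_param[OF open_UNIV convex_UNIV UNIV_I k2c prim2_DERIV[OF kc]])
      show "continuous_on (UNIV \<times> {0..1}) (\<lambda>p. k (snd p * a, fst p))"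
        by (rule continuous_on_compose2[OF kc]) (auto intro!: continuous_intros)
    qed
  qed (use that deq in auto)
  \<comment> \<open>The derivatives of d that enter are already known as primitives of k, so no
    second derivative of d appears and the regularity argument is not circular.\<close>
  define ka where "ka = null_source_deriv f d null_weight_a scaled_soliton_a (\<lambda>p. f' (fst p) + prim2 k p)"
  define kz where "kz = null_source_deriv f d null_weight_z scaled_soliton_z (prim1 k)"
  have q: "0 < 1 + a * z" if "-1 < a" "0 \<le> z" "z \<le> z0" for a z
    using cl_pos[of "(a, z)"] cl_id[of a z] that by simp
  have keq: "k (a, z) = null_source f (a, z) (d (a, z))" if "-1 < a" "0 \<le> z" "z \<le> z0" for a z
    using that by (simp add: k_def H_def cl_id)
  have k_a: "((\<lambda>a. k (a, z)) has_real_derivative ka (a, z)) (at a)" if "-1 < a" "0 \<le> z" "z \<le> z0" for a z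
  proof (rule has_field_derivative_transform_within_open[of _ _ _ "{-1<..}"])
    have "((\<lambda>a. f a + d (a, z)) has_real_derivative f' a + prim2 k (a, z)) (at a)"
      by (rule DERIV_add[OF f d_a[OF that(2,3)]])
    from null_source_DERIV[OF null_weight_DERIV(1)[OF q[OF that]] scaled_soliton_DERIV(1)[OF q[OF that]] this]
    show "((\<lambda>a. null_source f (a, z) (d (a, z))) has_real_derivative ka (a, z)) (at a)"
      by (simp add: null_source_def ka_def null_source_deriv_def add.assoc)
  qed (use that keq in auto)
  have k_z: "((\<lambda>z. k (a, z)) has_real_derivative kz (a, z)) (at z)" if "-1 < a" "0 < z" "z < z0" for a z
  proof (rule has_field_derivative_transform_within_open[of _ _ _ "{0<..<z0}"])
    have q': "0 < 1 + a * z" using q that by simp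
    have "((\<lambda>z. f a + d (a, z)) has_real_derivative 0 + prim1 k (a, z)) (at z)"
      by (rule DERIV_add[OF DERIV_const d_z[OF that(2,3)]])
    from null_source_DERIV[OF null_weight_DERIV(2)[OF q'] scaled_soliton_DERIV(2)[OF q'] this]
    show "((\<lambda>z. null_source f (a, z) (d (a, z))) has_real_derivative kz (a, z)) (at z)"
      by (simp add: null_source_def kz_def null_source_deriv_def add.assoc)
  qed (use that keq in auto)
  \<comment> \<open>Primitives in z start at null infinity z = 0, so continuity of the
    differentiated source is required up to that edge.\<close>
  let ?D = "{-1::real<..} \<times> {0..z0}" and ?G = "{-1::real<..} \<times> {0<..<z0}"
  have posD: "0 < 1 + fst p * snd p" if "p \<in> ?D" for p using that q by auto
  have kac: "continuous_on ?D ka"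
  proof -
    have "continuous_on ?D (\<lambda>p. f' (fst p) + prim2 k p)"
      by (intro continuous_intros continuous_on_compose2[OF f'] continuous_on_subset[OF k2c]) auto
    then show ?thesis unfolding ka_def
      by (intro null_source_deriv_continuous fc posD continuous_on_null_deriv continuous_on_subset[OF dc]) auto
  qed
  have kzc: "continuous_on ?D kz"
    unfolding kz_def
    by (intro null_source_deriv_continuous fc posD continuous_on_null_deriv continuous_on_subset[OF dc]
        continuous_on_subset[OF k1c]) auto
  have scale: "0 \<le> s * z" "s * z \<le> z0" if "s \<in> {0..1}" "0 \<le> z" "z \<le> z0" for s z :: real
    using that mult_left_le_one_le[of z s] by auto
  have scale': "-1 < s * a" if "s \<in> {0..1}" "-1 < a" for s a :: real
  proof (cases "0 \<le> a")
    case False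
    then have "1 * a \<le> s * a" using that by (intro mult_right_mono_neg) auto
    then show ?thesis using that by simp
  next
    case True
    then have "0 \<le> s * a" using that by auto
    then show ?thesis by linarith
  qed
  have G: "open ?G" by (intro open_Times open_greaterThan open_greaterThanLessThan)
  have sub: "?G \<subseteq> ?D" by auto
  have daac: "continuous_on ?G (prim2 ka)"
    by (rule prim2_continuous_on[OF kac]) (use scale in auto)
  have dzzc: "continuous_on ?G (prim1 kz)"
    by (rule prim1_continuous_on[OF kzc]) (use scale' in auto)
  have da_a: "((\<lambda>a. prim2 k (a, z)) has_real_derivative prim2 ka (a, z)) (at a)"
    if "-1 < a" "0 < z" "z < z0" for a z
  proof (rule prim2_DERIV_param[OF _ _ _ kc, of "{-1<..}"])
    show "((\<lambda>a. k (a, s * z)) has_real_derivative ka (a, s * z)) (at a)" if "a \<in> {-1<..}" "s \<in> {0..1}" for a s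
      using k_a[of a "s * z"] scale[of s z] that \<open>0 < z\<close> \<open>z < z0\<close> by auto
    show "continuous_on ({-1<..} \<times> {0..1}) (\<lambda>p. ka (fst p, snd p * z))"
      by (rule continuous_on_compose2[OF kac]) (use scale[of _ z] that in \<open>auto intro!: continuous_intros\<close>)
  qed (use that in auto)
  have dz_z: "((\<lambda>z. prim1 k (a, z)) has_real_derivative prim1 kz (a, z)) (at z)"
    if "-1 < a" "0 < z" "z < z0" for a z
  proof (rule prim1_DERIV_param[OF _ _ _ kc, of "{0<..<z0}"])
    show "((\<lambda>z. k (s * a, z)) has_real_derivative kz (s * a, z)) (at z)" if "z \<in> {0<..<z0}" "s \<in> {0..1}" for z s
      using k_z[of "s * a" z] scale'[of s a] that \<open>-1 < a\<close> by auto
    show "continuous_on ({0<..<z0} \<times> {0..1}) (\<lambda>p. kz (snd p * a, fst p))"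
      by (rule continuous_on_compose2[OF kzc]) (use scale'[of _ a] that in \<open>auto intro!: continuous_intros\<close>)
  qed (use that in auto)
  have kb: "\<bar>k (a, z)\<bar> \<le> B / (L + a)\<^sup>2" if "0 \<le> a" "0 \<le> z" "z \<le> z0" for a z
    using null_source_lipschitz(2)[OF that(1,2) zL[OF that(3)] L(1) M d1 d1] that
    by (simp add: k_def H_def B_def cl_id)
  have kb': "\<bar>k (a, z)\<bar> \<le> B" if "0 \<le> z" "z \<le> z0" for a z
  proof (cases "0 \<le> a")
    case True
    have "1\<^sup>2 \<le> (L + a)\<^sup>2" using L(2) True by (intro power_mono) auto
    then have "B / (L + a)\<^sup>2 \<le> B / 1" using B by (intro divide_left_mono) auto
    then show ?thesis using kb[OF True that] by simp
  qed (use k0 B in auto)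
  have nsc: "continuous_on ?G (\<lambda>p. null_source f p (d p))"
    by (rule continuous_on_eq[OF continuous_on_subset[OF kc]]) (use keq in auto)
  show ?thesis
  \<comment> \<open>In the constant \<open>max 1 B\<close>, 1 bounds d and B bounds the source;
    integration over [0, z] gives B z for d_a, integration in a gives B / L \<le> B for d_z.\<close>
  proof (rule that[of z0 d "prim2 k" "prim1 k" "prim2 ka" "prim1 kz" "max 1 B"])
    fix p assume p: "p \<in> ?G"
    obtain a z where az: "p = (a, z)" "-1 < a" "0 < z" "z < z0" using p by auto
    have kp: "null_source f p (d p) = k p" using keq az by simp
    show "(d has_derivative (\<lambda>h. prim2 k p * fst h + prim1 k p * snd h)) (at p)"
      by (rule C1_has_derivative[OF G p]) (use az d_a d_z k1c in \<open>auto intro: continuous_on_subset\<close>)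
    show "(prim2 k has_derivative (\<lambda>h. prim2 ka p * fst h + null_source f p (d p) * snd h)) (at p)"
      unfolding kp
      by (rule C1_has_derivative[OF G p]) (use az da_a prim2_DERIV[OF kc] kc in \<open>auto intro: continuous_on_subset\<close>)
    show "(prim1 k has_derivative (\<lambda>h. null_source f p (d p) * fst h + prim1 kz p * snd h)) (at p)"
      unfolding kp
      by (rule C1_has_derivative[OF G p]) (use az dz_z prim1_DERIV[OF kc] dzzc in auto)
  next
    fix a z :: real assume z: "0 < z" "z < z0"
    have "\<bar>prim2 k (a, z)\<bar> \<le> z * B"
      by (rule prim2_bound) (use kb' kc z scale[of _ z] in auto)
    then have 1: "\<bar>prim2 k (a, z)\<bar> \<le> max 1 B * z"
      using z(1) by (auto simp: mult.commute max_def intro: order_trans mult_right_mono)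
    have "\<bar>prim1 k (a, z)\<bar> \<le> B / L"
    proof (cases "0 \<le> a")
      case True
      show ?thesis by (rule prim1_bound[OF _ kc True L(1) B]) (use kb z True in auto)
    qed (use k10 B L in auto)
    also have "B / L \<le> B / 1" using L(2) B by (intro divide_left_mono) auto
    finally show "\<bar>d (a, z)\<bar> \<le> max 1 B \<and> \<bar>prim2 k (a, z)\<bar> \<le> max 1 B * z \<and> \<bar>prim1 k (a, z)\<bar> \<le> max 1 B"
      using 1 d1[of "(a, z)"] by auto
  qed (use z0 nsc daac dzzc d0 in auto)
qed

section \<open>The soliton\<close>

text \<open>A free exponent closes the family under differentiation up to coordinate factors; the
  soliton is the exponent - 1/2.\<close>

definition soliton_power :: "real \<Rightarrow> spacetime \<Rightarrow> real" where
  "soliton_power s p = (1 + (norm (snd p))\<^sup>2 / 3) powr s"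

lemma soliton_base_pos: "0 < 1 + (norm x)\<^sup>2 / 3"
  by (simp add: add_pos_nonneg)

lemma soliton_power_has_derivative:
  "(soliton_power s has_derivative (\<lambda>h. 2 / 3 * s * soliton_power (s - 1) p * (snd p \<bullet> snd h))) (at p)"
proof -
  have "((\<lambda>p::spacetime. 1 + (snd p \<bullet> snd p) / 3) has_derivative (\<lambda>h. 2 / 3 * (snd p \<bullet> snd h))) (at p)"
    by (auto intro!: derivative_eq_intros simp: inner_commute)
  then have "((\<lambda>p::spacetime. 1 + (norm (snd p))\<^sup>2 / 3) has_derivative (\<lambda>h. 2 / 3 * (snd p \<bullet> snd h))) (at p)"
    by (simp add: power2_norm_eq_inner)
  moreover have "((\<lambda>z. z powr s) has_real_derivative s * (1 + (norm (snd p))\<^sup>2 / 3) powr (s - 1))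
      (at (1 + (norm (snd p))\<^sup>2 / 3))"
    by (rule has_real_derivative_powr[OF soliton_base_pos])
  ultimately have "((\<lambda>p::spacetime. (1 + (norm (snd p))\<^sup>2 / 3) powr s) has_derivative
     (\<lambda>h. s * (1 + (norm (snd p))\<^sup>2 / 3) powr (s - 1) * (2 / 3 * (snd p \<bullet> snd h)))) (at p)"
    unfolding has_field_derivative_def by (rule has_derivative_compose)
  then show ?thesis
    unfolding soliton_power_def by (rule has_derivative_eq_rhs) (simp add: fun_eq_iff)
qed

lemma partial_soliton_power_0: "partial 0 (soliton_power s) p = 0"
  using partial_eq[OF soliton_power_has_derivative, of 0] by (simp add: snd_coord_dir_0)

lemma partial_soliton_power:
  assumes "i \<in> {1..3}"
  shows "partial i (soliton_power s) p = 2 / 3 * s * soliton_power (s - 1) p * snd p $ of_nat i"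
  using partial_eq[OF soliton_power_has_derivative, of i] coord_dir_inner[OF assms] by simp

lemma Ck_on_soliton_power: "Ck_on k UNIV (soliton_power s)"
proof (induction k arbitrary: s)
  case 0
  have "continuous_on UNIV (soliton_power s)"
    by (intro continuous_at_imp_continuous_on ballI has_derivative_continuous[OF soliton_power_has_derivative])
  then show ?case by simp
next
  case (Suc k)
  show ?case
  proof (rule Ck_on_SucI[OF open_UNIV soliton_power_has_derivative])
    fix \<mu> :: nat assume "\<mu> \<in> {0..3}"
    then consider "\<mu> = 0" | "\<mu> \<in> {1..3}" by fastforce
    then show "Ck_on k UNIV (\<lambda>p. 2 / 3 * s * soliton_power (s - 1) p * (snd p \<bullet> snd (coord_dir \<mu>)))"
    proof cases
      case 1
      then show ?thesis by (simp add: snd_coord_dir_0 Ck_on_const)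
    next
      case 2
      show ?thesis unfolding coord_dir_inner[OF 2]
        by (intro Ck_on_mult Suc Ck_on_const Ck_on_linear open_UNIV bounded_linear_coord)
    qed
  qed
qed

lemma soliton_eq: "(\<lambda>q::spacetime. soliton (snd q)) = soliton_power (- 1 / 2)"
  by (simp add: soliton_def soliton_power_def fun_eq_iff)

text \<open>With Q = 1 + r^2/3 the Laplacian of Q^(-1/2) is - Q^(-3/2) + (r^2/3) Q^(-5/2) = -
  Q^(-5/2) (Q - r^2/3), and the bracket is 1.\<close>

lemma wave_op_soliton: "wave_op (\<lambda>q. soliton (snd q)) p = - (soliton (snd p) ^ 5)"
proof -
  let ?Q = "1 + (norm (snd p))\<^sup>2 / 3" and ?W = "soliton_power (- 1 / 2)"
  have pd: "partial i (partial i ?W) p = - 1 / 3 * soliton_power (- 3 / 2) p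
      + 1 / 3 * soliton_power (- 5 / 2) p * (snd p $ of_nat i)\<^sup>2" if i: "i \<in> {1..3}" for i
  proof -
    have "((\<lambda>p. - 1 / 3 * (soliton_power (- 3 / 2) p * snd p $ of_nat i)) has_derivative
       (\<lambda>h. - 1 / 3 * (soliton_power (- 3 / 2) p * snd h $ of_nat i
          + (2 / 3 * (- 3 / 2) * soliton_power (- 3 / 2 - 1) p * (snd p \<bullet> snd h)) * snd p $ of_nat i))) (at p)"
      by (intro has_derivative_mult_right has_derivative_mult soliton_power_has_derivative
          bounded_linear_imp_has_derivative[OF bounded_linear_coord])
    from partial_eq[OF this, of i]
    have "partial i (\<lambda>p. - 1 / 3 * (soliton_power (- 3 / 2) p * snd p $ of_nat i)) p
      = - 1 / 3 * soliton_power (- 3 / 2) p + 1 / 3 * soliton_power (- 5 / 2) p * (snd p $ of_nat i)\<^sup>2"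
      using i coord_dir_inner[OF i, of "snd p"]
      by (simp add: power2_eq_square algebra_simps) (simp add: coord_dir_def)
    moreover have "partial i ?W = (\<lambda>p. - 1 / 3 * (soliton_power (- 3 / 2) p * snd p $ of_nat i))"
      unfolding partial_soliton_power[OF i, abs_def] by (simp add: fun_eq_iff)
    ultimately show ?thesis by simp
  qed
  have "partial 0 (partial 0 ?W) p = partial 0 (\<lambda>_. 0) p"
    by (rule partial_cong[OF open_UNIV UNIV_I partial_soliton_power_0])
  then have "wave_op ?W p = (\<Sum>i=1..3. partial i (partial i ?W) p)"
    by (simp add: wave_op_def partial_def)
  also have "\<dots> = (\<Sum>i=1..3. - 1 / 3 * soliton_power (- 3 / 2) p + 1 / 3 * soliton_power (- 5 / 2) p * (snd p $ of_nat i)\<^sup>2)"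
    by (intro sum.cong pd) auto
  also have "\<dots> = - soliton_power (- 3 / 2) p + 1 / 3 * soliton_power (- 5 / 2) p * (norm (snd p))\<^sup>2"
    unfolding sum.distrib sum_distrib_left[symmetric] sum_coord_squares by simp
  also have "soliton_power (- 3 / 2) p = ?Q powr (- 5 / 2) * ?Q powr 1"
    unfolding soliton_power_def powr_add[symmetric] by simp
  also have "?Q powr 1 = ?Q" using soliton_base_pos[of "snd p"] by simp
  also have "- (?Q powr (- 5 / 2) * ?Q) + 1 / 3 * soliton_power (- 5 / 2) p * (norm (snd p))\<^sup>2 = - (?Q powr (- 5 / 2))"
    by (simp add: soliton_power_def algebra_simps)
  also have "?Q powr (- 5 / 2) = soliton (snd p) ^ 5"
    unfolding soliton_def using soliton_base_pos[of "snd p"] by (subst powr_power) auto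
  finally show ?thesis unfolding soliton_eq .
qed

text \<open>Under 1 + a z = 2 r z the radicand is 12 z^2 (1 + r^2/3), so z cancels and the square
  root of the soliton's denominator remains.\<close>

lemma scaled_soliton_eq:
  assumes "0 < z" "1 + a * z = 2 * norm x * z"
  shows "scaled_soliton (a, z) = norm x * soliton x"
proof -
  have "12 * z\<^sup>2 + (2 * norm x * z)\<^sup>2 = 12 * z\<^sup>2 * (1 + (norm x)\<^sup>2 / 3)"
    by (simp add: field_simps power_mult_distrib)
  moreover have "sqrt (12 * z\<^sup>2) = 2 * sqrt 3 * z"
    using assms(1) by (intro real_sqrt_unique) (auto simp: power_mult_distrib)
  ultimately have "sqrt (12 * z\<^sup>2 + (2 * norm x * z)\<^sup>2) = 2 * sqrt 3 * z * sqrt (1 + (norm x)\<^sup>2 / 3)"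
    by (simp add: real_sqrt_mult)
  moreover have "soliton x = 1 / sqrt (1 + (norm x)\<^sup>2 / 3)"
  proof -
    have "soliton x = inverse ((1 + (norm x)\<^sup>2 / 3) powr (1 / 2))"
      unfolding soliton_def using powr_minus[of "1 + (norm x)\<^sup>2 / 3" "1 / 2"]
      by (simp only: minus_divide_left)
    then show ?thesis
      by (simp only: powr_half_sqrt[OF less_imp_le[OF soliton_base_pos]] inverse_eq_divide)
  qed
  ultimately show ?thesis
    unfolding scaled_soliton_def fst_conv snd_conv assms(2) using assms(1) by simp
qed

definition null_coords :: "real \<times> real \<Rightarrow> real \<times> real" where
  "null_coords p = (snd p - fst p, 1 / (fst p + snd p))"

text \<open>The coefficients encode d/dt = - d/da - z^2 d/dz and d/dr = d/da - z^2 d/dz.\<close>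

lemma null_coords_has_derivative:
  assumes "0 < fst p + snd p"
    and "(w has_derivative (\<lambda>h. wa * fst h + wz * snd h)) (at (null_coords p))"
  shows "((\<lambda>p. w (null_coords p)) has_derivative
    (\<lambda>h. (- wa - (1 / (fst p + snd p))\<^sup>2 * wz) * fst h + (wa - (1 / (fst p + snd p))\<^sup>2 * wz) * snd h)) (at p)"
proof -
  have "(null_coords has_derivative
      (\<lambda>h. (snd h - fst h, - ((1 / (fst p + snd p))\<^sup>2 * (fst h + snd h))))) (at p)"
    unfolding null_coords_def[abs_def] using assms(1)
    by (auto intro!: derivative_eq_intros simp: power2_eq_square divide_inverse)
  from has_derivative_compose[OF this assms(2)] show ?thesis
    by (rule has_derivative_eq_rhs) (simp add: fun_eq_iff algebra_simps)
qed

lemma null_coords_continuous_on: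
  assumes "\<And>p. p \<in> S \<Longrightarrow> 0 < fst p + snd p"
  shows "continuous_on S null_coords"
  unfolding null_coords_def using assms by (intro continuous_intros) (fastforce simp: less_imp_neq[symmetric])

section \<open>Return to physical coordinates\<close>

text \<open>The weight is made for 4 z^2 \<open>null_weight\<close> / r = r^(-5), which divides each
  quintic by the fifth power of r. The quotient f(r - t) / r will be the free wave.\<close>

lemma null_source_physical:
  assumes "0 < norm x" "0 < t + norm x"
  shows "4 * (1 / (t + norm x))\<^sup>2 * null_source f (null_coords (t, norm x)) e / norm x
    = (soliton x + (f (norm x - t) + e) / norm x) ^ 5 - soliton x ^ 5"
proof -
  define r z a w where "r = norm x" and "z = 1 / (t + r)" and "a = r - t" and "w = f a + e"
  have r: "0 < r" and z: "0 < z" using assms by (auto simp: r_def z_def)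
  have q: "1 + a * z = 2 * r * z" using assms by (simp add: a_def z_def r_def field_simps)
  have y: "scaled_soliton (a, z) = r * soliton x"
    using scaled_soliton_eq[OF z, of a x] q by (simp add: r_def)
  have c: "4 * z\<^sup>2 * null_weight (a, z) / r = 1 / r ^ 5"
    unfolding null_weight_def fst_conv snd_conv q using r z
    by (simp add: power_mult_distrib field_simps numeral_eq_Suc)
  have "4 * z\<^sup>2 * null_source f (a, z) e / r
      = (4 * z\<^sup>2 * null_weight (a, z) / r) * ((r * soliton x + w) ^ 5 - (r * soliton x) ^ 5)"
    by (simp add: null_source_def y w_def add.assoc)
  also have "\<dots> = ((r * soliton x + w) / r) ^ 5 - (r * soliton x / r) ^ 5"
    unfolding c by (simp only: power_divide diff_divide_distrib[symmetric] times_divide_eq_left mult_1)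
  also have "\<dots> = (soliton x + w / r) ^ 5 - soliton x ^ 5"
  proof -
    have "r * soliton x / r = soliton x" using r by simp
    then show ?thesis by (simp only: add_divide_distrib)
  qed
  finally show ?thesis by (simp add: null_coords_def a_def z_def r_def w_def)
qed

text \<open>These product, difference and sign rules keep derivatives in the shape a dt + b dr, so
  that the second partials of composite expressions can be read off.\<close>

lemma has_derivative_pair_mult:
  fixes f g :: "real \<times> real \<Rightarrow> real"
  assumes "(f has_derivative (\<lambda>h. a * fst h + b * snd h)) (at p)"
    "(g has_derivative (\<lambda>h. a' * fst h + b' * snd h)) (at p)"
  shows "((\<lambda>p. f p * g p) has_derivative
     (\<lambda>h. (f p * a' + a * g p) * fst h + (f p * b' + b * g p) * snd h)) (at p)"
  using has_derivative_mult[OF assms] by (rule has_derivative_eq_rhs) (simp add: fun_eq_iff algebra_simps)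

lemma has_derivative_pair_diff:
  fixes f g :: "real \<times> real \<Rightarrow> real"
  assumes "(f has_derivative (\<lambda>h. a * fst h + b * snd h)) (at p)"
    "(g has_derivative (\<lambda>h. a' * fst h + b' * snd h)) (at p)"
  shows "((\<lambda>p. f p - g p) has_derivative (\<lambda>h. (a - a') * fst h + (b - b') * snd h)) (at p)"
  using has_derivative_diff[OF assms] by (rule has_derivative_eq_rhs) (simp add: fun_eq_iff algebra_simps)

lemma has_derivative_pair_minus:
  fixes f :: "real \<times> real \<Rightarrow> real"
  assumes "(f has_derivative (\<lambda>h. a * fst h + b * snd h)) (at p)"
  shows "((\<lambda>p. - f p) has_derivative (\<lambda>h. (- a) * fst h + (- b) * snd h)) (at p)"
  using has_derivative_minus[OF assms] by (rule has_derivative_eq_rhs) (simp add: fun_eq_iff algebra_simps)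

text \<open>Dividing by r absorbs the first-order term 2/r of the radial Laplacian, and the
  one-dimensional wave operator keeps only the mixed null derivative. The same \<open>k\<close> in
  the derivatives of \<open>da\<close> and \<open>dz\<close> expresses the symmetry of that mixed
  derivative.\<close>

lemma radial_null_C2:
  fixes d da dz k daa dzz :: "real \<times> real \<Rightarrow> real" and S :: "spacetime set"
  defines "N \<equiv> (\<lambda>p::spacetime. null_coords (fst p, norm (snd p)))"
    and "Z \<equiv> (\<lambda>p::spacetime. 1 / (fst p + norm (snd p)))"
  assumes S: "open S" "\<And>p. p \<in> S \<Longrightarrow> snd p \<noteq> 0" "\<And>p. p \<in> S \<Longrightarrow> 0 < fst p + norm (snd p)"
    and NG: "\<And>p. p \<in> S \<Longrightarrow> N p \<in> G"
    and d: "\<And>q. q \<in> G \<Longrightarrow> (d has_derivative (\<lambda>h. da q * fst h + dz q * snd h)) (at q)"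
    and da: "\<And>q. q \<in> G \<Longrightarrow> (da has_derivative (\<lambda>h. daa q * fst h + k q * snd h)) (at q)"
    and dz: "\<And>q. q \<in> G \<Longrightarrow> (dz has_derivative (\<lambda>h. k q * fst h + dzz q * snd h)) (at q)"
    and cont: "continuous_on G k" "continuous_on G daa" "continuous_on G dzz"
  shows "Ck_on 2 S (\<lambda>p. d (N p) / norm (snd p))"
    and "\<And>p. p \<in> S \<Longrightarrow> partial 0 (\<lambda>p. d (N p) / norm (snd p)) p = (- da (N p) - (Z p)\<^sup>2 * dz (N p)) / norm (snd p)"
    and "\<And>p i. p \<in> S \<Longrightarrow> i \<in> {1..3} \<Longrightarrow> partial i (\<lambda>p. d (N p) / norm (snd p)) p
        = ((da (N p) - (Z p)\<^sup>2 * dz (N p)) / norm (snd p) - d (N p) / (norm (snd p))\<^sup>2) * (snd p $ of_nat i / norm (snd p))"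
    and "\<And>p. p \<in> S \<Longrightarrow> wave_op (\<lambda>p. d (N p) / norm (snd p)) p = - (4 * (Z p)\<^sup>2 * k (N p) / norm (snd p))"
proof -
  define zz :: "real \<times> real \<Rightarrow> real" where "zz p = 1 / (fst p + snd p)" for p
  define ii :: "real \<times> real \<Rightarrow> real" where "ii p = 1 / snd p" for p
  define v where "v p = d (null_coords p)" for p
  define vt where "vt p = - da (null_coords p) - (zz p)\<^sup>2 * dz (null_coords p)" for p
  define vr where "vr p = da (null_coords p) - (zz p)\<^sup>2 * dz (null_coords p)" for p
  \<comment> \<open>The second derivative of d along t + r, that is, of - z^2 d/dz applied twice. It
    occurs equally in \<open>vtt\<close> and \<open>vrr\<close>, as does \<open>daa\<close>, so both
    drop out of the wave operator and - 4 z^2 k remains.\<close>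
  define c where "c p = 2 * zz p ^ 3 * dz (null_coords p) + zz p ^ 4 * dzz (null_coords p)" for p
  define vtt where "vtt p = daa (null_coords p) + 2 * (zz p)\<^sup>2 * k (null_coords p) + c p" for p
  define vtr where "vtr p = c p - daa (null_coords p)" for p
  define vrr where "vrr p = daa (null_coords p) - 2 * (zz p)\<^sup>2 * k (null_coords p) + c p" for p
  define R where "R p = (fst p, norm (snd p))" for p :: spacetime
  have pos: "0 < fst (R p) + snd (R p)" "snd (R p) \<noteq> 0" "null_coords (R p) \<in> G" if "p \<in> S" for p
    using S(2,3)[OF that] NG[OF that] by (auto simp: R_def N_def)
  have zz2: "((\<lambda>q. (zz q)\<^sup>2) has_derivative (\<lambda>h. (- 2 * zz q ^ 3) * fst h + (- 2 * zz q ^ 3) * snd h)) (at q)"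
    if "0 < fst q + snd q" for q
  proof -
    have "(zz has_derivative (\<lambda>h. (- (zz q)\<^sup>2) * fst h + (- (zz q)\<^sup>2) * snd h)) (at q)"
      unfolding zz_def[abs_def] using that
      by (auto intro!: derivative_eq_intros simp: power2_eq_square divide_inverse algebra_simps)
    from has_derivative_pair_mult[OF this this] show ?thesis
      by (simp add: power2_eq_square power3_eq_cube mult.assoc)
  qed
  have ii: "(ii has_derivative (\<lambda>h. 0 * fst h + (- (ii q)\<^sup>2) * snd h)) (at q)" if "snd q \<noteq> 0" for q
    unfolding ii_def[abs_def] using that
    by (auto intro!: derivative_eq_intros simp: power2_eq_square field_simps)
  have comp: "((\<lambda>q. w (null_coords q)) has_derivative
      (\<lambda>h. (- wa (null_coords (R p)) - (zz (R p))\<^sup>2 * wz (null_coords (R p))) * fst h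
         + (wa (null_coords (R p)) - (zz (R p))\<^sup>2 * wz (null_coords (R p))) * snd h)) (at (R p))"
    if "p \<in> S" "\<forall>q\<in>G. (w has_derivative (\<lambda>h. wa q * fst h + wz q * snd h)) (at q)" for w wa wz p
    unfolding zz_def by (rule null_coords_has_derivative[OF pos(1)[OF that(1)] bspec[OF that(2) pos(3)[OF that(1)]]])
  have D: "\<forall>q\<in>G. (d has_derivative (\<lambda>h. da q * fst h + dz q * snd h)) (at q)"
    "\<forall>q\<in>G. (da has_derivative (\<lambda>h. daa q * fst h + k q * snd h)) (at q)"
    "\<forall>q\<in>G. (dz has_derivative (\<lambda>h. k q * fst h + dzz q * snd h)) (at q)"
    using d da dz by blast+
  have v: "(v has_derivative (\<lambda>h. vt (R p) * fst h + vr (R p) * snd h)) (at (R p))" if "p \<in> S" for p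
    using comp[OF that D(1)] unfolding v_def[abs_def] vt_def vr_def .
  have zdz: "((\<lambda>q. (zz q)\<^sup>2 * dz (null_coords q)) has_derivative
      (\<lambda>h. (- (zz (R p))\<^sup>2 * k (null_coords (R p)) - c (R p)) * fst h
         + ((zz (R p))\<^sup>2 * k (null_coords (R p)) - c (R p)) * snd h)) (at (R p))" if "p \<in> S" for p
    using has_derivative_pair_mult[OF zz2[OF pos(1)[OF that]] comp[OF that D(3)]]
  proof (rule has_derivative_eq_rhs, intro ext)
    have "y\<^sup>2 * (a - y\<^sup>2 * b) + - 2 * y ^ 3 * e = y\<^sup>2 * a - (2 * y ^ 3 * e + y ^ 4 * b)" for y a b e :: real
      by (simp add: algebra_simps eval_nat_numeral)
    note this[of "zz (R p)" _ "dzz (null_coords (R p))" "dz (null_coords (R p))"]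
    then show "((zz (R p))\<^sup>2 * (- k (null_coords (R p)) - (zz (R p))\<^sup>2 * dzz (null_coords (R p)))
          + - 2 * zz (R p) ^ 3 * dz (null_coords (R p))) * fst h
        + ((zz (R p))\<^sup>2 * (k (null_coords (R p)) - (zz (R p))\<^sup>2 * dzz (null_coords (R p)))
          + - 2 * zz (R p) ^ 3 * dz (null_coords (R p))) * snd h
      = (- (zz (R p))\<^sup>2 * k (null_coords (R p)) - c (R p)) * fst h
         + ((zz (R p))\<^sup>2 * k (null_coords (R p)) - c (R p)) * snd h" for h :: "real \<times> real"
      by (simp only: c_def) simp
  qed
  have vt: "(vt has_derivative (\<lambda>h. vtt (R p) * fst h + vtr (R p) * snd h)) (at (R p))" if "p \<in> S" for p
    unfolding vt_def[abs_def]
    using has_derivative_pair_diff[OF has_derivative_pair_minus[OF comp[OF that D(2)]] zdz[OF that]]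
    by (rule has_derivative_eq_rhs) (simp add: fun_eq_iff vtt_def vtr_def algebra_simps)
  have vr: "(vr has_derivative (\<lambda>h. vtr (R p) * fst h + vrr (R p) * snd h)) (at (R p))" if "p \<in> S" for p
    unfolding vr_def[abs_def]
    using has_derivative_pair_diff[OF comp[OF that D(2)] zdz[OF that]]
    by (rule has_derivative_eq_rhs) (simp add: fun_eq_iff vrr_def vtr_def algebra_simps)
  define g where "g p = v p * ii p" for p
  define gt where "gt p = vt p * ii p" for p
  define gr where "gr p = vr p * ii p - v p * ii p * ii p" for p
  define gtt where "gtt p = vtt p * ii p" for p
  define gtr where "gtr p = vtr p * ii p - vt p * ii p * ii p" for p
  define grr where "grr p = vrr p * ii p - 2 * vr p * ii p * ii p + 2 * v p * ii p * ii p * ii p" for p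
  have g: "(g has_derivative (\<lambda>h. gt (R p) * fst h + gr (R p) * snd h)) (at (R p))" if "p \<in> S" for p
    unfolding g_def[abs_def] using has_derivative_pair_mult[OF v[OF that] ii[OF pos(2)[OF that]]]
    by (rule has_derivative_eq_rhs) (simp add: fun_eq_iff gt_def gr_def algebra_simps power2_eq_square)
  have gt: "(gt has_derivative (\<lambda>h. gtt (R p) * fst h + gtr (R p) * snd h)) (at (R p))" if "p \<in> S" for p
    unfolding gt_def[abs_def] using has_derivative_pair_mult[OF vt[OF that] ii[OF pos(2)[OF that]]]
    by (rule has_derivative_eq_rhs) (simp add: fun_eq_iff gtt_def gtr_def algebra_simps power2_eq_square)
  have gr: "(gr has_derivative (\<lambda>h. gtr (R p) * fst h + grr (R p) * snd h)) (at (R p))" if "p \<in> S" for p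
    unfolding gr_def[abs_def]
    using has_derivative_pair_diff[OF has_derivative_pair_mult[OF vr[OF that] ii[OF pos(2)[OF that]]]
        has_derivative_pair_mult[OF has_derivative_pair_mult[OF v[OF that] ii[OF pos(2)[OF that]]] ii[OF pos(2)[OF that]]]]
    by (rule has_derivative_eq_rhs) (simp add: fun_eq_iff gtr_def grr_def algebra_simps power2_eq_square)
  have Rc: "continuous_on S R" unfolding R_def by (intro continuous_intros)
  have hc: "continuous_on S (\<lambda>p. h (R p))"
    if "\<And>p. p \<in> S \<Longrightarrow> (h has_derivative h' p) (at (R p))" for h :: "real \<times> real \<Rightarrow> real" and h'
  proof (rule continuous_on_compose2[of "R ` S" h, OF _ Rc order_refl])
    show "continuous_on (R ` S) h"
      by (intro continuous_at_imp_continuous_on ballI) (metis imageE that has_derivative_continuous)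
  qed
  have Nc: "continuous_on S (\<lambda>p. null_coords (R p))"
    by (rule continuous_on_compose2[OF null_coords_continuous_on[of "R ` S"] Rc]) (use pos in auto)
  have kc: "continuous_on S (\<lambda>p. h (null_coords (R p)))" if "continuous_on G h" for h :: "real \<times> real \<Rightarrow> real"
    by (rule continuous_on_compose2[OF that Nc]) (use pos in auto)
  have zc: "continuous_on S (\<lambda>p. zz (R p))" unfolding zz_def R_def
    using S(3) by (intro continuous_intros) (fastforce simp: less_imp_neq[symmetric])
  have ic: "continuous_on S (\<lambda>p. ii (R p))" by (rule hc[OF ii[OF pos(2)]])
  have dzc: "continuous_on S (\<lambda>p. dz (null_coords (R p)))" by (rule hc[OF comp[OF _ D(3)]])
  have cc: "continuous_on S (\<lambda>p. c (R p))" unfolding c_def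
    by (intro continuous_intros zc dzc kc cont)
  have vs: "continuous_on S (\<lambda>p. vtt (R p))" "continuous_on S (\<lambda>p. vtr (R p))" "continuous_on S (\<lambda>p. vrr (R p))"
    unfolding vtt_def vtr_def vrr_def by (intro continuous_intros zc cc kc cont)+
  have gs: "continuous_on S (\<lambda>p. gtt (R p))" "continuous_on S (\<lambda>p. gtr (R p))" "continuous_on S (\<lambda>p. grr (R p))"
  proof -
    have v3: "continuous_on S (\<lambda>p. v (R p))" "continuous_on S (\<lambda>p. vt (R p))" "continuous_on S (\<lambda>p. vr (R p))"
      by (rule hc[OF v] hc[OF vt] hc[OF vr]; assumption)+
    show "continuous_on S (\<lambda>p. gtt (R p))" "continuous_on S (\<lambda>p. gtr (R p))" "continuous_on S (\<lambda>p. grr (R p))"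
      unfolding gtt_def gtr_def grr_def
      by (rule continuous_on_add continuous_on_diff continuous_on_mult continuous_on_const ic vs v3)+
  qed
  have eq: "(\<lambda>p. d (N p) / norm (snd p)) = (\<lambda>p. g (R p))"
    by (simp add: fun_eq_iff g_def v_def N_def R_def ii_def)
  note rad = radial_C2[OF S(1,2) g[unfolded R_def] gt[unfolded R_def] gr[unfolded R_def]
      gs(1)[unfolded R_def] gs(2)[unfolded R_def] gs(2)[unfolded R_def] gs(3)[unfolded R_def], folded R_def]
  show "Ck_on 2 S (\<lambda>p. d (N p) / norm (snd p))" unfolding eq using rad(1) by simp
  show "partial 0 (\<lambda>p. d (N p) / norm (snd p)) p = (- da (N p) - (Z p)\<^sup>2 * dz (N p)) / norm (snd p)"
    if "p \<in> S" for p
    unfolding eq using rad(2)[of p] that by (simp add: gt_def vt_def N_def Z_def R_def ii_def zz_def)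
  show "partial i (\<lambda>p. d (N p) / norm (snd p)) p
        = ((da (N p) - (Z p)\<^sup>2 * dz (N p)) / norm (snd p) - d (N p) / (norm (snd p))\<^sup>2) * (snd p $ of_nat i / norm (snd p))"
    if "p \<in> S" "i \<in> {1..3}" for p i
    unfolding eq using rad(3)[of p i] that
    by (simp add: gr_def vr_def v_def N_def Z_def R_def ii_def zz_def power2_eq_square)
  show "wave_op (\<lambda>p. d (N p) / norm (snd p)) p = - (4 * (Z p)\<^sup>2 * k (N p) / norm (snd p))" if "p \<in> S" for p
  proof -
    have "wave_op (\<lambda>p. g (R p)) p = - gtt (R p) + grr (R p) + 2 * gr (R p) * ii (R p)"
      using rad(4)[of p] that by (simp add: R_def ii_def)
    also have "\<dots> = (vrr (R p) - vtt (R p)) * ii (R p)"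
      by (simp add: gtt_def grr_def gr_def algebra_simps)
    also have "\<dots> = - (4 * (zz (R p))\<^sup>2 * k (null_coords (R p)) * ii (R p))"
      by (simp add: vrr_def vtt_def algebra_simps)
    finally show ?thesis unfolding eq by (simp add: N_def Z_def R_def ii_def zz_def)
  qed
qed

theorem corollary1p9p1:
  fixes A :: real
  assumes "0 < A"
  shows "\<exists>u. smooth_on UNIV u \<and> free_wave u
    \<and> (\<forall>c. (\<forall>\<mu>\<in>{0..3}. slice_L2 c (partial \<mu> u))
           \<and> (\<Sum>\<mu>=0..3. (slice_norm c (partial \<mu> u))\<^sup>2) = A\<^sup>2)
    \<and> (\<exists>T \<phi>. quintic_solution_after T \<phi>
         \<and> (\<forall>\<mu>\<in>{0..3}.
              (\<forall>c>T. slice_L2 c (\<lambda>p. partial \<mu> (\<lambda>q. \<phi> q - soliton (snd q)) p - partial \<mu> u p))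
              \<and> ((\<lambda>c. slice_norm c (\<lambda>p. partial \<mu> (\<lambda>q. \<phi> q - soliton (snd q)) p - partial \<mu> u p))
                   \<longlongrightarrow> 0) at_top))"
proof -
  define K where "K = unit_ball_vol (3::real)"
  have K: "0 < K" by (simp add: K_def unit_ball_vol_pos)
  \<comment> \<open>Inverts the energy formula 3/2 K \<kappa>^2 of the free wave.\<close>
  define \<kappa> where "\<kappa> = A / sqrt (3 / 2 * K)"
  have \<kappa>: "3 / 2 * K * \<kappa>\<^sup>2 = A\<^sup>2" using K by (simp add: \<kappa>_def power_divide)
  define u where "u = free_profile \<kappa>"
  have u_smooth: "smooth_on UNIV u" unfolding smooth_on_def u_def using Ck_on_free_profile by blast
  have u_wave: "wave_op u p = 0" for p
    unfolding u_def by (rule wave_op_radial_kern[where F="profile \<kappa>", OF profile_has_real_derivative])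
  \<comment> \<open>This is r u as a function of a = r - t wherever t + r \<ge> 0, because the
    incoming part F(t + r) vanishes there.\<close>
  define f where "f a = - profile \<kappa> 0 (- a)" for a
  have f': "(f has_real_derivative profile \<kappa> 1 (- a)) (at a)" for a
  proof -
    have "((\<lambda>a. profile \<kappa> 0 (- a)) has_real_derivative profile \<kappa> (Suc 0) (- a) * (- 1)) (at a)"
      by (rule DERIV_chain2[OF profile_has_real_derivative]) (auto intro!: derivative_eq_intros)
    from DERIV_minus[OF this] show ?thesis unfolding f_def by simp
  qed
  have f'_cont: "continuous_on UNIV (\<lambda>a. profile \<kappa> 1 (- a))"
    by (intro continuous_at_imp_continuous_on ballI DERIV_isCont)
       (rule DERIV_chain2[OF profile_has_real_derivative DERIV_minus[OF DERIV_ident]])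
  have f_bound: "\<bar>f a\<bar> \<le> \<bar>\<kappa>\<bar>" for a unfolding f_def using profile_bound by simp
  have f0: "f a = 0" if "a \<le> 0" for a using that by (simp add: f_def profile_eq_0)
  obtain z0 C d da dz daa dzz where z0: "0 < z0"
    and d: "\<And>p. p \<in> {-1<..} \<times> {0<..<z0} \<Longrightarrow> (d has_derivative (\<lambda>h. da p * fst h + dz p * snd h)) (at p)"
    and da: "\<And>p. p \<in> {-1<..} \<times> {0<..<z0} \<Longrightarrow>
       (da has_derivative (\<lambda>h. daa p * fst h + null_source f p (d p) * snd h)) (at p)"
    and dz: "\<And>p. p \<in> {-1<..} \<times> {0<..<z0} \<Longrightarrow>
       (dz has_derivative (\<lambda>h. null_source f p (d p) * fst h + dzz p * snd h)) (at p)"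
    and cont: "continuous_on ({-1<..} \<times> {0<..<z0}) (\<lambda>p. null_source f p (d p))"
      "continuous_on ({-1<..} \<times> {0<..<z0}) daa" "continuous_on ({-1<..} \<times> {0<..<z0}) dzz"
    and d0: "\<And>a z. a \<le> 0 \<Longrightarrow> d (a, z) = 0"
    and C: "\<And>a z. 0 < z \<Longrightarrow> z < z0 \<Longrightarrow> \<bar>d (a, z)\<bar> \<le> C \<and> \<bar>da (a, z)\<bar> \<le> C * z \<and> \<bar>dz (a, z)\<bar> \<le> C"
    by (rule goursat_solution[OF f' f'_cont f_bound f0]) (assumption, rule that)
  \<comment> \<open>Times after 1 / z0 have 1 / (t + r) < z0. Times after 1 keep the set r > t - 1
    away from the axis.\<close>
  define T where "T = max 1 (1 / z0)"
  have T: "1 \<le> T" by (simp add: T_def)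
  define N where "N = (\<lambda>p::spacetime. null_coords (fst p, norm (snd p)))"
  define \<delta> where "\<delta> = (\<lambda>p. d (N p) / norm (snd p))"
  define S1 where "S1 = {p::spacetime. T < fst p \<and> norm (snd p) < fst p}"
  \<comment> \<open>Reaching one unit inside the cone, matching a > -1, makes the two open sets
    overlap and cover the cone itself.\<close>
  define S2 where "S2 = {p::spacetime. T < fst p \<and> fst p - 1 < norm (snd p)}"
  have "open S1" "open S2" unfolding S1_def S2_def
    by (intro open_Collect_conj open_Collect_less continuous_intros)+
  have S12: "{p. T < fst p} = S1 \<union> S2" by (auto simp: S1_def S2_def)
  \<comment> \<open>Inside the cone a is negative, so the numerator is 0; on the axis the convention
    for division by zero gives the same value.\<close>
  have \<delta>1: "\<delta> p = 0" if "p \<in> S1" for p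
    using that by (simp add: \<delta>_def N_def null_coords_def S1_def d0)
  have r2: "0 < norm (snd p)" "0 < fst p + norm (snd p)" "1 / z0 < fst p + norm (snd p)"
    "1 \<le> fst p + norm (snd p)" if "p \<in> S2" for p
    using that T norm_ge_zero[of "snd p"] by (auto simp: S2_def T_def)
  have N2: "N p \<in> {-1<..} \<times> {0<..<z0}" if "p \<in> S2" for p
    using r2[OF that] z0 that by (auto simp: N_def null_coords_def S2_def field_simps)
  have nz: "snd p \<noteq> 0" if "p \<in> S2" for p using r2(1)[OF that] by auto
  note ext' = radial_null_C2[OF \<open>open S2\<close> nz r2(2) N2[unfolded N_def] d da dz cont]
  have ext: "Ck_on 2 S2 \<delta>"
    "p \<in> S2 \<Longrightarrow> partial 0 \<delta> p
      = (- da (N p) - (1 / (fst p + norm (snd p)))\<^sup>2 * dz (N p)) / norm (snd p)"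
    "p \<in> S2 \<Longrightarrow> i \<in> {1..3} \<Longrightarrow> partial i \<delta> p
      = ((da (N p) - (1 / (fst p + norm (snd p)))\<^sup>2 * dz (N p)) / norm (snd p) - d (N p) / (norm (snd p))\<^sup>2)
        * (snd p $ of_nat i / norm (snd p))"
    "p \<in> S2 \<Longrightarrow> wave_op \<delta> p
      = - (4 * (1 / (fst p + norm (snd p)))\<^sup>2 * null_source f (N p) (d (N p)) / norm (snd p))" for p i
    unfolding \<delta>_def N_def using ext' by blast+
  have \<delta>_C2: "Ck_on 2 {p. T < fst p} \<delta>"
    unfolding S12
  proof (rule Ck_on_Un[OF \<open>open S1\<close> \<open>open S2\<close>])
    show "Ck_on 2 S1 \<delta>" by (rule Ck_on_cong[OF \<open>open S1\<close> _ Ck_on_const[OF \<open>open S1\<close>, of 2 0]]) (simp add: \<delta>1)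
  qed (rule ext(1))
  have \<delta>_const: "partial \<mu> \<delta> p = 0" if "p \<in> S1" for p \<mu>
    using partial_cong[OF \<open>open S1\<close> that, of \<delta> "\<lambda>_. 0"] \<delta>1 by (simp add: partial_def)
  have wave_\<delta>: "wave_op \<delta> p = - ((soliton (snd p) + u p + \<delta> p) ^ 5 - soliton (snd p) ^ 5)"
    if "T < fst p" for p
  proof (cases "p \<in> S1")
    case True
    have "partial \<mu> (partial \<mu> \<delta>) p = 0" for \<mu>
      using partial_cong[OF \<open>open S1\<close> True, of "partial \<mu> \<delta>" "\<lambda>_. 0"] \<delta>_const by (simp add: partial_def)
    \<comment> \<open>Inside the cone t + s r is nonnegative for every s in [-1, 1], so the average
      only sees the part of the profile that vanishes.\<close>
    moreover have "u p = 0"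
    proof -
      have "integral {-1..1} (\<lambda>s. (1 - s\<^sup>2) ^ 0 * profile \<kappa> 1 (fst p + s * norm (snd p)))
          = integral {-1..1} (\<lambda>s::real. 0)"
      proof (rule integral_cong)
        fix s :: real assume "s \<in> {-1..1}"
        then have "- 1 * norm (snd p) \<le> s * norm (snd p)" by (intro mult_right_mono) auto
        then have "0 \<le> fst p + s * norm (snd p)" using True by (simp add: S1_def)
        then show "(1 - s\<^sup>2) ^ 0 * profile \<kappa> 1 (fst p + s * norm (snd p)) = 0" by (simp add: profile_eq_0)
      qed
      then show ?thesis by (simp add: u_def radial_kern_def kern_def)
    qed
    ultimately show ?thesis using \<delta>1[OF True] by (simp add: wave_op_def)
  next
    case False
    then have p: "p \<in> S2" using that S12 by blast
    define r where "r = norm (snd p)"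
    have r: "0 < r" using r2(1)[OF p] by (simp add: r_def)
    have "r * u p = - profile \<kappa> 0 (fst p - r)"
      using profile_mult_kern[where \<kappa>=\<kappa> and r=r and n=0 and t="fst p"] profile_eq_0[of "fst p + r" \<kappa> 0] r2(2)[OF p]
      by (simp add: u_def radial_kern_def r_def)
    then have "u p = f (r - fst p) / r" using r by (simp add: f_def field_simps)
    moreover have "wave_op \<delta> p = - (4 * (1 / (fst p + r))\<^sup>2 * null_source f (N p) (d (N p)) / r)"
      unfolding r_def by (rule ext(4)[OF p])
    moreover have "4 * (1 / (fst p + r))\<^sup>2 * null_source f (N p) (d (N p)) / r
        = (soliton (snd p) + (f (r - fst p) + d (N p)) / r) ^ 5 - soliton (snd p) ^ 5"
      using null_source_physical[of "snd p" "fst p"] r2[OF p] by (simp add: N_def r_def)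
    ultimately show ?thesis by (simp add: \<delta>_def r_def add_divide_distrib add.assoc)
  qed
  define \<phi> where "\<phi> p = soliton (snd p) + (u p + \<delta> p)" for p
  have open_T: "open {p::spacetime. T < fst p}"
    by (intro open_Collect_less continuous_intros)
  have CW: "Ck_on 2 {p. T < fst p} (\<lambda>p. soliton (snd p))"
    unfolding soliton_eq by (rule Ck_on_mono[OF Ck_on_soliton_power]) simp
  have Cu: "Ck_on 2 {p. T < fst p} u"
    using u_smooth by (auto simp: smooth_on_def intro: Ck_on_mono)
  have Cu\<delta>: "Ck_on 2 {p. T < fst p} (\<lambda>p. u p + \<delta> p)"
    by (rule Ck_on_add[OF open_T Cu \<delta>_C2])
  have sol: "quintic_solution_after T \<phi>"
    unfolding quintic_solution_after_def
  proof (intro conjI allI impI)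
    show "Ck_on 2 {p. T < fst p} \<phi>"
      unfolding \<phi>_def[abs_def] by (rule Ck_on_add[OF open_T CW Cu\<delta>])
    fix p :: spacetime assume p: "T < fst p"
    then have p': "p \<in> {p. T < fst p}" by simp
    have "wave_op \<phi> p = wave_op (\<lambda>p. soliton (snd p)) p + (wave_op u p + wave_op \<delta> p)"
      unfolding \<phi>_def[abs_def]
      by (simp only: wave_op_add[OF open_T p' CW Cu\<delta>] wave_op_add[OF open_T p' Cu \<delta>_C2])
    then show "wave_op \<phi> p = - (\<phi> p ^ 5)"
      by (simp add: wave_op_soliton u_wave wave_\<delta>[OF p] \<phi>_def add.assoc)
  qed
  \<comment> \<open>The scattering error is exactly the gradient of \<delta>, so convergence reduces
    to the decay of that gradient.\<close>
  have diff_eq: "partial \<mu> (\<lambda>q. \<phi> q - soliton (snd q)) (c, x) - partial \<mu> u (c, x) = partial \<mu> \<delta> (c, x)"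
    if "T < c" for \<mu> c x
  proof -
    have "partial \<mu> (\<lambda>q. u q + \<delta> q) (c, x) = partial \<mu> u (c, x) + partial \<mu> \<delta> (c, x)"
      using Cu \<delta>_C2 that by (intro partial_add) (auto simp: numeral_2_eq_2)
    then show ?thesis by (simp add: \<phi>_def)
  qed
  have C0: "0 \<le> C" using C[of "z0 / 2" 0] z0 by (auto intro: order_trans[OF abs_ge_zero])
  \<comment> \<open>Because z \<le> 1/r and z \<le> 1, the terms d_a / r, z^2 d_z / r and d / r^2
    are each at most C / r^2; the third occurs only in spatial derivatives.\<close>
  have bound: "\<bar>partial \<mu> \<delta> (c, x)\<bar> \<le> 3 * C / (norm x)\<^sup>2" if \<mu>: "\<mu> \<in> {0..3}" and c: "T < c" "c \<le> norm x" for \<mu> c x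
  proof -
    define r z where "r = norm x" and "z = 1 / (c + norm x)"
    have p: "(c, x) \<in> S2" using c by (simp add: S2_def)
    have r: "0 < r" unfolding r_def using c T by linarith
    have z: "0 < z" "z \<le> 1 / r" "z \<le> 1" using c T r by (auto simp: z_def r_def field_simps)
    have zz: "z < z0" using N2[OF p] by (simp add: N_def null_coords_def z_def)
    have Np: "N (c, x) = (r - c, z)" by (simp add: N_def null_coords_def r_def z_def)
    have b: "\<bar>d (N (c, x))\<bar> \<le> C" "\<bar>da (N (c, x))\<bar> \<le> C * z" "\<bar>dz (N (c, x))\<bar> \<le> C"
      unfolding Np using C[OF z(1) zz] by auto
    have "C * z \<le> C / r" using mult_left_mono[OF z(2) C0] by simp
    then have b1: "\<bar>da (N (c, x))\<bar> \<le> C / r" using b(2) by linarith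
    have "z\<^sup>2 \<le> 1 / r * 1" unfolding power2_eq_square using z r by (intro mult_mono) auto
    then have "z\<^sup>2 * \<bar>dz (N (c, x))\<bar> \<le> 1 / r * C" using b(3) r by (intro mult_mono) auto
    then have b2: "\<bar>z\<^sup>2 * dz (N (c, x))\<bar> \<le> C / r" by (simp add: abs_mult)
    have b3: "\<bar>\<alpha> / r\<bar> \<le> 2 * C / r\<^sup>2" if "\<bar>\<alpha>\<bar> \<le> 2 * C / r" for \<alpha>
      using divide_right_mono[OF that, of r] r by (simp add: power2_eq_square)
    consider "\<mu> = 0" | "\<mu> \<in> {1..3}" using \<mu> by fastforce
    then show ?thesis
    proof cases
      case 1
      have "partial 0 \<delta> (c, x) = (- da (N (c, x)) - z\<^sup>2 * dz (N (c, x))) / r"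
        using ext(2)[OF p] by (simp add: r_def z_def)
      moreover have "\<bar>- da (N (c, x)) - z\<^sup>2 * dz (N (c, x))\<bar> \<le> 2 * C / r"
        using b1 b2 by linarith
      ultimately have "\<bar>partial 0 \<delta> (c, x)\<bar> \<le> 2 * C / r\<^sup>2" using b3 by simp
      also have "\<dots> \<le> 3 * C / r\<^sup>2" using C0 by (intro divide_right_mono) auto
      finally show ?thesis by (simp add: 1 r_def)
    next
      case 2
      let ?e = "(da (N (c, x)) - z\<^sup>2 * dz (N (c, x))) / r - d (N (c, x)) / r\<^sup>2"
      have "\<bar>da (N (c, x)) - z\<^sup>2 * dz (N (c, x))\<bar> \<le> 2 * C / r" using b1 b2 by linarith
      then have e1: "\<bar>(da (N (c, x)) - z\<^sup>2 * dz (N (c, x))) / r\<bar> \<le> 2 * C / r\<^sup>2" by (rule b3)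
      have e2: "\<bar>d (N (c, x)) / r\<^sup>2\<bar> \<le> C / r\<^sup>2"
        using b(1) by (simp add: divide_right_mono)
      have "2 * C / r\<^sup>2 + C / r\<^sup>2 = 3 * C / r\<^sup>2" by (simp add: add_divide_distrib[symmetric])
      with e1 e2 have e: "\<bar>?e\<bar> \<le> 3 * C / r\<^sup>2" by linarith
      have q: "\<bar>x $ of_nat \<mu> / r\<bar> \<le> 1"
        using component_le_norm_cart[of x "of_nat \<mu>"] r by (simp add: r_def divide_le_eq)
      have "\<bar>?e * (x $ of_nat \<mu> / r)\<bar> \<le> 3 * C / r\<^sup>2 * 1"
        unfolding abs_mult[of ?e] by (rule mult_mono[OF e q]) (use C0 in auto)
      moreover have "partial \<mu> \<delta> (c, x) = ?e * (x $ of_nat \<mu> / r)"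
        using ext(3)[OF p 2] by (simp add: r_def z_def)
      ultimately have "\<bar>partial \<mu> \<delta> (c, x)\<bar> \<le> 3 * C / r\<^sup>2 * 1" by (simp only:)
      then show ?thesis by (simp add: r_def)
    qed
  qed
  have decay: "slice_L2 c (partial \<mu> \<delta>)" "slice_norm c (partial \<mu> \<delta>) \<le> sqrt (3 * K * (3 * C)\<^sup>2 / c)"
    if \<mu>: "\<mu> \<in> {0..3}" and c: "T < c" for \<mu> c
  proof -
    have "Ck_on (Suc 0) {p. T < fst p} (partial \<mu> \<delta>)"
      using \<delta>_C2 \<mu> unfolding numeral_2_eq_2 Ck_on.simps(2)[of "Suc 0"] by blast
    then have "continuous_on {p. T < fst p} (partial \<mu> \<delta>)" by (rule Ck_on_imp_continuous_on)
    then have cont: "continuous_on UNIV (\<lambda>x. partial \<mu> \<delta> (c, x))"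
      by (rule continuous_on_compose2) (use c in \<open>auto intro!: continuous_intros\<close>)
    have "0 < c" using c T by simp
    have z: "partial \<mu> \<delta> (c, x) = 0" if "norm x < c" for x
      using \<delta>_const[of "(c, x)" \<mu>] that c by (simp add: S1_def)
    note sd = slice_decay[where f="partial \<mu> \<delta>" and C="3 * C", OF \<open>0 < c\<close> _ cont z bound[OF \<mu> c]]
    show "slice_L2 c (partial \<mu> \<delta>)" using sd(1) C0 by simp
    show "slice_norm c (partial \<mu> \<delta>) \<le> sqrt (3 * K * (3 * C)\<^sup>2 / c)" using sd(2) C0 by (simp add: K_def)
  qed
  have slice_eq: "slice_L2 c (\<lambda>p. partial \<mu> (\<lambda>q. \<phi> q - soliton (snd q)) p - partial \<mu> u p) = slice_L2 c (partial \<mu> \<delta>)"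
    "slice_norm c (\<lambda>p. partial \<mu> (\<lambda>q. \<phi> q - soliton (snd q)) p - partial \<mu> u p) = slice_norm c (partial \<mu> \<delta>)"
    if "T < c" for \<mu> c
    unfolding slice_L2_def slice_norm_def diff_eq[OF that] by auto
  have lim: "((\<lambda>c. slice_norm c (\<lambda>p. partial \<mu> (\<lambda>q. \<phi> q - soliton (snd q)) p - partial \<mu> u p)) \<longlongrightarrow> 0) at_top"
    if \<mu>: "\<mu> \<in> {0..3}" for \<mu>
  proof (rule Lim_null_comparison)
    show "\<forall>\<^sub>F c in at_top. norm (slice_norm c (\<lambda>p. partial \<mu> (\<lambda>q. \<phi> q - soliton (snd q)) p - partial \<mu> u p))
        \<le> sqrt (3 * K * (3 * C)\<^sup>2 / c)"
      using eventually_gt_at_top[of T]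
    proof eventually_elim
      case (elim c)
      have "0 \<le> slice_norm c (partial \<mu> \<delta>)" by (simp add: slice_norm_def)
      then show ?case using decay(2)[OF \<mu> elim] by (simp add: slice_eq(2)[OF elim])
    qed
    have "((\<lambda>c. 3 * K * (3 * C)\<^sup>2 / c) \<longlongrightarrow> 0) at_top"
      by (rule tendsto_divide_0[OF tendsto_const]) (simp add: filterlim_at_top_imp_at_infinity filterlim_ident)
    from tendsto_real_sqrt[OF this] show "((\<lambda>c. sqrt (3 * K * (3 * C)\<^sup>2 / c)) \<longlongrightarrow> 0) at_top" by simp
  qed
  have energy: "(\<Sum>\<mu>=0..3. (slice_norm c (partial \<mu> u))\<^sup>2) = A\<^sup>2" for c
    unfolding u_def free_profile_slices(2) using \<kappa> by (simp add: K_def)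
  show ?thesis
  proof (intro exI[of _ u] conjI allI ballI)
    show "free_wave u" by (simp add: free_wave_def u_wave)
    show "slice_L2 c (partial \<mu> u)" if "\<mu> \<in> {0..3}" for c \<mu>
      unfolding u_def by (rule free_profile_slices(1)[OF that])
    show "\<exists>T \<phi>. quintic_solution_after T \<phi>
         \<and> (\<forall>\<mu>\<in>{0..3}.
              (\<forall>c>T. slice_L2 c (\<lambda>p. partial \<mu> (\<lambda>q. \<phi> q - soliton (snd q)) p - partial \<mu> u p))
              \<and> ((\<lambda>c. slice_norm c (\<lambda>p. partial \<mu> (\<lambda>q. \<phi> q - soliton (snd q)) p - partial \<mu> u p))
                   \<longlongrightarrow> 0) at_top)"
      by (intro exI[of _ T] exI[of _ \<phi>] conjI ballI allI impI sol lim)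
         (simp_all add: slice_eq(1) decay(1))
  qed (fact u_smooth energy)+
qed

end
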